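(* Let $\mathcal G$ be a connected noncompact metric graph satisfying Assumption (H), and consider the critical energy ($p=6$). Then $\mu_{\mathcal G}=\mu_{\mathbb R}$, and $\mathcal E_{\mathcal G}(\mu_{\mathbb R})=0$, this value being attained if and only if $\mathcal G$ is $\mathbb R$ or a bubble tower.
   Context: Metric graphs have finitely many edges and vertices, bounded edges identified with $[0,\ell_e]$ and halflines with $[0,\infty)$ (far endpoints: vertices at infinity); noncompact means at least one halfline. A trail is a path of adjacent edges traversing each edge exactly once. Assumption (H): every point of $\mathcal G$ lies on a trail containing two halflines (equivalently, after identifying all vertices at infinity, $\mathcal G$ admits a covering by cycles). A bubble tower is a graph obtained from $\mathbb R$ by identifying finitely many pairs of opposite points $x_j\sim-x_j$. $H^1_\mu(\mathcal G)$: continuous functions, $H^1$ on each edge, $\|u\|_2^2=\mu$. $E(u,\mathcal G)=\frac12\int|u'|^2-\frac16\int|u|^6$, $\mathcal E_{\mathcal G}(\mu)=\inf_{H^1_\mu(\mathcal G)}E(\cdot,\mathcal G)$. For a graph $X$, $K_X=\sup_{u\in H^1(X),u\ne0}\frac{\|u\|_6^6}{\|u\|_2^4\|u'\|_2^2}$ and $\mu_X=\sqrt{3/K_X}$; $\mu_{\mathbb R}=\pi\sqrt3/2$. *)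

theory Defs
  imports "HOL-Analysis.Analysis"
begin

section \<open>Noncompact metric graphs\<close>

text \<open>A metric graph: finitely many vertices and edges (loops and multiple edges allowed).
  Every edge e has a starting vertex src e.  A bounded edge (e not in halflines) is
  identified with [0, len e], its endpoint 0 sitting at src e and len e at tgt e.
  A halfline is identified with [0, infinity), its point 0 sitting at src e
  (its far endpoint is a vertex at infinity and is not an element of verts).\<close>

record ('v, 'e) mgraph =
  verts :: "'v set"
  edges :: "'e set"
  halflines :: "'e set"
  len :: "'e \<Rightarrow> real"
  src :: "'e \<Rightarrow> 'v"
  tgt :: "'e \<Rightarrow> 'v"

definition wf_mgraph :: "('v, 'e) mgraph \<Rightarrow> bool" where
  "wf_mgraph G \<longleftrightarrow> finite (verts G) \<and> finite (edges G) \<and> halflines G \<subseteq> edges G \<and>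
     (\<forall>e\<in>edges G. src G e \<in> verts G) \<and>
     (\<forall>e\<in>edges G - halflines G. tgt G e \<in> verts G \<and> len G e > 0)"

text \<open>The interval an edge is identified with.\<close>
definition edom :: "('v, 'e) mgraph \<Rightarrow> 'e \<Rightarrow> real set" where
  "edom G e = (if e \<in> halflines G then {0..} else {0..len G e})"

definition noncompact :: "('v, 'e) mgraph \<Rightarrow> bool" where
  "noncompact G \<longleftrightarrow> halflines G \<noteq> {}"

text \<open>Connectedness: any two vertices are joined by a chain of bounded edges
  (halflines are attached to a vertex, so this is connectedness of the graph).\<close>
definition adj :: "('v, 'e) mgraph \<Rightarrow> ('v \<times> 'v) set" where
  "adj G = {(v, w). \<exists>e\<in>edges G - halflines G.
               (src G e = v \<and> tgt G e = w) \<or> (src G e = w \<and> tgt G e = v)}"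

definition connected_mgraph :: "('v, 'e) mgraph \<Rightarrow> bool" where
  "connected_mgraph G \<longleftrightarrow> (\<forall>v\<in>verts G. \<forall>w\<in>verts G. (v, w) \<in> (adj G)\<^sup>*)"

section \<open>Trails and Assumption (H)\<close>

text \<open>A trail containing two halflines: a list of pairwise distinct edges es (each edge
  traversed exactly once), starting and ending with a halfline, all intermediate edges
  bounded, together with the list vs of the vertices visited, where vs!(i-1), vs!i are
  the endpoints of es!i (in either orientation).\<close>
definition trail2 :: "('v, 'e) mgraph \<Rightarrow> 'e list \<Rightarrow> 'v list \<Rightarrow> bool" where
  "trail2 G es vs \<longleftrightarrow>
     length es \<ge> 2 \<and> length vs = length es - 1 \<and> distinct es \<and> set es \<subseteq> edges G \<and>
     hd es \<in> halflines G \<and> last es \<in> halflines G \<and>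
     src G (hd es) = vs ! 0 \<and> src G (last es) = vs ! (length vs - 1) \<and>
     (\<forall>i. 0 < i \<and> i < length es - 1 \<longrightarrow>
        es ! i \<notin> halflines G \<and>
        ((src G (es ! i) = vs ! (i - 1) \<and> tgt G (es ! i) = vs ! i) \<or>
         (src G (es ! i) = vs ! i \<and> tgt G (es ! i) = vs ! (i - 1))))"

text \<open>Assumption (H): every point of G (every point of every edge and every vertex)
  lies on a trail containing two halflines.\<close>
definition assumption_H :: "('v, 'e) mgraph \<Rightarrow> bool" where
  "assumption_H G \<longleftrightarrow>
     (\<forall>e\<in>edges G. \<exists>es vs. trail2 G es vs \<and> e \<in> set es) \<and>
     (\<forall>v\<in>verts G. \<exists>es vs. trail2 G es vs \<and> v \<in> set vs)"

section \<open>The space H^1 and the energy\<close>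

text \<open>u e is the function on edge e, g e its (weak) derivative: u is H^1 on each edge
  (absolutely continuous with L^2 derivative, and L^2 itself) and continuous at the vertices.\<close>
definition H1pair :: "('v, 'e) mgraph \<Rightarrow> ('e \<Rightarrow> real \<Rightarrow> real) \<Rightarrow> ('e \<Rightarrow> real \<Rightarrow> real) \<Rightarrow> bool" where
  "H1pair G u g \<longleftrightarrow>
     (\<forall>e\<in>edges G.
        set_borel_measurable lborel (edom G e) (g e) \<and>
        set_integrable lborel (edom G e) (\<lambda>x. (g e x)^2) \<and>
        set_integrable lborel (edom G e) (\<lambda>x. (u e x)^2) \<and>
        (\<forall>x\<in>edom G e. u e x = u e 0 + set_lebesgue_integral lborel {0..x} (g e))) \<and>
     (\<exists>\<phi> :: 'v \<Rightarrow> real. \<forall>e\<in>edges G. u e 0 = \<phi> (src G e) \<and>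
        (e \<notin> halflines G \<longrightarrow> u e (len G e) = \<phi> (tgt G e)))"

definition Lnorm_pow :: "('v, 'e) mgraph \<Rightarrow> nat \<Rightarrow> ('e \<Rightarrow> real \<Rightarrow> real) \<Rightarrow> real" where
  "Lnorm_pow G p u = (\<Sum>e\<in>edges G. set_lebesgue_integral lborel (edom G e) (\<lambda>x. \<bar>u e x\<bar> ^ p))"

text \<open>E(u,G) = 1/2 ||u'||_2^2 - 1/6 ||u||_6^6\<close>
definition energy :: "('v, 'e) mgraph \<Rightarrow> ('e \<Rightarrow> real \<Rightarrow> real) \<Rightarrow> ('e \<Rightarrow> real \<Rightarrow> real) \<Rightarrow> real" where
  "energy G u g = Lnorm_pow G 2 g / 2 - Lnorm_pow G 6 u / 6"

definition H1_mass :: "('v, 'e) mgraph \<Rightarrow> real \<Rightarrow> (('e \<Rightarrow> real \<Rightarrow> real) \<times> ('e \<Rightarrow> real \<Rightarrow> real)) set" where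
  "H1_mass G \<mu> = {(u, g). H1pair G u g \<and> Lnorm_pow G 2 u = \<mu>}"

text \<open>The ground state energy level, as an extended real (it may be -infinity a priori).\<close>
definition energy_level :: "('v, 'e) mgraph \<Rightarrow> real \<Rightarrow> ereal" where
  "energy_level G \<mu> = (INF p\<in>H1_mass G \<mu>. ereal (energy G (fst p) (snd p)))"

text \<open>Gagliardo-Nirenberg constant K_G (possibly +infinity a priori) and mu_G = sqrt(3/K_G)
  (with the convention 3/infinity = 0).\<close>
definition K_const :: "('v, 'e) mgraph \<Rightarrow> ereal" where
  "K_const G = (SUP p\<in>{(u, g). H1pair G u g \<and> (\<exists>e\<in>edges G. \<exists>x\<in>edom G e. u e x \<noteq> 0)}.
      ereal (Lnorm_pow G 6 (fst p) / ((Lnorm_pow G 2 (fst p))^2 * Lnorm_pow G 2 (snd p))))"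

definition mu_const :: "('v, 'e) mgraph \<Rightarrow> real" where
  "mu_const G = (if K_const G = \<infinity> then 0 else sqrt (3 / real_of_ereal (K_const G)))"

text \<open>mu_R = pi sqrt 3 / 2\<close>
definition mu_R :: real where
  "mu_R = pi * sqrt 3 / 2"

section \<open>The real line and bubble towers\<close>

text \<open>Points of G are represented by positions (e, x) with x in the interval of e;
  two positions are the same point iff equal or both are the same vertex.\<close>
definition positions :: "('v, 'e) mgraph \<Rightarrow> ('e \<times> real) set" where
  "positions G = {(e, x). e \<in> edges G \<and> x \<in> edom G e}"

definition vertex_at :: "('v, 'e) mgraph \<Rightarrow> 'e \<times> real \<Rightarrow> 'v option" where
  "vertex_at G p = (if snd p = 0 then Some (src G (fst p))
      else if fst p \<notin> halflines G \<and> snd p = len G (fst p) then Some (tgt G (fst p))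
      else None)"

definition same_point :: "('v, 'e) mgraph \<Rightarrow> 'e \<times> real \<Rightarrow> 'e \<times> real \<Rightarrow> bool" where
  "same_point G p q \<longleftrightarrow> p = q \<or> (vertex_at G p \<noteq> None \<and> vertex_at G p = vertex_at G q)"

text \<open>G is (isometric, as a metric graph, to) the graph obtained from R by identifying
  x ~ -x for every x in X: there is a surjective map phi from R onto the points of G which
  locally runs along edges at unit speed, and identifies exactly the pairs x, -x (x in X).\<close>
definition from_line :: "('v, 'e) mgraph \<Rightarrow> real set \<Rightarrow> bool" where
  "from_line G X \<longleftrightarrow> (\<exists>\<phi> :: real \<Rightarrow> 'e \<times> real.
     (\<forall>t. \<phi> t \<in> positions G) \<and>
     (\<forall>p\<in>positions G. \<exists>t. same_point G (\<phi> t) p) \<and>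
     (\<forall>s t. same_point G (\<phi> s) (\<phi> t) \<longleftrightarrow>
              s = t \<or> (\<exists>x\<in>X. (s = x \<and> t = - x) \<or> (s = - x \<and> t = x))) \<and>
     (\<forall>t. \<exists>\<epsilon>>0. \<exists>e1 a1 \<sigma>1 e2 a2 \<sigma>2. \<sigma>1 \<in> {-1, 1} \<and> \<sigma>2 \<in> {-1, 1 :: real} \<and>
        (\<forall>s\<in>{t - \<epsilon>..t}. (e1, a1 + \<sigma>1 * (s - t)) \<in> positions G \<and>
                          same_point G (\<phi> s) (e1, a1 + \<sigma>1 * (s - t))) \<and>
        (\<forall>s\<in>{t..t + \<epsilon>}. (e2, a2 + \<sigma>2 * (s - t)) \<in> positions G \<and>
                          same_point G (\<phi> s) (e2, a2 + \<sigma>2 * (s - t)))))"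

definition is_real_line :: "('v, 'e) mgraph \<Rightarrow> bool" where
  "is_real_line G \<longleftrightarrow> from_line G {}"

definition bubble_tower :: "('v, 'e) mgraph \<Rightarrow> bool" where
  "bubble_tower G \<longleftrightarrow> (\<exists>X. finite X \<and> X \<noteq> {} \<and> X \<subseteq> {0<..} \<and> from_line G X)"

end

(*
  Let M be the maximum of |u|.  The soliton of height M solves |phi'| = f(phi) with
  f(t) = t sqrt((M^4 - t^4) / 3), so completing the square gives
    E(u) + (M^4 / 6) ||u||_2^2 = (1/2) int (|u'|^2 + f(u)^2) >= int |u'| |f(u)|.
  By (H) the maximum point lies on a trail with two halflines; along it |u| rises from 0 to M and
  falls back to 0, so the right-hand side is at least 2 int_0^M f = (M^4 / 6) mu_R.  Hence
  E(u) >= (M^4 / 6) (mu_R - ||u||_2^2), which is the sharp inequality, and solitons cut off and placed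
  on a halfline show optimality.

  If E(u) = 0 at mass mu_R, all inequalities are equalities: on the trail u solves u' = +-f(u), first
  increasing and then decreasing in modulus.  The two monotone branches already carry the mass mu_R, so
  there is neither a plateau at the maximum nor any mass off the trail.  Hence the trail covers G, and
  the value of |u| determines the distance to the maximum point along the trail; so the trail can only
  revisit a vertex at opposite times.  Conversely an even soliton descends to any such quotient of R.
*)
theory Submission
  imports Defs
begin

section \<open>Absolutely continuous functions on an interval\<close>

text \<open>The calibration uses the height M of the function itself: f is then real on the range of
  u and vanishes at the top. The ODE u' = +-f(u) behaves oppositely at its two zeros. Near 0, f is
  Lipschitz, so a nonzero u cannot reach 0 at a finite distance; by connectedness u is then nonzero
  on all of G, which excludes edges off the trail. Near M, f is like a square root and solutions may
  rest at height M, so the ODE alone does not exclude a plateau.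

  Trails cross bounded edges in either direction. To keep orientations out of the estimates, every
  edge gets one peak p, its point nearest to the maximum along the trail, and each edge bound has
  the form 2F(p) - F(one end) - F(other end), which ignores direction and sums to 2F at the maximum
  when F(0) = 0. The primitive of f gives the energy bound, an arcsine the mass bound.

  Conversely, the definition of a quotient of R offers only local unit speed arcs, up to
  identification of points. Finiteness of the identified set excludes folding and double covering,
  so each edge is an affine piece of the line.\<close>

lemma set_integral_split_at:
  fixes h :: "real \<Rightarrow> real"
  assumes "set_integrable lborel A h" "A \<in> sets borel"
  shows "(LINT x:A|lborel. h x) = (LINT x:A \<inter> {..b}|lborel. h x) + (LINT x:A \<inter> {b..}|lborel. h x)"
proof -
  have i: "set_integrable lborel (A \<inter> {..b}) h" "set_integrable lborel (A \<inter> {b..}) h"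
    using assms by (auto intro: set_integrable_subset)
  have "AE x in lborel. x \<noteq> b" by (rule AE_lborel_singleton)
  then have "AE x in lborel. \<not> (x \<in> A \<inter> {..b} \<and> x \<in> A \<inter> {b..})"
    by eventually_elim auto
  from set_integral_Un_AE[OF this _ _ i]
  have "(LINT x:(A \<inter> {..b}) \<union> (A \<inter> {b..})|lborel. h x)
      = (LINT x:A \<inter> {..b}|lborel. h x) + (LINT x:A \<inter> {b..}|lborel. h x)"
    using assms by auto
  moreover have "(A \<inter> {..b}) \<union> (A \<inter> {b..}) = A" by auto
  ultimately show ?thesis by simp
qed

lemma set_integral_split_Icc:
  fixes h :: "real \<Rightarrow> real"
  assumes "set_integrable lborel {a..c} h" "a \<le> b" "b \<le> c"
  shows "(LINT x:{a..c}|lborel. h x) = (LINT x:{a..b}|lborel. h x) + (LINT x:{b..c}|lborel. h x)"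
  using set_integral_split_at[OF assms(1), of b] assms by (simp add: min_absorb2 max_absorb2)

lemma set_integral_nonneg':
  fixes h :: "real \<Rightarrow> real"
  assumes "\<And>x. x \<in> A \<Longrightarrow> 0 \<le> h x"
  shows "0 \<le> (LINT x:A|M. h x)"
  using assms unfolding set_lebesgue_integral_def
  by (intro integral_nonneg_AE) (auto split: split_indicator)

lemma set_integral_subset_mono:
  fixes h :: "real \<Rightarrow> real"
  assumes "set_integrable lborel A h" "B \<subseteq> A" "B \<in> sets borel" "\<And>x. x \<in> A \<Longrightarrow> 0 \<le> h x"
  shows "(LINT x:B|lborel. h x) \<le> (LINT x:A|lborel. h x)"
proof -
  have "set_integrable lborel B h" using assms by (auto intro: set_integrable_subset)
  then show ?thesis using assms unfolding set_integrable_def set_lebesgue_integral_def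
    by (intro integral_mono) (auto split: split_indicator)
qed

lemma indefinite_set_integral_continuous:
  fixes g :: "real \<Rightarrow> real"
  assumes "set_integrable lborel {a..b} g" "\<And>x. x \<in> {a..b} \<Longrightarrow> u x = u a + (LINT y:{a..x}|lborel. g y)"
  shows "continuous_on {a..b} u"
proof -
  have "(LINT y:{a..x}|lborel. g y) = integral {a..x} g" if "x \<in> {a..b}" for x
    by (rule set_borel_integral_eq_integral) (use that assms in \<open>auto intro: set_integrable_subset\<close>)
  then have eq: "u a + integral {a..x} g = u x" if "x \<in> {a..b}" for x using assms(2)[OF that] that by simp
  have "continuous_on {a..b} (\<lambda>x. u a + integral {a..x} g)"
    by (intro continuous_intros indefinite_integral_continuous_1 set_borel_integral_eq_integral assms(1))
  then show ?thesis by (rule continuous_on_eq) (rule eq)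
qed

lemma set_integrable_continuous_mult:
  fixes g h :: "real \<Rightarrow> real"
  assumes "set_integrable lborel {a..b} g" "continuous_on {a..b} h"
  shows "set_integrable lborel {a..b} (\<lambda>x. h x * g x)"
proof -
  obtain C where C: "\<And>x. x \<in> {a..b} \<Longrightarrow> \<bar>h x\<bar> \<le> C"
    using compact_imp_bounded[OF compact_continuous_image[OF assms(2)]] unfolding bounded_iff by force
  have m: "set_borel_measurable lborel {a..b} h"
    using borel_measurable_continuous_on_indicator[OF _ assms(2)] unfolding set_borel_measurable_def
    by (simp)
  have eq: "indicat_real {a..b} x *\<^sub>R (h x * g x) = (indicator {a..b} x *\<^sub>R h x) * (indicator {a..b} x *\<^sub>R g x)" for x
    by (auto split: split_indicator)
  have "(\<lambda>x. indicator {a..b} x *\<^sub>R g x) \<in> borel_measurable lborel"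
    using assms(1) unfolding set_integrable_def by (rule borel_measurable_integrable)
  then have m: "set_borel_measurable lborel {a..b} (\<lambda>x. h x * g x)"
    using m unfolding set_borel_measurable_def eq by (rule borel_measurable_times[rotated])
  have "\<bar>h x * g x\<bar> \<le> \<bar>C * g x\<bar>" if "x \<in> {a..b}" for x
    using mult_right_mono[OF order_trans[OF C[OF that] abs_ge_self], of "\<bar>g x\<bar>"] by (simp add: abs_mult)
  then show ?thesis
    by (intro set_integrable_bound[OF set_integrable_mult_right[OF assms(1), of C] m] AE_I2) auto
qed

text \<open>The estimate \<open>\<bar>F(u y) - F(u x) - \<integral> f(u) g\<bar> \<le> \<epsilon> \<integral> \<bar>g\<bar>\<close> on \<open>[x, y]\<close> is additive in the interval
  and holds on short intervals by the mean value theorem, so it globalises by bisection.\<close>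
lemma absolutely_continuous_chain_rule:
  fixes u g F f :: "real \<Rightarrow> real"
  assumes ab: "a \<le> b" and g: "set_integrable lborel {a..b} g"
    and u: "\<And>x. x \<in> {a..b} \<Longrightarrow> u x = u a + (LINT y:{a..x}|lborel. g y)"
    and rng: "\<And>x. x \<in> {a..b} \<Longrightarrow> u x \<in> {m..M}"
    and F: "continuous_on {m..M} F" and f: "continuous_on {m..M} f"
    and d: "\<And>t. m < t \<Longrightarrow> t < M \<Longrightarrow> (F has_real_derivative f t) (at t)"
  shows "F (u b) - F (u a) = (LINT x:{a..b}|lborel. f (u x) * g x)"
proof -
  have uc: "continuous_on {a..b} u" using indefinite_set_integral_continuous g u by blast
  have fuc: "continuous_on {a..b} (\<lambda>x. f (u x))"
    by (rule continuous_on_compose2[OF f uc]) (use rng in auto)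
  have fg: "set_integrable lborel {a..b} (\<lambda>x. f (u x) * g x)"
    by (rule set_integrable_continuous_mult[OF g fuc])
  have sub: "set_integrable lborel {x..y} h" if "set_integrable lborel {a..b} h" "a \<le> x" "y \<le> b"
    for h :: "real \<Rightarrow> real" and x y
    by (rule set_integrable_subset[OF that(1)]) (use that in auto)
  have inc: "u y - u x = (LINT z:{x..y}|lborel. g z)" if "a \<le> x" "x \<le> y" "y \<le> b" for x y
    using u[of x] u[of y] set_integral_split_Icc[OF sub[OF g, of a y], of x] that by simp
  \<comment> \<open>Only interior derivatives are available, since \<open>calF M\<close> will be
    used up to height M, where the arcsine has none; the mean value theorem needs no more.\<close>
  have mv: "\<exists>\<xi>. \<bar>\<xi> - p\<bar> \<le> \<bar>q - p\<bar> \<and> \<xi> \<in> {m..M} \<and> F q - F p = f \<xi> * (q - p)"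
    if pq: "p \<in> {m..M}" "q \<in> {m..M}" for p q
  proof -
    have *: "\<exists>\<xi>. p < \<xi> \<and> \<xi> < q \<and> F q - F p = f \<xi> * (q - p)" if "p < q" "m \<le> p" "q \<le> M" for p q
    proof -
      have "continuous_on {p..q} F" by (rule continuous_on_subset[OF F]) (use that in auto)
      moreover have "F differentiable (at x)" if "p < x" "x < q" for x
        using d[of x] that \<open>m \<le> p\<close> \<open>q \<le> M\<close> by (auto simp: real_differentiable_def)
      ultimately obtain l z where "p < z" "z < q" "(F has_real_derivative l) (at z)" "F q - F p = (q - p) * l"
        using MVT[of p q F] \<open>p < q\<close> by blast
      moreover from this have "l = f z" using DERIV_unique[OF _ d[of z]] that by auto
      ultimately show ?thesis by (intro exI[of _ z]) auto
    qed
    consider "p = q" | "p < q" | "q < p" by linarith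
    then show ?thesis
    proof cases
      case 1 then show ?thesis using that by (intro exI[of _ p]) auto
    next
      case 2 then obtain \<xi> where "p < \<xi>" "\<xi> < q" "F q - F p = f \<xi> * (q - p)" using *[of p q] pq by auto
      then show ?thesis using pq by (intro exI[of _ \<xi>]) auto
    next
      case 3 then obtain \<xi> where "q < \<xi>" "\<xi> < p" "F p - F q = f \<xi> * (p - q)" using *[of q p] pq by auto
      then show ?thesis using pq by (intro exI[of _ \<xi>]) (auto simp: algebra_simps)
    qed
  qed
  have main: "\<bar>F (u b) - F (u a) - (LINT x:{a..b}|lborel. f (u x) * g x)\<bar> \<le> e * (LINT x:{a..b}|lborel. \<bar>g x\<bar>)"
    if "e > 0" for e
  proof -
    let ?P = "\<lambda>x y. a \<le> x \<longrightarrow> y \<le> b \<longrightarrow> \<bar>F (u y) - F (u x) - (LINT z:{x..y}|lborel. f (u z) * g z)\<bar>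
                \<le> e * (LINT z:{x..y}|lborel. \<bar>g z\<bar>)"
    have uf: "uniformly_continuous_on {m..M} f" by (rule compact_uniformly_continuous[OF f]) simp
    from this[unfolded uniformly_continuous_on_def dist_real_def, rule_format, OF \<open>e > 0\<close>]
    obtain dl where dl: "dl > 0" "\<And>s t. s \<in> {m..M} \<Longrightarrow> t \<in> {m..M} \<Longrightarrow> \<bar>s - t\<bar> < dl \<Longrightarrow> \<bar>f s - f t\<bar> < e"
      by blast
    have "?P a b"
    proof (rule Bolzano[of a b ?P, OF ab])
      fix x y z assume trans: "?P x y" "?P y z" and "x \<le> y" "y \<le> z"
      show "?P x z"
      proof (intro impI)
        assume "a \<le> x" "z \<le> b"
        then have i: "set_integrable lborel {x..z} (\<lambda>t. f (u t) * g t)" "set_integrable lborel {x..z} (\<lambda>t. \<bar>g t\<bar>)"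
          by (rule sub[OF fg] sub[OF set_integrable_abs[OF g]])+
        have "(LINT t:{x..z}|lborel. f (u t) * g t) = (LINT t:{x..y}|lborel. f (u t) * g t) + (LINT t:{y..z}|lborel. f (u t) * g t)"
            "(LINT t:{x..z}|lborel. \<bar>g t\<bar>) = (LINT t:{x..y}|lborel. \<bar>g t\<bar>) + (LINT t:{y..z}|lborel. \<bar>g t\<bar>)"
          using set_integral_split_Icc[OF i(1)] set_integral_split_Icc[OF i(2)] \<open>x \<le> y\<close> \<open>y \<le> z\<close> by auto
        then show "\<bar>F (u z) - F (u x) - (LINT t:{x..z}|lborel. f (u t) * g t)\<bar> \<le> e * (LINT t:{x..z}|lborel. \<bar>g t\<bar>)"
          using trans(1,2) \<open>x \<le> y\<close> \<open>y \<le> z\<close> \<open>a \<le> x\<close> \<open>z \<le> b\<close> unfolding distrib_left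
          by (smt (verit) distrib_left)
      qed
    next
      fix x0 assume local: "a \<le> x0" "x0 \<le> b"
      \<comment> \<open>With oscillation below dl / 4 around x0, u varies by at most dl / 2 on
        [x, y]; the mean value point lies within dl / 2 of u x, hence within dl of every u
        z.\<close>
      obtain r where r: "r > 0" "\<And>x. x \<in> {a..b} \<Longrightarrow> \<bar>x - x0\<bar> < r \<Longrightarrow> \<bar>u x - u x0\<bar> < dl / 4"
        using uc[unfolded continuous_on_iff dist_real_def, rule_format, of x0 "dl / 4"] local dl(1) by auto
      show "\<exists>d>0. \<forall>x y. x \<le> x0 \<and> x0 \<le> y \<and> y - x < d \<longrightarrow> ?P x y"
      proof (intro exI[of _ r] conjI r(1) allI impI)
        fix x y assume h: "x \<le> x0 \<and> x0 \<le> y \<and> y - x < r" and "a \<le> x" "y \<le> b"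
        have near: "\<bar>u z - u x0\<bar> < dl / 4" "u z \<in> {m..M}" if "z \<in> {x..y}" for z
          using r(2)[of z] rng[of z] h \<open>a \<le> x\<close> \<open>y \<le> b\<close> that by auto
        have xy: "x \<le> y" using h by auto
        obtain \<xi> where xi: "\<bar>\<xi> - u x\<bar> \<le> \<bar>u y - u x\<bar>" "\<xi> \<in> {m..M}" "F (u y) - F (u x) = f \<xi> * (u y - u x)"
          using mv[OF near(2) near(2), of x y] xy by auto
        have i1: "set_integrable lborel {x..y} g" "set_integrable lborel {x..y} (\<lambda>z. f (u z) * g z)"
          using sub g fg \<open>a \<le> x\<close> \<open>y \<le> b\<close> by auto
        have i2: "set_integrable lborel {x..y} (\<lambda>z. f \<xi> * g z - f (u z) * g z)"
          using i1 by (intro set_integral_diff) auto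
        have "F (u y) - F (u x) - (LINT z:{x..y}|lborel. f (u z) * g z)
             = (LINT z:{x..y}|lborel. f \<xi> * g z - f (u z) * g z)"
          using inc[OF \<open>a \<le> x\<close> xy \<open>y \<le> b\<close>] xi i1 by (subst set_integral_diff) auto
        also have "\<bar>\<dots>\<bar> \<le> (LINT z:{x..y}|lborel. \<bar>f \<xi> * g z - f (u z) * g z\<bar>)"
          using set_integral_norm_bound[OF i2] by simp
        also have "\<dots> \<le> (LINT z:{x..y}|lborel. e * \<bar>g z\<bar>)"
        proof (rule set_integral_mono)
          fix z assume z: "z \<in> {x..y}"
          have "\<bar>u x - u x0\<bar> < dl / 4" "\<bar>u y - u x0\<bar> < dl / 4" "\<bar>u z - u x0\<bar> < dl / 4"
            using near(1) xy z by auto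
          then have "\<bar>u y - u x\<bar> \<le> dl / 2" "\<bar>u z - u x\<bar> < dl / 2" by linarith+
          then have "\<bar>\<xi> - u z\<bar> < dl" using xi by linarith
          then have "\<bar>f \<xi> - f (u z)\<bar> \<le> e" using dl(2)[OF xi(2) near(2)[OF z]] by auto
          moreover have "\<bar>f \<xi> * g z - f (u z) * g z\<bar> = \<bar>f \<xi> - f (u z)\<bar> * \<bar>g z\<bar>"
            by (simp add: abs_mult[symmetric] left_diff_distrib)
          ultimately show "\<bar>f \<xi> * g z - f (u z) * g z\<bar> \<le> e * \<bar>g z\<bar>" by (simp add: mult_right_mono)
        qed (use i1 i2 in \<open>auto intro!: set_integrable_abs\<close>)
        finally show "\<bar>F (u y) - F (u x) - (LINT z:{x..y}|lborel. f (u z) * g z)\<bar> \<le> e * (LINT z:{x..y}|lborel. \<bar>g z\<bar>)"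
          by simp
      qed
    qed
    then show ?thesis by simp
  qed
  let ?D = "\<bar>F (u b) - F (u a) - (LINT x:{a..b}|lborel. f (u x) * g x)\<bar>" and ?I = "LINT x:{a..b}|lborel. \<bar>g x\<bar>"
  have I: "?I \<ge> 0" by (rule set_integral_nonneg') auto
  have "?D \<le> 0 + e" if "e > 0" for e
  proof -
    \<comment> \<open>The + 1 covers the case that the integral of |g| is 0.\<close>
    have "?D \<le> (e / (?I + 1)) * ?I" using main[of "e / (?I + 1)"] I that by auto
    also have "\<dots> \<le> e" using I that by (simp add: field_simps)
    finally show ?thesis by simp
  qed
  then have "?D \<le> 0" by (rule field_le_epsilon)
  then show ?thesis by simp
qed

section \<open>H^1 functions on a single edge\<close>

definition edge_interval :: "real set \<Rightarrow> bool" where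
  "edge_interval D \<longleftrightarrow> D = {0..} \<or> (\<exists>l>0. D = {0..l})"

definition H1_on :: "real set \<Rightarrow> (real \<Rightarrow> real) \<Rightarrow> (real \<Rightarrow> real) \<Rightarrow> bool" where
  "H1_on D u g \<longleftrightarrow> edge_interval D \<and> set_borel_measurable lborel D g \<and>
     set_integrable lborel D (\<lambda>x. (g x)\<^sup>2) \<and> set_integrable lborel D (\<lambda>x. (u x)\<^sup>2) \<and>
     (\<forall>x\<in>D. u x = u 0 + (LINT y:{0..x}|lborel. g y))"

lemma edge_interval_borel: "edge_interval D \<Longrightarrow> D \<in> sets borel"
  by (auto simp: edge_interval_def)

lemma edge_interval_sub: "edge_interval D \<Longrightarrow> b \<in> D \<Longrightarrow> 0 \<le> a \<Longrightarrow> {a..b} \<subseteq> D"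
  by (auto simp: edge_interval_def)

lemma edge_interval_ge0: "edge_interval D \<Longrightarrow> x \<in> D \<Longrightarrow> 0 \<le> x"
  by (auto simp: edge_interval_def)

lemma edge_interval_0: "edge_interval D \<Longrightarrow> 0 \<in> D"
  by (auto simp: edge_interval_def)

text \<open>On a bounded interval L^2 gives L^1, since |t| \<le> 1 + t^2.\<close>

lemma H1_on_integrable:
  assumes "H1_on D u g" "0 \<le> a" "b \<in> D"
  shows "set_integrable lborel {a..b} g"
proof -
  have D: "edge_interval D" using assms by (auto simp: H1_on_def)
  have s: "{a..b} \<subseteq> D" by (rule edge_interval_sub[OF D assms(3,2)])
  have m: "set_borel_measurable lborel {a..b} g"
    using assms s unfolding H1_on_def by (auto intro: set_borel_measurable_subset)
  have i: "set_integrable lborel {a..b} (\<lambda>x. 1 + (g x)\<^sup>2)"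
    by (intro set_integral_add(1) set_integrable_subset[OF _ _ s, of lborel "\<lambda>x. (g x)\<^sup>2"])
       (use assms in \<open>auto simp: H1_on_def intro: borel_integrable_atLeastAtMost'\<close>)
  have "norm t \<le> norm (1 + t\<^sup>2)" for t :: real
    using zero_le_power2[of "\<bar>t\<bar> - 1/2"] by (simp add: power2_diff power_divide)
  then show ?thesis by (intro set_integrable_bound[OF i m] AE_I2 impI)
qed

lemma H1_on_increment:
  assumes "H1_on D u g" "0 \<le> a" "b \<in> D" "x \<in> {a..b}"
  shows "u x = u a + (LINT y:{a..x}|lborel. g y)"
proof -
  have D: "edge_interval D" using assms by (auto simp: H1_on_def)
  have x: "x \<in> D" "a \<in> D" using edge_interval_sub[OF D assms(3,2)] assms by auto
  have "u x = u 0 + (LINT y:{0..x}|lborel. g y)" "u a = u 0 + (LINT y:{0..a}|lborel. g y)"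
    using assms x unfolding H1_on_def by blast+
  then show ?thesis
    using set_integral_split_Icc[OF H1_on_integrable[OF assms(1) order.refl x(1)], of a] assms by simp
qed

lemma H1_on_continuous_Icc:
  assumes "H1_on D u g" "0 \<le> a" "b \<in> D"
  shows "continuous_on {a..b} u"
  using indefinite_set_integral_continuous[OF H1_on_integrable[OF assms]] H1_on_increment[OF assms] by blast

lemma H1_on_continuous:
  assumes "H1_on D u g"
  shows "continuous_on D u"
proof -
  consider "D = {0..}" | l where "l > 0" "D = {0..l}" using assms by (auto simp: H1_on_def edge_interval_def)
  then show ?thesis
  proof cases
    case 1
    have "continuous (at x within {0..}) u" if "x \<ge> 0" for x
    proof -
      have "continuous (at x within {0..x+1}) u"
        using H1_on_continuous_Icc[OF assms, of 0 "x+1"] 1 that by (auto simp: continuous_on_eq_continuous_within)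
      moreover have "at x within {0..} = at x within {0..x+1}"
        by (rule at_within_nhd[of x "{..<x+1}"]) auto
      ultimately show ?thesis by simp
    qed
    then show ?thesis using 1 by (simp add: continuous_on_eq_continuous_within)
  next
    case 2 then show ?thesis using H1_on_continuous_Icc[OF assms, of 0 l] by auto
  qed
qed

text \<open>Halflines have to behave like edges whose far end carries the value 0. The bound
  \<open>bd\<close> controls (u b)^2 by twice the H^1 tail beyond b, and tails of integrable
  functions vanish.\<close>

lemma H1_on_halfline_decay:
  assumes "H1_on {0..} u g"
  shows "(u \<longlongrightarrow> 0) at_top"
proof -
  have iu: "set_integrable lborel {0..} (\<lambda>x. (u x)\<^sup>2)" and ig: "set_integrable lborel {0..} (\<lambda>x. (g x)\<^sup>2)"
    using assms by (auto simp: H1_on_def)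
  define N where "N h b = (LINT x:{b..}|lborel. h x)" for h :: "real \<Rightarrow> real" and b
  have tail: "(N h \<longlongrightarrow> 0) at_top" if i: "set_integrable lborel {0..} h" for h
  proof -
    \<comment> \<open>\<open>max 0 b\<close> keeps the domain inside the halfline for negative b,
      since nothing is known of h outside it.\<close>
    have "((\<lambda>b. LINT x|lborel. indicat_real {max 0 b..} x * h x) \<longlongrightarrow> (LINT x|(lborel :: real measure). 0)) at_top"
    proof (rule integral_dominated_convergence_at_top[where w="\<lambda>x. indicator {0..} x * \<bar>h x\<bar>"])
      have m: "(\<lambda>x. indicat_real {0..} x * h x) \<in> borel_measurable lborel"
        using i by (auto simp: set_integrable_def)
      have "(\<lambda>x. indicat_real {max 0 b..} x * (indicat_real {0..} x * h x)) \<in> borel_measurable lborel" for b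
        by (intro borel_measurable_times m) auto
      moreover have "indicat_real {max 0 b..} x * (indicat_real {0..} x * h x) = indicat_real {max 0 b..} x * h x" for b x
        by (auto split: split_indicator)
      ultimately show "(\<lambda>x. indicat_real {max 0 b..} x * h x) \<in> borel_measurable lborel" for b by simp
      show "integrable lborel (\<lambda>x. indicator {0..} x * \<bar>h x\<bar>)"
        using set_integrable_abs[OF i] by (simp add: set_integrable_def)
      show "AE x in lborel. ((\<lambda>b. indicat_real {max 0 b..} x * h x) \<longlongrightarrow> 0) at_top"
      proof (intro AE_I2 tendsto_eventually)
        fix x :: real
        show "\<forall>\<^sub>F b in at_top. indicat_real {max 0 b..} x * h x = 0"
          using eventually_gt_at_top[of x] by eventually_elim (auto split: split_indicator)
      qed
    qed (auto split: split_indicator)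
    moreover have "\<forall>\<^sub>F b in at_top. (LINT x|lborel. indicat_real {max 0 b..} x * h x) = N h b"
      using eventually_ge_at_top[of 0]
      by eventually_elim (auto simp: N_def set_lebesgue_integral_def max_absorb2)
    ultimately show ?thesis using tendsto_cong by fastforce
  qed
  have iug: "set_integrable lborel {0..} (\<lambda>x. (u x)\<^sup>2 + (g x)\<^sup>2)" using iu ig by auto
  \<comment> \<open>Morrey-type bound: on a unit interval, \<open>u\<^sup>2\<close> is controlled by the local \<open>H\<^sup>1\<close> norm.\<close>
  have bd: "(u b)\<^sup>2 \<le> 2 * N (\<lambda>x. (u x)\<^sup>2 + (g x)\<^sup>2) b" if b: "b \<ge> 0" for b
  proof -
    let ?h = "\<lambda>x. (u x)\<^sup>2 + (g x)\<^sup>2"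
    have isub: "set_integrable lborel {b..b+1} ?h" by (rule set_integrable_subset[OF iug]) (use b in auto)
    have le: "(u b)\<^sup>2 \<le> (u x)\<^sup>2 + (LINT y:{b..b+1}|lborel. ?h y)" if x: "x \<in> {b..b+1}" for x
    proof -
      have D: "x \<in> {0..}" using x b by auto
      have gx: "set_integrable lborel {b..x} g" by (rule H1_on_integrable[OF assms b D])
      have cu: "continuous_on {b..x} u" by (rule H1_on_continuous_Icc[OF assms b D])
      obtain C where C: "\<And>z. z \<in> {b..x} \<Longrightarrow> \<bar>u z\<bar> \<le> C"
        using compact_imp_bounded[OF compact_continuous_image[OF cu]] unfolding bounded_iff by force
      have "(u x)\<^sup>2 - (u b)\<^sup>2 = (LINT y:{b..x}|lborel. (2 * u y) * g y)"
        by (rule absolutely_continuous_chain_rule[where m="-C" and M=C and F="\<lambda>t. t\<^sup>2" and f="\<lambda>t. 2 * t"])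
           (use x in simp, rule gx, erule H1_on_increment[OF assms b D], use C in \<open>fastforce simp: abs_le_iff\<close>,
            auto intro!: derivative_eq_intros continuous_intros)
      moreover have "- (LINT y:{b..x}|lborel. ?h y) \<le> (LINT y:{b..x}|lborel. (2 * u y) * g y)"
      proof -
        have i3: "set_integrable lborel {b..x} ?h" by (rule set_integrable_subset[OF isub]) (use x in auto)
        have "(LINT y:{b..x}|lborel. - ?h y) \<le> (LINT y:{b..x}|lborel. (2 * u y) * g y)"
        proof (rule set_integral_mono)
          show "set_integrable lborel {b..x} (\<lambda>y. - ((u y)\<^sup>2 + (g y)\<^sup>2))"
            using set_integrable_mult_right[OF i3, of "-1"] by simp
          show "set_integrable lborel {b..x} (\<lambda>y. (2 * u y) * g y)"
            by (intro set_integrable_continuous_mult gx continuous_intros cu)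
          show "- ((u y)\<^sup>2 + (g y)\<^sup>2) \<le> (2 * u y) * g y" for y
            using zero_le_power2[of "u y + g y"] by (simp add: power2_sum)
        qed
        then show ?thesis unfolding set_integral_uminus[OF i3] .
      qed
      moreover have "(LINT y:{b..x}|lborel. ?h y) \<le> (LINT y:{b..b+1}|lborel. ?h y)"
        by (rule set_integral_subset_mono[OF isub]) (use x in auto)
      ultimately show ?thesis by linarith
    qed
    have iu1: "set_integrable lborel {b..b+1} (\<lambda>x. (u x)\<^sup>2)"
      by (rule set_integrable_subset[OF iu]) (use b in auto)
    have cst: "set_integrable lborel {b..b+1} (\<lambda>x. c)" for c :: real
      by (simp add: set_integrable_def)
    \<comment> \<open>Average \<open>le\<close> over the unit interval: the integral of u^2 and the
      constant each contribute one H^1 integral, hence the factor 2.\<close>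
    have "(LINT x:{b..b+1}|lborel. (u b)\<^sup>2) \<le> (LINT x:{b..b+1}|lborel. (u x)\<^sup>2 + (LINT y:{b..b+1}|lborel. ?h y))"
      by (rule set_integral_mono[OF cst set_integral_add(1)[OF iu1 cst]]) (rule le)
    also have "\<dots> = (LINT x:{b..b+1}|lborel. (u x)\<^sup>2) + (LINT y:{b..b+1}|lborel. ?h y)"
      by (subst set_integral_add(2)[OF iu1 cst]) (simp add: set_lebesgue_integral_def)
    also have "(LINT x:{b..b+1}|lborel. (u x)\<^sup>2) \<le> (LINT x:{b..b+1}|lborel. ?h x)"
      by (rule set_integral_mono[OF iu1 isub]) auto
    also have "(LINT x:{b..b+1}|lborel. ?h x) \<le> N ?h b"
      unfolding N_def by (rule set_integral_subset_mono[OF set_integrable_subset[OF iug, of "{b..}"]]) (use b in auto)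
    finally show ?thesis by (simp add: set_lebesgue_integral_def)
  qed
  have "((\<lambda>b. (u b)\<^sup>2) \<longlongrightarrow> 0) at_top"
  proof (rule tendsto_sandwich[of "\<lambda>_. 0"])
    show "\<forall>\<^sub>F b in at_top. (u b)\<^sup>2 \<le> 2 * N (\<lambda>x. (u x)\<^sup>2 + (g x)\<^sup>2) b"
      using eventually_ge_at_top[of 0] by eventually_elim (rule bd)
    show "((\<lambda>b. 2 * N (\<lambda>x. (u x)\<^sup>2 + (g x)\<^sup>2) b) \<longlongrightarrow> 0) at_top"
      using tendsto_mult_left[OF tail[OF iug], of 2] by simp
  qed auto
  then have "((\<lambda>b. sqrt ((u b)\<^sup>2)) \<longlongrightarrow> sqrt 0) at_top" by (intro tendsto_intros)
  then show ?thesis by (simp add: tendsto_rabs_zero_iff)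
qed

text \<open>By decay, points far out cannot beat a given nonzero value, which reduces the halfline
  to a compact interval; u = 0 is treated apart.\<close>

lemma H1_on_attains_max:
  assumes "H1_on D u g"
  shows "\<exists>x0\<in>D. \<forall>x\<in>D. \<bar>u x\<bar> \<le> \<bar>u x0\<bar>"
proof -
  have D: "edge_interval D" using assms by (auto simp: H1_on_def)
  have ex: "\<exists>x0\<in>{0..b}. \<forall>x\<in>{0..b}. \<bar>u x\<bar> \<le> \<bar>u x0\<bar>" if "b \<in> D" for b
    by (rule continuous_attains_sup)
       (use edge_interval_ge0[OF D that] H1_on_continuous_Icc[OF assms order.refl that] in \<open>auto intro!: continuous_intros\<close>)
  consider "D = {0..}" | l where "l > 0" "D = {0..l}" using D by (auto simp: edge_interval_def)
  then show ?thesis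
  proof cases
    case 2 then show ?thesis using ex[of l] by auto
  next
    case 1
    show ?thesis
    proof (cases "\<exists>y\<in>D. u y \<noteq> 0")
      case False then show ?thesis using 1 by (intro bexI[of _ 0]) auto
    next
      case True
      then obtain y where y: "y \<ge> 0" "u y \<noteq> 0" using 1 by auto
      have "\<forall>\<^sub>F x in at_top. \<bar>u x\<bar> < \<bar>u y\<bar>"
        using tendstoD[OF H1_on_halfline_decay, of u g "\<bar>u y\<bar>"] assms 1 y by (simp add: dist_real_def)
      then obtain B where B: "\<And>x. x \<ge> B \<Longrightarrow> \<bar>u x\<bar> < \<bar>u y\<bar>" by (auto simp: eventually_at_top_linorder)
      obtain x0 where x0: "x0 \<in> {0..max B y}" "\<And>x. x\<in>{0..max B y} \<Longrightarrow> \<bar>u x\<bar> \<le> \<bar>u x0\<bar>"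
        using ex[of "max B y"] 1 y by (metis atLeast_iff max.coboundedI2)
      have "\<bar>u x\<bar> \<le> \<bar>u x0\<bar>" if "x \<ge> 0" for x
        using x0(2)[of x] x0(2)[of y] B[of x] that y by (cases "x \<le> max B y") fastforce+
      then show ?thesis using 1 x0 by auto
    qed
  qed
qed

section \<open>Calibration by the soliton of prescribed height\<close>

lemma mu_R_pos: "0 < mu_R" by (simp add: mu_R_def)

text \<open>The soliton \<open>\<phi>\<close> of height \<open>M\<close> satisfies \<open>\<bar>\<phi>'\<bar> = cal M \<phi>\<close>, and \<open>calF M\<close> is the even primitive of the odd
  function \<open>cal M\<close>. Along \<open>\<phi>\<close>, \<open>mass_angle\<close> grows like \<open>2 / sqrt 3\<close> times the accumulated mass and
  \<open>soliton_time\<close> is the distance to the maximum point.\<close>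
definition cal :: "real \<Rightarrow> real \<Rightarrow> real" where
  "cal M t = t * sqrt ((M^4 - t^4) / 3)"

definition calF :: "real \<Rightarrow> real \<Rightarrow> real" where
  "calF M t = (t\<^sup>2 * sqrt (M^4 - t^4) + M^4 * arcsin (t\<^sup>2 / M\<^sup>2)) / (4 * sqrt 3)"

definition mass_angle :: "real \<Rightarrow> real \<Rightarrow> real" where
  "mass_angle M t = arcsin (t\<^sup>2 / M\<^sup>2)"

definition soliton_time :: "real \<Rightarrow> real \<Rightarrow> real" where
  "soliton_time M t = sqrt 3 / (2 * M\<^sup>2) * arcosh (M\<^sup>2 / t\<^sup>2)"

lemma continuous_on_cal: "continuous_on A (cal M)"
  unfolding cal_def by (intro continuous_intros) auto

lemma pow4_le: "\<bar>t\<bar> \<le> M \<Longrightarrow> t^4 \<le> (M::real)^4"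
  using power_mono[of "\<bar>t\<bar>" M 4] by (simp add: power_even_abs)

lemma pow4_less: "\<bar>t\<bar> < M \<Longrightarrow> t^4 < (M::real)^4"
  using power_strict_mono[of "\<bar>t\<bar>" M 4] by (simp add: power_even_abs)

lemma sq_le: "\<bar>t\<bar> \<le> M \<Longrightarrow> t\<^sup>2 \<le> (M::real)\<^sup>2"
  using power_mono[of "\<bar>t\<bar>" M 2] by simp

lemma sq_less: "\<bar>t\<bar> < M \<Longrightarrow> t\<^sup>2 < (M::real)\<^sup>2"
  using power_strict_mono[of "\<bar>t\<bar>" M 2] by simp

text \<open>The algebra behind completing the square: half of g^2 + (\<open>cal M u\<close>)^2 is
  the energy density plus M^4 / 6 times u^2.\<close>

lemma cal_sq: "\<bar>t\<bar> \<le> M \<Longrightarrow> (cal M t)\<^sup>2 = (M^4 * t\<^sup>2 - t^6) / 3"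
proof -
  assume "\<bar>t\<bar> \<le> M"
  then have "(sqrt ((M^4 - t^4) / 3))\<^sup>2 = (M^4 - t^4) / 3" using pow4_le[of t M] by simp
  then have "(cal M t)\<^sup>2 = t\<^sup>2 * ((M^4 - t^4) / 3)" unfolding cal_def power_mult_distrib by simp
  also have "\<dots> = (M^4 * t\<^sup>2 - t^6) / 3" by (simp add: right_diff_distrib mult.commute flip: power_add)
  finally show ?thesis .
qed

lemma continuous_on_mass_angle: "0 < M \<Longrightarrow> continuous_on {-M..M} (mass_angle M)"
  unfolding mass_angle_def
proof (intro continuous_intros ballI)
  fix t assume M: "0 < M" and "t \<in> {-M..M}"
  then have "t\<^sup>2 \<le> M\<^sup>2" by (intro sq_le) auto
  then have "t\<^sup>2 / M\<^sup>2 \<le> 1" using M by simp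
  moreover have "0 \<le> t\<^sup>2 / M\<^sup>2" by simp
  ultimately show "-1 \<le> t\<^sup>2 / M\<^sup>2 \<and> t\<^sup>2 / M\<^sup>2 \<le> 1" by linarith
qed auto

lemma continuous_on_calF: "0 < M \<Longrightarrow> continuous_on {-M..M} (calF M)"
  using continuous_on_mass_angle[of M] unfolding calF_def mass_angle_def
  by (intro continuous_on_divide continuous_on_add continuous_on_mult continuous_on_const
      continuous_on_real_sqrt continuous_on_diff continuous_on_power continuous_on_id) auto

lemma mass_angle_deriv:
  assumes "\<bar>t\<bar> < M"
  shows "(mass_angle M has_real_derivative 2 * t / sqrt (M^4 - t^4)) (at t)"
proof -
  have M: "M > 0" and t: "t\<^sup>2 < M\<^sup>2" "t^4 < M^4" using assms sq_less pow4_less by auto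
  have "0 \<le> t\<^sup>2 / M\<^sup>2" by simp
  then have r: "-1 < t\<^sup>2 / M\<^sup>2" "t\<^sup>2 / M\<^sup>2 < 1" using M t by (linarith, simp)
  have "1 - (t\<^sup>2 / M\<^sup>2)\<^sup>2 = (M^4 - t^4) / (M\<^sup>2)\<^sup>2"
    using M by (simp add: field_simps flip: power_mult)
  then have s: "sqrt (1 - (t\<^sup>2 / M\<^sup>2)\<^sup>2) = sqrt (M^4 - t^4) / M\<^sup>2"
    by (simp only: real_sqrt_divide real_sqrt_abs abs_power2)
  have "(mass_angle M has_real_derivative inverse (sqrt (1 - (t\<^sup>2 / M\<^sup>2)\<^sup>2)) * (2 * t / M\<^sup>2)) (at t)"
    unfolding mass_angle_def
    by (rule DERIV_chain2[where g="\<lambda>t. t\<^sup>2 / M\<^sup>2" and x=t, OF DERIV_arcsin[OF r]])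
       (rule DERIV_cdivide, auto intro!: derivative_eq_intros)
  then show ?thesis unfolding s using M by simp
qed

lemma calF_deriv:
  assumes "\<bar>t\<bar> < M"
  shows "(calF M has_real_derivative cal M t) (at t)"
proof -
  let ?s = "sqrt (M^4 - t^4)"
  have M: "M > 0" and t: "t^4 < M^4" using assms pow4_less by auto
  then have s: "?s > 0" "?s * ?s = M^4 - t^4" by auto
  have d: "((\<lambda>t. t\<^sup>2 * sqrt (M^4 - t^4)) has_real_derivative (2 * t * ?s + t\<^sup>2 * (- (4 * t^3) / (2 * ?s)))) (at t)"
    using t by (auto intro!: derivative_eq_intros simp: field_simps)
  have "(calF M has_real_derivative ((2 * t * ?s + t\<^sup>2 * (- (4 * t^3) / (2 * ?s))) + M^4 * (2 * t / ?s)) / (4 * sqrt 3)) (at t)"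
    unfolding calF_def
    by (rule DERIV_cdivide DERIV_add d DERIV_cmult mass_angle_deriv[OF assms, unfolded mass_angle_def])+
  \<comment> \<open>The product rule term and the arcsine term combine: -2 t^5 + 2 t M^4 = 2 t (M^4
    - t^4), over the root.\<close>
  moreover have "(2 * t * ?s + t\<^sup>2 * (- (4 * t^3) / (2 * ?s))) + M^4 * (2 * t / ?s) = 2 * t * ?s + 2 * t * (M^4 - t^4) / ?s"
    using s by (simp add: field_simps eval_nat_numeral)
  moreover have "(M^4 - t^4) / ?s = ?s" using s by (simp add: field_simps)
  ultimately have "(calF M has_real_derivative (2 * t * ?s + 2 * t * ?s) / (4 * sqrt 3)) (at t)"
    by (metis times_divide_eq_right)
  then show ?thesis by (simp add: cal_def real_sqrt_divide)
qed

lemma calF_0 [simp]: "calF M 0 = 0" and mass_angle_0 [simp]: "mass_angle M 0 = 0"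
  by (auto simp: calF_def mass_angle_def)

lemma mass_angle_max: "0 < M \<Longrightarrow> \<bar>t\<bar> = M \<Longrightarrow> mass_angle M t = pi / 2"
  using power2_abs[of t] by (simp add: mass_angle_def)

text \<open>The origin of \<open>mu_R\<close>: one rise from 0 to M and one fall cost twice the
  primitive at M, where only the arcsine term with value pi / 2 survives.\<close>

lemma calF_max: assumes "0 < M" "\<bar>t\<bar> = M" shows "2 * calF M t = M^4 / 6 * mu_R"
proof -
  have "t^4 = M^4" using assms(2) by (metis power_even_abs_numeral even_numeral)
  then show ?thesis using mass_angle_max[OF assms] real_div_sqrt[of 3]
    unfolding calF_def mass_angle_def mu_R_def by (simp add: field_simps)
qed

text \<open>The far end of a halfline is a vertex at infinity; it gets the limit value 0 of u, so
  that every edge has two ends.\<close>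

definition far_value :: "real set \<Rightarrow> (real \<Rightarrow> real) \<Rightarrow> real" where
  "far_value D u = (if D = {0..} then 0 else u (Sup D))"

lemma continuous_on_set_borel_measurable:
  fixes h :: "real \<Rightarrow> real"
  assumes "continuous_on D h" "D \<in> sets borel"
  shows "set_borel_measurable lborel D h"
  using borel_measurable_continuous_on_indicator[OF assms(2,1)] unfolding set_borel_measurable_def by simp

lemma set_integral_abs_ge:
  fixes h :: "real \<Rightarrow> real"
  assumes "set_integrable lborel A h"
  shows "\<bar>LINT x:A|lborel. h x\<bar> \<le> (LINT x:A|lborel. \<bar>h x\<bar>)"
  using set_integral_norm_bound[OF assms] by simp

section \<open>The calibration inequality on one edge\<close>

locale bounded_edge =
  fixes D u g M
  assumes H1: "H1_on D u g" and M: "0 < M" and bd: "\<And>x. x \<in> D \<Longrightarrow> \<bar>u x\<bar> \<le> M"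
begin

lemma D: "edge_interval D" using H1 by (auto simp: H1_on_def)
lemma D_borel [measurable]: "D \<in> sets borel" by (rule edge_interval_borel[OF D])
lemma u_cont: "continuous_on D u" by (rule H1_on_continuous[OF H1])
lemma u_int: "set_integrable lborel D (\<lambda>x. (u x)\<^sup>2)" using H1 by (simp add: H1_on_def)
lemma g_int: "set_integrable lborel D (\<lambda>x. (g x)\<^sup>2)" using H1 by (simp add: H1_on_def)

lemma cal_u_cont: "continuous_on D (\<lambda>x. cal M (u x))"
  by (rule continuous_on_compose2[OF continuous_on_cal u_cont, of UNIV]) auto

lemma u6_int: "set_integrable lborel D (\<lambda>x. u x ^ 6)"
proof (rule set_integrable_bound[OF set_integrable_mult_right[OF u_int, of "M^4"]])
  show "set_borel_measurable lborel D (\<lambda>x. u x ^ 6)"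
    by (intro continuous_on_set_borel_measurable continuous_intros u_cont D_borel)
  have "\<bar>u x ^ 6\<bar> \<le> M^4 * (u x)\<^sup>2" if "x \<in> D" for x
  proof -
    have "\<bar>u x ^ 6\<bar> = u x ^ 4 * (u x)\<^sup>2" by (simp add: flip: power_add)
    then show ?thesis using mult_right_mono[OF pow4_le[OF bd[OF that]], of "(u x)\<^sup>2"] by auto
  qed
  then show "AE x in lborel. x \<in> D \<longrightarrow> norm (u x ^ 6) \<le> norm (M^4 * (u x)\<^sup>2)"
    by (intro AE_I2) (simp add: abs_mult)
qed

lemma cal_int: "set_integrable lborel D (\<lambda>x. (cal M (u x))\<^sup>2)"
proof -
  have "set_integrable lborel D (\<lambda>x. (M^4 * (u x)\<^sup>2 - u x ^ 6) / 3)"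
    using u_int u6_int by auto
  then show ?thesis by (rule set_integrable_cong[THEN iffD1, rotated 3]) (auto simp: cal_sq bd)
qed

lemma cost_int: "set_integrable lborel D (\<lambda>x. cal M (u x) * g x)"
proof (rule set_integrable_bound[OF set_integral_add(1)[OF cal_int g_int]])
  have eq: "indicat_real D x *\<^sub>R (cal M (u x) * g x) = (indicator D x *\<^sub>R cal M (u x)) * (indicator D x *\<^sub>R g x)" for x
    by (auto split: split_indicator)
  show "set_borel_measurable lborel D (\<lambda>x. cal M (u x) * g x)"
    using continuous_on_set_borel_measurable[OF cal_u_cont D_borel] H1
    unfolding set_borel_measurable_def eq H1_on_def by (intro borel_measurable_times) auto
  have "\<bar>a * b\<bar> \<le> \<bar>a\<^sup>2 + b\<^sup>2\<bar>" for a b :: real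
  proof -
    have "0 \<le> (\<bar>a\<bar> - \<bar>b\<bar>)\<^sup>2" by simp
    then have "2 * (\<bar>a\<bar> * \<bar>b\<bar>) \<le> a\<^sup>2 + b\<^sup>2" by (simp add: power2_diff)
    then show ?thesis unfolding abs_mult using mult_nonneg_nonneg[of "\<bar>a\<bar>" "\<bar>b\<bar>"] by linarith
  qed
  then show "AE x in lborel. x \<in> D \<longrightarrow> norm (cal M (u x) * g x) \<le> norm ((cal M (u x))\<^sup>2 + (g x)\<^sup>2)"
    by (intro AE_I2) simp
qed

lemma cost_Icc:
  assumes "0 \<le> a" "a \<le> b" "b \<in> D"
  shows "calF M (u b) - calF M (u a) = (LINT x:{a..b}|lborel. cal M (u x) * g x)"
proof (rule absolutely_continuous_chain_rule[where m="-M" and M=M])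
  show "u x \<in> {-M..M}" if "x \<in> {a..b}" for x
    using bd[of x] edge_interval_sub[OF D assms(3,1)] that by (auto simp: abs_le_iff)
  show "u x = u a + (LINT y:{a..x}|lborel. g y)" if "x \<in> {a..b}" for x
    by (rule H1_on_increment[OF H1 assms(1,3) that])
qed (use assms M in \<open>auto intro: H1_on_integrable[OF H1] continuous_on_calF continuous_on_cal calF_deriv\<close>)

lemma sub_int: "set_integrable lborel D h \<Longrightarrow> A \<subseteq> D \<Longrightarrow> A \<in> sets borel \<Longrightarrow> set_integrable lborel A h"
  for h :: "real \<Rightarrow> real"
  by (rule set_integrable_subset) auto

text \<open>Passing to the far end of the edge, where \<open>u\<close> tends to \<open>0\<close> on a halfline.\<close>
lemma far_bound:
  fixes F h :: "real \<Rightarrow> real"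
  assumes F: "isCont F 0" and x: "x \<in> D" and h: "set_integrable lborel D h" "\<And>x. x \<in> D \<Longrightarrow> 0 \<le> h x"
    and le: "\<And>b. b \<in> D \<Longrightarrow> x \<le> b \<Longrightarrow> F (u x) - F (u b) \<le> (LINT y:{x..b}|lborel. h y)"
  shows "F (u x) - F (far_value D u) \<le> (LINT y:D \<inter> {x..}|lborel. h y)"
proof -
  have x0: "0 \<le> x" by (rule edge_interval_ge0[OF D x])
  have I: "F (u x) - F (u b) \<le> (LINT y:D \<inter> {x..}|lborel. h y)" if "b \<in> D" "x \<le> b" for b
  proof -
    have "(LINT y:{x..b}|lborel. h y) \<le> (LINT y:D \<inter> {x..}|lborel. h y)"
      by (rule set_integral_subset_mono[OF sub_int[OF h(1)]])
         (use edge_interval_sub[OF D that(1) x0] h(2) in auto)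
    then show ?thesis using le[OF that] by simp
  qed
  consider "D = {0..}" | l where "l > 0" "D = {0..l}" using D by (auto simp: edge_interval_def)
  then show ?thesis
  proof cases
    case 1
    have "(u \<longlongrightarrow> 0) at_top" using H1_on_halfline_decay H1 1 by simp
    then have "((\<lambda>b. F (u x) - F (u b)) \<longlongrightarrow> F (u x) - F 0) at_top"
      by (intro tendsto_intros isCont_tendsto_compose[OF F])
    moreover have "\<forall>\<^sub>F b in at_top. F (u x) - F (u b) \<le> (LINT y:D \<inter> {x..}|lborel. h y)"
      using eventually_ge_at_top[of x] by eventually_elim (use I 1 x0 in auto)
    ultimately have "F (u x) - F 0 \<le> (LINT y:D \<inter> {x..}|lborel. h y)"
      by (rule tendsto_upperbound) simp
    then show ?thesis using 1 by (simp add: far_value_def)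
  next
    case 2
    then have "D \<noteq> {0..}" by (metis atLeast_iff atLeastAtMost_iff gt_ex less_le not_le order.trans)
    then show ?thesis using I[of l] 2 x by (auto simp: far_value_def)
  qed
qed

text \<open>On an interval this is the total variation of \<open>calF M\<close> along u, which is
  why increments of \<open>calF M\<close> bound it from below.\<close>

abbreviation "cost A \<equiv> (LINT x:A|lborel. \<bar>cal M (u x) * g x\<bar>)"

lemma isCont_calF: "isCont (calF M) 0" and isCont_mass_angle: "isCont (mass_angle M) 0"
  using calF_deriv[of 0 M] mass_angle_deriv[of 0 M] M DERIV_isCont by auto

lemma cost_Icc_ge:
  assumes "0 \<le> a" "a \<le> b" "b \<in> D"
  shows "\<bar>calF M (u b) - calF M (u a)\<bar> \<le> cost {a..b}"
  unfolding cost_Icc[OF assms]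
  by (rule set_integral_abs_ge[OF sub_int[OF cost_int edge_interval_sub[OF D assms(3,1)]]]) auto

lemma cost_tail_ge:
  assumes "x \<in> D"
  shows "calF M (u x) - calF M (far_value D u) \<le> cost (D \<inter> {x..})"
  using cost_Icc_ge[OF edge_interval_ge0[OF D assms]]
  by (intro far_bound[OF isCont_calF assms set_integrable_abs[OF cost_int]]) fastforce+

lemma D_split:
  fixes h :: "real \<Rightarrow> real"
  assumes "set_integrable lborel D h" "x \<in> D"
  shows "(LINT y:D|lborel. h y) = (LINT y:{0..x}|lborel. h y) + (LINT y:D \<inter> {x..}|lborel. h y)"
proof -
  have "D \<inter> {..x} = {0..x}" using D assms(2) by (auto simp: edge_interval_def)
  then show ?thesis using set_integral_split_at[OF assms(1) D_borel, of x] by simp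
qed

lemma D_tail_split:
  fixes h :: "real \<Rightarrow> real"
  assumes "set_integrable lborel D h" "x \<in> D" "y \<in> D" "x \<le> y"
  shows "(LINT y:D \<inter> {x..}|lborel. h y) = (LINT z:{x..y}|lborel. h z) + (LINT z:D \<inter> {y..}|lborel. h z)"
proof -
  have "(D \<inter> {x..}) \<inter> {..y} = {x..y}" "(D \<inter> {x..}) \<inter> {y..} = D \<inter> {y..}"
    using D assms by (auto simp: edge_interval_def)
  then show ?thesis using set_integral_split_at[OF sub_int[OF assms(1), of "D \<inter> {x..}"], of y] by simp
qed

text \<open>The edge is cut at x and each side is bounded by its increment. The two ends enter
  symmetrically, so the direction of travel does not matter; x may itself be an end, and then a
  single increment remains.\<close>

lemma cost_ge:
  assumes "x \<in> D"
  shows "2 * calF M (u x) - calF M (u 0) - calF M (far_value D u) \<le> cost D"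
  using cost_tail_ge[OF assms] cost_Icc_ge[OF order.refl edge_interval_ge0[OF D assms] assms]
    D_split[OF set_integrable_abs[OF cost_int] assms] by linarith

end

text \<open>Equality case. A cost no larger than the signed increment forces
  \<open>cal M (u x) * g x\<close> to have sign \<sigma> almost everywhere, and with |g| =
  |\<open>cal M u\<close>| this gives g = \<sigma> \<open>cal M u\<close>. The right side is
  continuous, so u solves the ODE classically at every point.\<close>

lemma (in bounded_edge) saturated_deriv:
  assumes ab: "0 \<le> a" "a \<le> b" "b \<in> D" and \<sigma>: "\<sigma> = 1 \<or> \<sigma> = (-1::real)"
    and ae: "AE x in lborel. x \<in> D \<longrightarrow> \<bar>g x\<bar> = \<bar>cal M (u x)\<bar>"
    and le: "cost {a..b} \<le> \<sigma> * (calF M (u b) - calF M (u a))"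
    and x: "x \<in> {a..b}"
  shows "(u has_real_derivative \<sigma> * cal M (u x)) (at x within {a..b})"
proof -
  let ?h = "\<lambda>x. cal M (u x) * g x"
  have sub: "{a..b} \<subseteq> D" by (rule edge_interval_sub[OF D ab(3,1)])
  have i: "set_integrable lborel {a..b} ?h" by (rule sub_int[OF cost_int sub]) simp
  have i2: "set_integrable lborel {a..b} (\<lambda>x. \<bar>?h x\<bar> - \<sigma> * ?h x)"
    using i by (intro set_integral_diff(1) set_integrable_abs set_integrable_mult_right)
  have nn: "\<sigma> * ?h x \<le> \<bar>?h x\<bar>" for x using \<sigma> by auto
  have "(LINT x:{a..b}|lborel. \<bar>?h x\<bar> - \<sigma> * ?h x) = cost {a..b} - \<sigma> * (LINT x:{a..b}|lborel. ?h x)"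
    using i by (subst set_integral_diff(2)) (auto intro!: set_integrable_abs)
  also have "\<dots> \<le> 0" using le unfolding cost_Icc[OF ab] by simp
  finally have "(LINT x:{a..b}|lborel. \<bar>?h x\<bar> - \<sigma> * ?h x) = 0"
    using set_integral_nonneg'[of "{a..b}" "\<lambda>x. \<bar>?h x\<bar> - \<sigma> * ?h x" lborel] nn by force
  then have "AE x in lborel. indicat_real {a..b} x *\<^sub>R (\<bar>?h x\<bar> - \<sigma> * ?h x) = 0"
    using i2 nn unfolding set_lebesgue_integral_def set_integrable_def
    by (subst (asm) integral_nonneg_eq_0_iff_AE) (auto split: split_indicator)
  then have aeg: "AE x in lborel. x \<in> {a..b} \<longrightarrow> g x = \<sigma> * cal M (u x)"
    using ae
  proof eventually_elim
    case (elim x)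
    show ?case
    proof
      assume xx: "x \<in> {a..b}"
      then have "\<bar>g x\<bar> = \<bar>cal M (u x)\<bar>" "\<bar>?h x\<bar> = \<sigma> * ?h x" using elim sub by auto
      then show "g x = \<sigma> * cal M (u x)"
        using \<sigma> by (auto simp: abs_if zero_less_mult_iff mult_less_0_iff split: if_splits)
    qed
  qed
  have cc: "continuous_on {a..b} (\<lambda>x. \<sigma> * cal M (u x))"
    by (intro continuous_intros continuous_on_subset[OF cal_u_cont sub])
  have eq: "u y = u a + integral {a..y} (\<lambda>x. \<sigma> * cal M (u x))" if y: "y \<in> {a..b}" for y
  proof -
    have s: "{a..y} \<subseteq> {a..b}" using y by auto
    have ig: "set_integrable lborel {a..y} g" using H1_on_integrable[OF H1 ab(1), of y] y sub by blast
    have ic: "set_integrable lborel {a..y} (\<lambda>x. \<sigma> * cal M (u x))"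
      by (rule borel_integrable_atLeastAtMost'[OF continuous_on_subset[OF cc s]])
    have "(LINT x:{a..y}|lborel. g x) = (LINT x:{a..y}|lborel. \<sigma> * cal M (u x))"
      unfolding set_lebesgue_integral_def
    proof (rule integral_cong_AE)
      show "AE x in lborel. indicat_real {a..y} x *\<^sub>R g x = indicat_real {a..y} x *\<^sub>R (\<sigma> * cal M (u x))"
        using aeg by eventually_elim (use y in \<open>auto split: split_indicator\<close>)
    qed (use ig ic in \<open>auto simp: set_integrable_def\<close>)
    then show ?thesis using H1_on_increment[OF H1 ab(1,3) y] set_borel_integral_eq_integral(2)[OF ic] by simp
  qed
  have "((\<lambda>y. u a + integral {a..y} (\<lambda>x. \<sigma> * cal M (u x))) has_real_derivative \<sigma> * cal M (u x)) (at x within {a..b})"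
    using DERIV_add[OF DERIV_const integral_has_real_derivative[OF cc x]] by simp
  then show ?thesis unfolding has_field_derivative_def
    by (rule has_derivative_transform[OF x, rotated]) (rule eq)
qed

section \<open>The soliton equation u' = +-\<open>cal M u\<close>\<close>

locale cal_ode =
  fixes u :: "real \<Rightarrow> real" and a b M \<sigma> :: real
  assumes ab: "a \<le> b" and M: "0 < M" and \<sigma>: "\<sigma> = 1 \<or> \<sigma> = -1"
    and bd: "\<And>x. x \<in> {a..b} \<Longrightarrow> \<bar>u x\<bar> \<le> M"
    and ode: "\<And>x. x \<in> {a..b} \<Longrightarrow> (u has_real_derivative \<sigma> * cal M (u x)) (at x within {a..b})"
begin

lemma restrict: "a \<le> x \<Longrightarrow> x \<le> y \<Longrightarrow> y \<le> b \<Longrightarrow> cal_ode u x y M \<sigma>"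
  using M \<sigma> bd DERIV_subset[OF ode] by unfold_locales auto

lemma cont: "continuous_on {a..b} u"
  by (rule DERIV_continuous_on[OF ode])

lemma ode_at: "a < x \<Longrightarrow> x < b \<Longrightarrow> (u has_real_derivative \<sigma> * cal M (u x)) (at x)"
  using ode[of x] by (simp add: at_within_Icc_at)

text \<open>Since \<open>cal M\<close> is odd, \<sigma> = 1 lets |u| grow and \<sigma> = -1 lets it
  shrink, whatever the sign of u.\<close>

lemma sq_mono: "\<sigma> * (u a)\<^sup>2 \<le> \<sigma> * (u b)\<^sup>2"
proof (rule DERIV_nonneg_imp_increasing_open[OF ab])
  fix x assume x: "a < x" "x < b"
  have "((\<lambda>x. \<sigma> * (u x)\<^sup>2) has_real_derivative \<sigma> * (2 * u x * (\<sigma> * cal M (u x)))) (at x)"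
    using ode_at[OF x] by (auto intro!: derivative_eq_intros)
  moreover have "\<sigma> * (2 * u x * (\<sigma> * cal M (u x))) = 2 * (u x)\<^sup>2 * sqrt ((M^4 - u x^4) / 3)"
    using \<sigma> by (auto simp: cal_def power2_eq_square)
  moreover have "0 \<le> 2 * (u x)\<^sup>2 * sqrt ((M^4 - u x^4) / 3)" using pow4_le[OF bd[of x]] x by simp
  ultimately show "\<exists>y. ((\<lambda>x. \<sigma> * (u x)\<^sup>2) has_real_derivative y) (at x) \<and> 0 \<le> y" by metis
qed (intro continuous_intros cont)

text \<open>From |\<open>cal M u\<close>| \<le> M^2 |u|: the derivative of u^2 lies between -2 M^2
  u^2 and 2 M^2 u^2, so either exponential weight gives a monotone product, for either
  \<sigma>.\<close>

lemma gronwall: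
  assumes "\<tau> = 1 \<or> \<tau> = (-1::real)"
  shows "\<tau> * ((u a)\<^sup>2 * exp (\<tau> * 2 * M\<^sup>2 * a)) \<le> \<tau> * ((u b)\<^sup>2 * exp (\<tau> * 2 * M\<^sup>2 * b))"
proof (rule DERIV_nonneg_imp_increasing_open[OF ab])
  fix x assume x: "a < x" "x < b"
  let ?s = "sqrt ((M^4 - u x^4) / 3)" and ?e = "exp (\<tau> * 2 * M\<^sup>2 * x)"
  have "0 \<le> u x^4" "0 \<le> M^4" "(M\<^sup>2)\<^sup>2 = M^4" by (auto simp flip: power_mult)
  moreover have "0 \<le> p \<Longrightarrow> 0 \<le> q \<Longrightarrow> (q - p) / 3 \<le> q" for p q :: real by (simp add: field_simps)
  ultimately have "(M^4 - u x^4) / 3 \<le> M^4" by blast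
  then have "?s \<le> M\<^sup>2" using \<open>(M\<^sup>2)\<^sup>2 = M^4\<close> by (intro real_le_lsqrt) simp_all
  moreover have "0 \<le> ?s" using pow4_le[OF bd[of x]] x by simp
  ultimately have s: "0 \<le> ?s" "?s \<le> M\<^sup>2" by auto
  have d: "((\<lambda>x. \<tau> * ((u x)\<^sup>2 * exp (\<tau> * 2 * M\<^sup>2 * x))) has_real_derivative
      \<tau> * (2 * u x * (\<sigma> * cal M (u x)) * ?e + (u x)\<^sup>2 * (?e * (\<tau> * 2 * M\<^sup>2)))) (at x)"
    using ode_at[OF x] by (auto intro!: derivative_eq_intros)
  have e: "\<tau> * (2 * u x * (\<sigma> * cal M (u x)) * ?e + (u x)\<^sup>2 * (?e * (\<tau> * 2 * M\<^sup>2)))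
      = 2 * (u x)\<^sup>2 * ?e * (\<tau> * \<sigma> * ?s + \<tau> * \<tau> * M\<^sup>2)"
    by (simp add: cal_def power2_eq_square algebra_simps)
  have "0 \<le> \<tau> * \<sigma> * ?s + \<tau> * \<tau> * M\<^sup>2" using assms \<sigma> s by auto
  then have n: "0 \<le> 2 * (u x)\<^sup>2 * ?e * (\<tau> * \<sigma> * ?s + \<tau> * \<tau> * M\<^sup>2)" by (intro mult_nonneg_nonneg) auto
  show "\<exists>y. ((\<lambda>x. \<tau> * ((u x)\<^sup>2 * exp (\<tau> * 2 * M\<^sup>2 * x))) has_real_derivative y) (at x) \<and> 0 \<le> y"
    by (intro exI conjI, rule d, unfold e, rule n)
qed (intro continuous_intros cont)

text \<open>The two Gronwall weights forbid reaching 0 at a finite distance, from either side.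
  Height M has no such protection: solutions can rest there.\<close>

lemma zero_iff: "u a = 0 \<longleftrightarrow> u b = 0"
proof
  assume "u a = 0"
  then have "(u b)\<^sup>2 * exp (- (2 * M\<^sup>2 * b)) \<le> 0" using gronwall[of "-1"] by simp
  then show "u b = 0" by (simp add: mult_le_0_iff)
next
  assume "u b = 0"
  then have "(u a)\<^sup>2 * exp (2 * M\<^sup>2 * a) \<le> 0" using gronwall[of 1] by simp
  then show "u a = 0" by (simp add: mult_le_0_iff)
qed

text \<open>With \<open>N > M\<close> in place of \<open>M\<close> the angle is differentiable even where \<open>\<bar>u\<bar> = M\<close>; then let \<open>N\<close> tend to \<open>M\<close>.\<close>
lemma mass_ge: "sqrt 3 / 2 * \<bar>mass_angle M (u b) - mass_angle M (u a)\<bar> \<le> (LINT x:{a..b}|lborel. (u x)\<^sup>2)"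
proof -
  have cu2: "continuous_on {a..b} (\<lambda>x. 2 / sqrt 3 * (u x)\<^sup>2)" by (intro continuous_intros cont)
  have I: "integral {a..b} (\<lambda>x. 2 / sqrt 3 * (u x)\<^sup>2) = 2 / sqrt 3 * (LINT x:{a..b}|lborel. (u x)\<^sup>2)"
    using set_borel_integral_eq_integral(2)[OF borel_integrable_atLeastAtMost'[OF cu2]] by simp
  have *: "\<bar>mass_angle N (u b) - mass_angle N (u a)\<bar> \<le> 2 / sqrt 3 * (LINT x:{a..b}|lborel. (u x)\<^sup>2)" if N: "M < N" for N
  proof -
    let ?f = "\<lambda>x. 2 * u x / sqrt (N^4 - u x^4) * (\<sigma> * cal M (u x))"
    have "(?f has_integral (mass_angle N (u b) - mass_angle N (u a))) {a..b}"
    proof (rule fundamental_theorem_of_calculus[OF ab])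
      fix x assume x: "x \<in> {a..b}"
      have "\<bar>u x\<bar> < N" using bd[OF x] N by simp
      from DERIV_chain2[OF mass_angle_deriv[OF this] ode[OF x]]
      show "((\<lambda>x. mass_angle N (u x)) has_vector_derivative ?f x) (at x within {a..b})"
        by (simp add: has_real_derivative_iff_has_vector_derivative)
    qed
    then have "?f integrable_on {a..b}" "integral {a..b} ?f = mass_angle N (u b) - mass_angle N (u a)"
      by (auto simp: integral_unique)
    moreover have "norm (?f x) \<le> 2 / sqrt 3 * (u x)\<^sup>2" if x: "x \<in> {a..b}" for x
    proof -
      have "u x^4 \<le> M^4" "M^4 < N^4" using pow4_le[OF bd[OF x]] pow4_less[of M N] M N by auto
      then have r: "0 \<le> sqrt (M^4 - u x^4)" "sqrt (M^4 - u x^4) \<le> sqrt (N^4 - u x^4)" "0 < sqrt (N^4 - u x^4)" by auto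
      have u2: "(u x)\<^sup>2 = \<bar>u x\<bar> * \<bar>u x\<bar>" by (simp add: power2_eq_square)
      \<comment> \<open>The root in \<open>cal M\<close> cancels the denominator of the angle
        derivative up to a ratio that is at most 1, and only the mass density remains.\<close>
      have "norm (?f x) = 2 / sqrt 3 * (u x)\<^sup>2 * (sqrt (M^4 - u x^4) / sqrt (N^4 - u x^4))"
        unfolding u2 using \<sigma> r by (auto simp: cal_def abs_mult real_sqrt_divide mult_ac simp del: abs_mult_self_eq)
      also have "\<dots> \<le> 2 / sqrt 3 * (u x)\<^sup>2 * 1" using r by (intro mult_left_mono) auto
      finally show ?thesis by simp
    qed
    ultimately show ?thesis
      using integral_norm_bound_integral[of ?f "{a..b}" "\<lambda>x. 2 / sqrt 3 * (u x)\<^sup>2"]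
        integrable_continuous_interval[OF cu2] I by simp
  qed
  have c: "((\<lambda>N. mass_angle N t) \<longlongrightarrow> mass_angle M t) (at_right M)" if "\<bar>t\<bar> \<le> M" for t
  proof -
    have "continuous_on {M..M+1} (\<lambda>N. mass_angle N t)"
      unfolding mass_angle_def
    proof (intro continuous_intros ballI)
      fix N assume "N \<in> {M..M+1}"
      then have "N > 0" "t\<^sup>2 \<le> N\<^sup>2" using M that by (auto intro!: sq_le)
      then have "t\<^sup>2 / N\<^sup>2 \<le> 1" "0 \<le> t\<^sup>2 / N\<^sup>2" by auto
      then show "-1 \<le> t\<^sup>2 / N\<^sup>2 \<and> t\<^sup>2 / N\<^sup>2 \<le> 1" by linarith
    qed (use M in auto)
    then show ?thesis by (rule continuous_on_Icc_at_rightD) simp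
  qed
  have "((\<lambda>N. \<bar>mass_angle N (u b) - mass_angle N (u a)\<bar>) \<longlongrightarrow> \<bar>mass_angle M (u b) - mass_angle M (u a)\<bar>) (at_right M)"
    using bd ab by (intro tendsto_intros c) auto
  then have "\<bar>mass_angle M (u b) - mass_angle M (u a)\<bar> \<le> 2 / sqrt 3 * (LINT x:{a..b}|lborel. (u x)\<^sup>2)"
    by (rule tendsto_upperbound) (use * in \<open>auto simp: eventually_at_filter\<close>)
  then show ?thesis by (simp add: field_simps)
qed

text \<open>Along the ODE the slope of \<open>soliton_time\<close> is -\<sigma>, so it measures
  length. Height M is allowed only at the ends of the interval, because arcosh is continuous but not
  differentiable at 1.\<close>

lemma time_diff:
  assumes lt: "\<And>x. a < x \<Longrightarrow> x < b \<Longrightarrow> \<bar>u x\<bar> < M" and nz: "\<And>x. x \<in> {a..b} \<Longrightarrow> u x \<noteq> 0"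
  shows "soliton_time M (u b) = soliton_time M (u a) - \<sigma> * (b - a)"
proof (cases "a = b")
  case False
  let ?h = "\<lambda>x. soliton_time M (u x) + \<sigma> * x"
  have "?h b = ?h a"
  proof (rule DERIV_isconst_end[of a b ?h])
    show "a < b" using False ab by simp
    have "1 \<le> M\<^sup>2 / (u x)\<^sup>2" if "x \<in> {a..b}" for x using sq_le[OF bd[OF that]] nz[OF that] by simp
    then show "continuous_on {a..b} ?h" unfolding soliton_time_def using nz
      by (intro continuous_intros cont) auto
    fix x assume x: "a < x" "x < b"
    then have xx: "x \<in> {a..b}" by auto
    have "0 < (u x)\<^sup>2" "(u x)\<^sup>2 < M\<^sup>2" "u x^4 < M^4"
      using nz[OF xx] sq_less[OF lt[OF x]] pow4_less[OF lt[OF x]] by auto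
    then have gt: "1 < M\<^sup>2 / (u x)\<^sup>2" and s: "0 < sqrt (M^4 - u x^4)" by auto
    have "(M\<^sup>2 / (u x)\<^sup>2)\<^sup>2 - 1 = (M^4 - u x^4) / ((u x)\<^sup>2)\<^sup>2"
      using nz[OF xx] by (simp add: field_simps flip: power_mult)
    then have sq: "sqrt ((M\<^sup>2 / (u x)\<^sup>2)\<^sup>2 - 1) = sqrt (M^4 - u x^4) / (u x)\<^sup>2"
      by (simp only: real_sqrt_divide real_sqrt_abs abs_power2)
    have "((\<lambda>x. M\<^sup>2 / (u x)\<^sup>2) has_real_derivative (- (M\<^sup>2 * (2 * u x * (\<sigma> * cal M (u x)))) / ((u x)\<^sup>2 * (u x)\<^sup>2))) (at x)"
      using ode_at[OF x] nz[OF xx] by (auto intro!: derivative_eq_intros simp: field_simps)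
    from DERIV_chain2[where g="\<lambda>x. M\<^sup>2 / (u x)\<^sup>2" and x=x, OF arcosh_real_has_field_derivative[OF gt] this]
    have "((\<lambda>x. soliton_time M (u x)) has_real_derivative sqrt 3 / (2 * M\<^sup>2) *
       (1 / (sqrt (M^4 - u x^4) / (u x)\<^sup>2) * (- (M\<^sup>2 * (2 * u x * (\<sigma> * cal M (u x)))) / ((u x)\<^sup>2 * (u x)\<^sup>2)))) (at x)"
      unfolding soliton_time_def sq by (rule DERIV_cmult)
    moreover have "sqrt 3 / (2 * M\<^sup>2) *
       (1 / (sqrt (M^4 - u x^4) / (u x)\<^sup>2) * (- (M\<^sup>2 * (2 * u x * (\<sigma> * cal M (u x)))) / ((u x)\<^sup>2 * (u x)\<^sup>2))) = - \<sigma>"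
      using s nz[OF xx] M by (simp add: cal_def real_sqrt_divide field_simps power2_eq_square)
    ultimately have "((\<lambda>x. soliton_time M (u x)) has_real_derivative - \<sigma>) (at x)" by metis
    then show "(?h has_real_derivative 0) (at x)" by (auto intro!: derivative_eq_intros)
  qed
  then show ?thesis by (simp add: algebra_simps)
qed simp

end


section \<open>Edges on which the calibration inequality is an equality\<close>

locale saturated_edge = bounded_edge +
  fixes x0
  assumes x0: "x0 \<in> D"
    and ae: "AE x in lborel. x \<in> D \<longrightarrow> \<bar>g x\<bar> = \<bar>cal M (u x)\<bar>"
    and sat: "cost D \<le> 2 * calF M (u x0) - calF M (u 0) - calF M (far_value D u)"
begin

lemma x0_ge0: "0 \<le> x0" by (rule edge_interval_ge0[OF D x0])

text \<open>Subtracting the tail bound beyond x0 from \<open>sat\<close> shows that [0, x0] spends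
  no more than its own increment.\<close>

lemma before: "cal_ode u 0 x0 M 1"
proof
  have "cost {0..x0} \<le> calF M (u x0) - calF M (u 0)"
    using sat cost_tail_ge[OF x0] D_split[OF set_integrable_abs[OF cost_int] x0] by linarith
  then have "cost {0..x0} \<le> 1 * (calF M (u x0) - calF M (u 0))" by simp
  from saturated_deriv[OF order.refl x0_ge0 x0 _ ae this]
  show "(u has_real_derivative 1 * cal M (u x)) (at x within {0..x0})" if "x \<in> {0..x0}" for x
    using that by simp
  show "\<bar>u x\<bar> \<le> M" if "x \<in> {0..x0}" for x
    using bd edge_interval_sub[OF D x0 order.refl] that by auto
qed (use x0_ge0 M in auto)

lemma after:
  assumes "b \<in> D" "x0 \<le> b"
  shows "cal_ode u x0 b M (-1)"
proof
  \<comment> \<open>\<open>sat\<close> minus the bounds before x0 and beyond b leaves saturation on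
    [x0, b], with the sign reversed.\<close>
  have "cost {x0..b} \<le> calF M (u x0) - calF M (u b)"
    using sat cost_tail_ge[OF assms(1)] cost_Icc_ge[OF order.refl x0_ge0 x0]
      D_split[OF set_integrable_abs[OF cost_int] x0] D_tail_split[OF set_integrable_abs[OF cost_int] x0 assms]
    by linarith
  then have "cost {x0..b} \<le> -1 * (calF M (u b) - calF M (u x0))" by simp
  from saturated_deriv[OF x0_ge0 assms(2,1) _ ae this]
  show "(u has_real_derivative -1 * cal M (u x)) (at x within {x0..b})" if "x \<in> {x0..b}" for x
    using that by simp
  show "\<bar>u x\<bar> \<le> M" if "x \<in> {x0..b}" for x
    using bd edge_interval_sub[OF D assms(1) x0_ge0] that by auto
qed (use assms M in auto)

lemma zero_iff_peak: "x \<in> D \<Longrightarrow> u x = 0 \<longleftrightarrow> u x0 = 0"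
proof (cases "x \<le> x0")
  case True
  assume "x \<in> D"
  then have "cal_ode u x x0 M 1"
    using cal_ode.restrict[OF before, of x x0] True edge_interval_ge0[OF D] by auto
  then show ?thesis by (rule cal_ode.zero_iff)
next
  case False
  assume "x \<in> D"
  then show ?thesis using cal_ode.zero_iff[OF after[of x]] False by auto
qed

text \<open>The term \<open>M\<^sup>2 * (x0 - x)\<close> is the mass of a plateau: |u| grows towards
  x0 and is at most M, so if it equals M at x it stays M up to x0. With x = x0 only the angle bound
  remains.\<close>

lemma mass_before_ge:
  assumes x: "x \<in> {0..x0}" and xM: "x = x0 \<or> \<bar>u x\<bar> = M"
  shows "sqrt 3 / 2 * (mass_angle M (u x0) - mass_angle M (u 0)) + M\<^sup>2 * (x0 - x) \<le> (LINT y:{0..x0}|lborel. (u y)\<^sup>2)"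
proof -
  have i: "set_integrable lborel {0..x0} (\<lambda>y. (u y)\<^sup>2)"
    by (rule sub_int[OF u_int edge_interval_sub[OF D x0 order.refl]]) simp
  have pM: "(u y)\<^sup>2 = M\<^sup>2" if y: "y \<in> {x..x0}" "x \<noteq> x0" for y
  proof -
    have "(u x)\<^sup>2 \<le> (u y)\<^sup>2" "(u x)\<^sup>2 = M\<^sup>2"
      using cal_ode.sq_mono[OF cal_ode.restrict[OF before, of x y]] x y xM power2_abs[of "u x"] by auto
    moreover have "(u y)\<^sup>2 \<le> M\<^sup>2"
      using cal_ode.bd[OF before, of y] x y by (intro sq_le) auto
    ultimately show ?thesis by simp
  qed
  have pl: "(u y)\<^sup>2 = (u x0)\<^sup>2" if y: "y \<in> {x..x0}" for y
  proof (cases "x = x0")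
    case True then show ?thesis using y by simp
  next
    case False
    then show ?thesis using pM[OF y] pM[of x0] x by simp
  qed
  have "(LINT y:{x..x0}|lborel. (u y)\<^sup>2) = (LINT y:{x..x0}|lborel. (u x0)\<^sup>2)"
    by (rule set_lebesgue_integral_cong, simp, intro allI impI, rule pl)
  also have "\<dots> = (u x0)\<^sup>2 * (x0 - x)" using x by (simp add: set_integral_const)
  also have "\<dots> = M\<^sup>2 * (x0 - x)" using pM[of x0] x by (cases "x = x0") auto
  finally have "(LINT y:{x..x0}|lborel. (u y)\<^sup>2) = M\<^sup>2 * (x0 - x)" .
  moreover have "mass_angle M (u x) = mass_angle M (u x0)" using pl[of x] x by (simp add: mass_angle_def)
  then have "sqrt 3 / 2 * \<bar>mass_angle M (u x0) - mass_angle M (u 0)\<bar> \<le> (LINT y:{0..x}|lborel. (u y)\<^sup>2)"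
    using cal_ode.mass_ge[OF cal_ode.restrict[OF before, of 0 x]] x by auto
  moreover have "sqrt 3 / 2 * (mass_angle M (u x0) - mass_angle M (u 0)) \<le> sqrt 3 / 2 * \<bar>mass_angle M (u x0) - mass_angle M (u 0)\<bar>"
    by (intro mult_left_mono) auto
  moreover have "(LINT y:{0..x0}|lborel. (u y)\<^sup>2) = (LINT y:{0..x}|lborel. (u y)\<^sup>2) + (LINT y:{x..x0}|lborel. (u y)\<^sup>2)"
    using set_integral_split_Icc[OF i, of x] x by simp
  ultimately show ?thesis by linarith
qed

text \<open>Mirror image beyond x0; \<open>far_bound\<close> carries the angle estimate to a
  possibly infinite end.\<close>

lemma mass_after_ge:
  assumes x: "x \<in> D" "x0 \<le> x" and xM: "x = x0 \<or> \<bar>u x\<bar> = M"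
  shows "sqrt 3 / 2 * (mass_angle M (u x0) - mass_angle M (far_value D u)) + M\<^sup>2 * (x - x0) \<le> (LINT y:D \<inter> {x0..}|lborel. (u y)\<^sup>2)"
proof -
  have x_ge: "0 \<le> x" using x x0_ge0 by simp
  have pM: "(u y)\<^sup>2 = M\<^sup>2" if y: "y \<in> {x0..x}" "x \<noteq> x0" for y
  proof -
    have "(u x)\<^sup>2 \<le> (u y)\<^sup>2" "(u x)\<^sup>2 = M\<^sup>2"
      using cal_ode.sq_mono[OF cal_ode.restrict[OF after[OF x], of y x]] x y xM power2_abs[of "u x"] by auto
    moreover have "(u y)\<^sup>2 \<le> M\<^sup>2"
      using cal_ode.bd[OF after[OF x], of y] x y by (intro sq_le) auto
    ultimately show ?thesis by simp
  qed
  have pl: "(u y)\<^sup>2 = (u x0)\<^sup>2" if y: "y \<in> {x0..x}" for y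
  proof (cases "x = x0")
    case True then show ?thesis using y by simp
  next
    case False
    then show ?thesis using pM[OF y] pM[of x0] x by simp
  qed
  have "(LINT y:{x0..x}|lborel. (u y)\<^sup>2) = (LINT y:{x0..x}|lborel. (u x0)\<^sup>2)"
    by (rule set_lebesgue_integral_cong, simp, intro allI impI, rule pl)
  also have "\<dots> = (u x0)\<^sup>2 * (x - x0)" using x by (simp add: set_integral_const)
  also have "\<dots> = M\<^sup>2 * (x - x0)" using pM[of x0] x by (cases "x = x0") auto
  finally have "(LINT y:{x0..x}|lborel. (u y)\<^sup>2) = M\<^sup>2 * (x - x0)" .
  moreover have "sqrt 3 / 2 * mass_angle M (u x) - sqrt 3 / 2 * mass_angle M (far_value D u) \<le> (LINT y:D \<inter> {x..}|lborel. (u y)\<^sup>2)"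
  proof (rule far_bound[OF _ x(1) u_int, where F="\<lambda>t. sqrt 3 / 2 * mass_angle M t"])
    show "isCont (\<lambda>t. sqrt 3 / 2 * mass_angle M t) 0" by (intro continuous_intros isCont_mass_angle)
    fix b assume b: "b \<in> D" "x \<le> b"
    have "sqrt 3 / 2 * (mass_angle M (u x) - mass_angle M (u b)) \<le> sqrt 3 / 2 * \<bar>mass_angle M (u b) - mass_angle M (u x)\<bar>"
      by (intro mult_left_mono) auto
    also have "\<dots> \<le> (LINT y:{x..b}|lborel. (u y)\<^sup>2)"
      using b x by (intro cal_ode.mass_ge[OF cal_ode.restrict[OF after[OF b(1)]]]) auto
    finally show "sqrt 3 / 2 * mass_angle M (u x) - sqrt 3 / 2 * mass_angle M (u b) \<le> (LINT y:{x..b}|lborel. (u y)\<^sup>2)"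
      by (simp add: right_diff_distrib)
  qed auto
  moreover have "mass_angle M (u x) = mass_angle M (u x0)" using pl[of x] x by (simp add: mass_angle_def)
  ultimately show ?thesis using D_tail_split[OF u_int x0 x] by (simp add: right_diff_distrib)
qed

text \<open>It serves twice: x = x0 gives the mass that a saturated edge must carry, and a point x
  with |u x| = M shows what a second point of maximal height would add.\<close>

lemma mass_ge:
  assumes x: "x \<in> D" and xM: "x = x0 \<or> \<bar>u x\<bar> = M"
  shows "sqrt 3 / 2 * (2 * mass_angle M (u x0) - mass_angle M (u 0) - mass_angle M (far_value D u)) + M\<^sup>2 * \<bar>x - x0\<bar>
    \<le> (LINT y:D|lborel. (u y)\<^sup>2)"
proof (cases "x \<le> x0")
  case True
  then show ?thesis using mass_before_ge[of x] mass_after_ge[of x0] xM x x0 D_split[OF u_int x0] edge_interval_ge0[OF D x]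
    by (simp add: algebra_simps)
next
  case False
  then show ?thesis using mass_before_ge[of x0] mass_after_ge[of x] xM x x0 x0_ge0 D_split[OF u_int x0]
    by (simp add: algebra_simps)
qed

lemma time_eq:
  assumes lt: "\<And>x. x \<in> D \<Longrightarrow> x \<noteq> x0 \<Longrightarrow> \<bar>u x\<bar> < M" and nz: "\<And>x. x \<in> D \<Longrightarrow> u x \<noteq> 0" and x: "x \<in> D"
  shows "soliton_time M (u x) = soliton_time M (u x0) + \<bar>x - x0\<bar>"
proof (cases "x \<le> x0")
  case True
  then have "cal_ode u x x0 M 1"
    using cal_ode.restrict[OF before, of x x0] edge_interval_ge0[OF D x] by auto
  have s: "y \<in> D" if "y \<in> {x..x0}" for y
    using edge_interval_sub[OF D x0 edge_interval_ge0[OF D x]] that by blast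
  from \<open>cal_ode u x x0 M 1\<close> have "soliton_time M (u x0) = soliton_time M (u x) - 1 * (x0 - x)"
    by (rule cal_ode.time_diff) (auto intro!: lt nz s)
  then show ?thesis using True by simp
next
  case False
  have s: "y \<in> D" if "y \<in> {x0..x}" for y
    using edge_interval_sub[OF D x x0_ge0] that by blast
  have "cal_ode u x0 x M (-1)" using False by (intro after x) simp
  then have "soliton_time M (u x) = soliton_time M (u x0) - (-1) * (x - x0)"
    by (rule cal_ode.time_diff) (auto intro!: lt nz s)
  then show ?thesis using False by simp
qed

end

section \<open>Graphs with a trail through every point\<close>

lemma edge_interval_edom: "wf_mgraph G \<Longrightarrow> e \<in> edges G \<Longrightarrow> edge_interval (edom G e)"
  by (auto simp: edom_def edge_interval_def wf_mgraph_def)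

lemma H1pair_H1_on: "wf_mgraph G \<Longrightarrow> H1pair G u g \<Longrightarrow> e \<in> edges G \<Longrightarrow> H1_on (edom G e) (u e) (g e)"
  using edge_interval_edom[of G e] by (auto simp: H1pair_def H1_on_def)

lemma far_value_edom:
  assumes "wf_mgraph G" "e \<in> edges G"
  shows "far_value (edom G e) f = (if e \<in> halflines G then 0 else f (len G e))"
proof -
  have "{0..l} \<noteq> {0..}" for l :: real
    by (metis atLeastAtMost_iff atLeast_iff gt_ex less_le_not_le nle_le order_trans)
  moreover have "0 \<le> len G e" if "e \<notin> halflines G" using assms that by (simp add: wf_mgraph_def less_imp_le)
  ultimately show ?thesis by (auto simp: far_value_def edom_def)
qed

lemma H1pair_attains_max:
  assumes "wf_mgraph G" "noncompact G" "H1pair G u g"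
  obtains e x where "e \<in> edges G" "x \<in> edom G e"
    "\<And>e' x'. e' \<in> edges G \<Longrightarrow> x' \<in> edom G e' \<Longrightarrow> \<bar>u e' x'\<bar> \<le> \<bar>u e x\<bar>"
proof -
  have "\<forall>e\<in>edges G. \<exists>x0\<in>edom G e. \<forall>x\<in>edom G e. \<bar>u e x\<bar> \<le> \<bar>u e x0\<bar>"
    using H1_on_attains_max H1pair_H1_on[OF assms(1,3)] by blast
  then obtain p where p: "\<And>e. e \<in> edges G \<Longrightarrow> p e \<in> edom G e"
    "\<And>e x. e \<in> edges G \<Longrightarrow> x \<in> edom G e \<Longrightarrow> \<bar>u e x\<bar> \<le> \<bar>u e (p e)\<bar>" by metis
  have fin: "finite (edges G)" "edges G \<noteq> {}" using assms by (auto simp: wf_mgraph_def noncompact_def)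
  let ?m = "\<lambda>e. \<bar>u e (p e)\<bar>"
  have "Max (?m ` edges G) \<in> ?m ` edges G" using fin by (intro Max_in) auto
  then obtain e where e: "e \<in> edges G" "?m e = Max (?m ` edges G)" by force
  have "?m e' \<le> ?m e" if "e' \<in> edges G" for e' unfolding e(2) using fin that by (intro Max_ge) auto
  then show ?thesis using that[OF e(1) p(1)[OF e(1)]] p(2) order_trans by blast
qed

text \<open>Terms before j telescope upwards as A (i + 1) - A i, those after j downwards, and term j
  supplies 2 m - A j - A (j + 1).\<close>

lemma sum_peaks:
  fixes A :: "nat \<Rightarrow> real"
  assumes "j \<le> n" and A: "A 0 = 0" "A (Suc n) = 0"
  shows "(\<Sum>i\<le>n. 2 * (if i < j then A (Suc i) else if i = j then m else A i) - A i - A (Suc i)) = 2 * m"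
proof -
  let ?t = "\<lambda>i. 2 * (if i < j then A (Suc i) else if i = j then m else A i) - A i - A (Suc i)"
  have "(\<Sum>i\<le>n. ?t i) = 2 * m - A 0 - A (Suc n)" using assms(1)
  proof (induction n rule: dec_induct)
    case base
    have "(\<Sum>i<j. ?t i) = (\<Sum>i<j. A (Suc i) - A i)" by (intro sum.cong) auto
    also have "\<dots> = A j - A 0" by (rule sum_lessThan_telescope)
    finally show ?case by (simp add: lessThan_Suc_atMost[symmetric])
  next
    case (step n) then show ?case by simp
  qed
  then show ?thesis using A by simp
qed

text \<open>A trail with two halflines, seen as a sequence of nodes \<open>0, \<dots>, n + 1\<close>: edge \<open>i\<close> joins nodes
  \<open>i\<close> and \<open>i + 1\<close>, node \<open>k\<close> is the vertex \<open>vs ! (k - 1)\<close> for \<open>1 \<le> k \<le> n\<close>, and nodes \<open>0\<close> and \<open>n + 1\<close> are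
  vertices at infinity.\<close>
locale trail =
  fixes G :: "('v, 'e) mgraph" and es :: "'e list" and vs :: "'v list" and fwd :: "nat \<Rightarrow> bool" and n :: nat
  assumes wf: "wf_mgraph G" and len_es: "length es = Suc n" and n_pos: "1 \<le> n"
    and dist: "distinct es" and es_edges: "set es \<subseteq> edges G"
    and fwdD: "\<And>i. i \<le> n \<Longrightarrow> fwd i \<Longrightarrow> 0 < i \<and> src G (es ! i) = vs ! (i - 1) \<and>
          (if i = n then es ! i \<in> halflines G else es ! i \<notin> halflines G \<and> tgt G (es ! i) = vs ! i)"
    and bwdD: "\<And>i. i \<le> n \<Longrightarrow> \<not> fwd i \<Longrightarrow> i < n \<and> src G (es ! i) = vs ! i \<and>
          (if i = 0 then es ! i \<in> halflines G else es ! i \<notin> halflines G \<and> tgt G (es ! i) = vs ! (i - 1))"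

lemma trail2_imp_trail:
  assumes "wf_mgraph G" "trail2 G es vs"
  obtains fwd where "trail G es vs fwd (length es - 1)"
proof -
  define n where "n = length es - 1"
  \<comment> \<open>The first halfline is run from infinity, hence backward, and the last one
    forward; a loop fits both orientations and counts as forward.\<close>
  define fwd where "fwd i \<longleftrightarrow> i = n \<or> (i > 0 \<and> src G (es ! i) = vs ! (i - 1) \<and> tgt G (es ! i) = vs ! i)" for i
  have t: "length es = Suc n" "1 \<le> n" "length vs = n" "distinct es" "set es \<subseteq> edges G" "es \<noteq> []"
    "hd es \<in> halflines G" "last es \<in> halflines G" "src G (hd es) = vs ! 0" "src G (last es) = vs ! (n - 1)"
    using assms(2) unfolding trail2_def n_def by auto
  have m: "es ! i \<notin> halflines G \<and>
        ((src G (es ! i) = vs ! (i - 1) \<and> tgt G (es ! i) = vs ! i) \<or>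
         (src G (es ! i) = vs ! i \<and> tgt G (es ! i) = vs ! (i - 1)))" if "0 < i" "i < n" for i
    using assms(2) that unfolding trail2_def n_def by auto
  have h: "hd es = es ! 0" "last es = es ! n" using t by (auto simp: hd_conv_nth last_conv_nth)
  have "trail G es vs fwd n"
  proof (unfold_locales)
    fix i assume i: "i \<le> n"
    show "0 < i \<and> src G (es ! i) = vs ! (i - 1) \<and>
          (if i = n then es ! i \<in> halflines G else es ! i \<notin> halflines G \<and> tgt G (es ! i) = vs ! i)" if "fwd i"
      using t h i that m[of i] by (cases "i = n") (auto simp: fwd_def)
    show "i < n \<and> src G (es ! i) = vs ! i \<and>
          (if i = 0 then es ! i \<in> halflines G else es ! i \<notin> halflines G \<and> tgt G (es ! i) = vs ! (i - 1))" if "\<not> fwd i"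
      using t h i that m[of i] by (cases "i = 0") (auto simp: fwd_def)
  qed (use t assms(1) in auto)
  then show ?thesis using that unfolding n_def by blast
qed

context trail
begin

lemma edge_in: "i \<le> n \<Longrightarrow> es ! i \<in> edges G"
  using es_edges len_es by (simp add: subset_eq)

text \<open>Where the trail enters edge i; meaningful for 0 < i, since edge 0 is entered from
  infinity.\<close>

definition start_pos :: "nat \<Rightarrow> real" where
  "start_pos i = (if fwd i then 0 else len G (es ! i))"

text \<open>Where the trail leaves edge i; meaningful for i < n.\<close>

definition end_pos :: "nat \<Rightarrow> real" where
  "end_pos i = (if fwd i then len G (es ! i) else 0)"

text \<open>The value 0 at the two nodes at infinity matches \<open>far_value\<close> on
  halflines.\<close>

definition node_val :: "('v \<Rightarrow> real) \<Rightarrow> nat \<Rightarrow> real" where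
  "node_val \<psi> k = (if k = 0 \<or> k = Suc n then 0 else \<psi> (vs ! (k - 1)))"

lemma len_pos: "i \<le> n \<Longrightarrow> es ! i \<notin> halflines G \<Longrightarrow> 0 < len G (es ! i)"
  using wf edge_in[of i] by (auto simp: wf_mgraph_def)

lemma start_pos_edom: "0 < i \<Longrightarrow> i \<le> n \<Longrightarrow> start_pos i \<in> edom G (es ! i)"
  using bwdD[of i] len_pos[of i] edge_interval_0[OF edge_interval_edom[OF wf edge_in[of i]]]
  by (auto simp: start_pos_def edom_def)

lemma end_pos_edom: "i < n \<Longrightarrow> end_pos i \<in> edom G (es ! i)"
  using fwdD[of i] len_pos[of i] edge_interval_0[OF edge_interval_edom[OF wf edge_in[of i]]]
  by (auto simp: end_pos_def edom_def)

lemma halfline_iff: "i \<le> n \<Longrightarrow> es ! i \<in> halflines G \<longleftrightarrow> i = 0 \<or> i = n"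
  using fwdD[of i] bwdD[of i] n_pos by (cases "fwd i") (auto split: if_splits)

end

section \<open>The energy inequality along a trail through the maximum point\<close>

locale trail_function = trail G es vs fwd n
  for G :: "('v, 'e) mgraph" and es vs fwd n +
  fixes u g :: "'e \<Rightarrow> real \<Rightarrow> real" and \<psi> :: "'v \<Rightarrow> real" and M :: real and j :: nat and x0 :: real
  assumes H1p: "H1pair G u g"
    and \<psi>: "\<And>e. e \<in> edges G \<Longrightarrow> u e 0 = \<psi> (src G e)" "\<And>e. e \<in> edges G \<Longrightarrow> e \<notin> halflines G \<Longrightarrow> u e (len G e) = \<psi> (tgt G e)"
    and M: "0 < M" and bd: "\<And>e x. e \<in> edges G \<Longrightarrow> x \<in> edom G e \<Longrightarrow> \<bar>u e x\<bar> \<le> M"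
    and j: "j \<le> n" and x0: "x0 \<in> edom G (es ! j)" and peak: "\<bar>u (es ! j) x0\<bar> = M"
begin

lemma bounded_edge: "e \<in> edges G \<Longrightarrow> bounded_edge (edom G e) (u e) (g e) M"
  by unfold_locales (use H1pair_H1_on[OF wf H1p] M bd in auto)

abbreviation "cost e \<equiv> (LINT x:edom G e|lborel. \<bar>cal M (u e x) * g e x\<bar>)"

text \<open>The point of edge i nearest to the maximum point along the trail; it is the cut point at
  which \<open>cost_ge\<close> is applied on that edge.\<close>

definition pk :: "nat \<Rightarrow> real" where
  "pk i = (if i < j then end_pos i else if i = j then x0 else start_pos i)"

lemma pk_edom: "i \<le> n \<Longrightarrow> pk i \<in> edom G (es ! i)"
  using start_pos_edom[of i] end_pos_edom[of i] x0 j by (auto simp: pk_def)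

lemma u_start: "0 < i \<Longrightarrow> i \<le> n \<Longrightarrow> u (es ! i) (start_pos i) = node_val \<psi> i"
  using fwdD[of i] bwdD[of i] \<psi> edge_in[of i] by (auto simp: start_pos_def node_val_def)

lemma u_end: "i < n \<Longrightarrow> u (es ! i) (end_pos i) = node_val \<psi> (Suc i)"
  using fwdD[of i] bwdD[of i] \<psi> edge_in[of i] by (auto simp: end_pos_def node_val_def)

lemma u_pk: "i \<le> n \<Longrightarrow> u (es ! i) (pk i) = (if i < j then node_val \<psi> (Suc i) else if i = j then u (es ! j) x0 else node_val \<psi> i)"
  using u_start[of i] u_end[of i] j by (auto simp: pk_def)

text \<open>The ends of edge i are the nodes i and i + 1 in one order or the other; in the sum the
  orientation disappears.\<close>

lemma ends_sum:
  fixes F :: "real \<Rightarrow> real"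
  assumes "i \<le> n"
  shows "F (u (es ! i) 0) + F (far_value (edom G (es ! i)) (u (es ! i))) = F (node_val \<psi> i) + F (node_val \<psi> (Suc i))"
proof (cases "fwd i")
  case True
  then show ?thesis using fwdD[OF assms True] \<psi>[OF edge_in[OF assms]] far_value_edom[OF wf edge_in[OF assms]] assms
    by (auto simp: node_val_def split: if_splits)
next
  case False
  then show ?thesis using bwdD[OF assms False] \<psi>[OF edge_in[OF assms]] far_value_edom[OF wf edge_in[OF assms]] assms
    by (auto simp: node_val_def split: if_splits)
qed

text \<open>Applied to \<open>calF M\<close> for the cost and to \<open>mass_angle M\<close> for the
  mass; inner nodes cancel and the nodes at infinity contribute F 0 = 0.\<close>

lemma sum_edge_bounds:
  fixes F :: "real \<Rightarrow> real"
  assumes "F 0 = 0"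
  shows "(\<Sum>i\<le>n. 2 * F (u (es ! i) (pk i)) - F (u (es ! i) 0) - F (far_value (edom G (es ! i)) (u (es ! i)))) = 2 * F (u (es ! j) x0)"
proof -
  let ?A = "\<lambda>k. F (node_val \<psi> k)"
  have "(\<Sum>i\<le>n. 2 * F (u (es ! i) (pk i)) - F (u (es ! i) 0) - F (far_value (edom G (es ! i)) (u (es ! i))))
     = (\<Sum>i\<le>n. 2 * (if i < j then ?A (Suc i) else if i = j then F (u (es ! j) x0) else ?A i) - ?A i - ?A (Suc i))"
  proof (intro sum.cong refl)
    fix i assume "i \<in> {..n}"
    then have i: "i \<le> n" by simp
    show "2 * F (u (es ! i) (pk i)) - F (u (es ! i) 0) - F (far_value (edom G (es ! i)) (u (es ! i)))
      = 2 * (if i < j then ?A (Suc i) else if i = j then F (u (es ! j) x0) else ?A i) - ?A i - ?A (Suc i)"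
      using ends_sum[OF i, of F] unfolding u_pk[OF i] by auto
  qed
  also have "\<dots> = 2 * F (u (es ! j) x0)"
    by (rule sum_peaks[OF j]) (use assms in \<open>auto simp: node_val_def\<close>)
  finally show ?thesis .
qed

lemma sum_trail: "(\<Sum>i\<le>n. f (es ! i)) = (\<Sum>e\<in>set es. f e)" for f :: "'e \<Rightarrow> real"
proof -
  have "bij_betw ((!) es) {..<length es} (set es)" by (rule bij_betw_nth[OF dist refl refl])
  from sum.reindex_bij_betw[OF this, of f] show ?thesis by (simp add: len_es lessThan_Suc_atMost)
qed

lemma sum_trail_le:
  fixes f :: "'e \<Rightarrow> real"
  assumes "\<And>e. e \<in> edges G \<Longrightarrow> 0 \<le> f e"
  shows "(\<Sum>i\<le>n. f (es ! i)) \<le> (\<Sum>e\<in>edges G. f e)"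
  unfolding sum_trail by (rule sum_mono2) (use wf es_edges assms in \<open>auto simp: wf_mgraph_def\<close>)

lemma cost_nonneg: "0 \<le> cost e"
  by (rule set_integral_nonneg') auto

lemma cost_trail_edge: "i \<le> n \<Longrightarrow>
  2 * calF M (u (es ! i) (pk i)) - calF M (u (es ! i) 0) - calF M (far_value (edom G (es ! i)) (u (es ! i))) \<le> cost (es ! i)"
  by (rule bounded_edge.cost_ge[OF bounded_edge[OF edge_in] pk_edom])

lemma cost_trail_ge: "M^4 / 6 * mu_R \<le> (\<Sum>i\<le>n. cost (es ! i))"
proof -
  have "M^4 / 6 * mu_R = 2 * calF M (u (es ! j) x0)" by (rule calF_max[OF M peak, symmetric])
  also have "\<dots> \<le> (\<Sum>i\<le>n. cost (es ! i))"
    unfolding sum_edge_bounds[of "calF M", OF calF_0, symmetric] by (rule sum_mono) (use cost_trail_edge in auto)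
  finally show ?thesis .
qed

definition quad :: "'e \<Rightarrow> real" where
  "quad e = (LINT x:edom G e|lborel. ((g e x)\<^sup>2 + (cal M (u e x))\<^sup>2) / 2)"

text \<open>The defect of 2 |a b| \<le> a^2 + b^2 is kept as an integral, because its vanishing must
  later yield |g| = |\<open>cal M u\<close>| almost everywhere.\<close>

lemma quad_minus_cost:
  assumes e: "e \<in> edges G"
  shows "quad e - cost e = (LINT x:edom G e|lborel. (\<bar>g e x\<bar> - \<bar>cal M (u e x)\<bar>)\<^sup>2 / 2)"
    and "set_integrable lborel (edom G e) (\<lambda>x. (\<bar>g e x\<bar> - \<bar>cal M (u e x)\<bar>)\<^sup>2 / 2)"
proof -
  interpret E: bounded_edge "edom G e" "u e" "g e" M by (rule bounded_edge[OF e])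
  have i1: "set_integrable lborel (edom G e) (\<lambda>x. ((g e x)\<^sup>2 + (cal M (u e x))\<^sup>2) / 2)"
    by (intro set_integrable_divide set_integral_add(1) E.g_int E.cal_int)
  have i2: "set_integrable lborel (edom G e) (\<lambda>x. \<bar>cal M (u e x) * g e x\<bar>)"
    by (rule set_integrable_abs[OF E.cost_int])
  have eq: "((g e x)\<^sup>2 + (cal M (u e x))\<^sup>2) / 2 - \<bar>cal M (u e x) * g e x\<bar> = (\<bar>g e x\<bar> - \<bar>cal M (u e x)\<bar>)\<^sup>2 / 2" for x
    by (simp add: power2_diff abs_mult diff_divide_distrib)
  show "quad e - cost e = (LINT x:edom G e|lborel. (\<bar>g e x\<bar> - \<bar>cal M (u e x)\<bar>)\<^sup>2 / 2)"
    using set_integral_diff(2)[OF i1 i2] unfolding eq quad_def by simp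
  show "set_integrable lborel (edom G e) (\<lambda>x. (\<bar>g e x\<bar> - \<bar>cal M (u e x)\<bar>)\<^sup>2 / 2)"
    using set_integral_diff(1)[OF i1 i2] unfolding eq .
qed

lemma cost_le_quad: "e \<in> edges G \<Longrightarrow> cost e \<le> quad e"
  using quad_minus_cost(1)[of e] set_integral_nonneg'[of "edom G e" "\<lambda>x. (\<bar>g e x\<bar> - \<bar>cal M (u e x)\<bar>)\<^sup>2 / 2" lborel] by simp

lemma sum_quad: "(\<Sum>e\<in>edges G. quad e) = energy G u g + M^4 / 6 * Lnorm_pow G 2 u"
proof -
  have "quad e = (LINT x:edom G e|lborel. \<bar>g e x\<bar>^2) / 2 - (LINT x:edom G e|lborel. \<bar>u e x\<bar>^6) / 6
      + M^4 / 6 * (LINT x:edom G e|lborel. \<bar>u e x\<bar>^2)" if e: "e \<in> edges G" for e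
  proof -
    interpret E: bounded_edge "edom G e" "u e" "g e" M by (rule bounded_edge[OF e])
    have "quad e = (LINT x:edom G e|lborel. (g e x)\<^sup>2 / 2 - u e x ^ 6 / 6 + M^4 / 6 * (u e x)\<^sup>2)"
      unfolding quad_def
    proof (rule set_lebesgue_integral_cong)
      show "\<forall>x. x \<in> edom G e \<longrightarrow> ((g e x)\<^sup>2 + (cal M (u e x))\<^sup>2) / 2 = (g e x)\<^sup>2 / 2 - u e x ^ 6 / 6 + M^4 / 6 * (u e x)\<^sup>2"
        by (auto simp: cal_sq[OF E.bd] add_divide_distrib diff_divide_distrib)
    qed simp
    also have "\<dots> = (LINT x:edom G e|lborel. (g e x)\<^sup>2) / 2 - (LINT x:edom G e|lborel. u e x ^ 6) / 6
      + M^4 / 6 * (LINT x:edom G e|lborel. (u e x)\<^sup>2)"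
      using E.u_int E.g_int E.u6_int by (simp add: set_integral_add set_integral_diff)
    finally show ?thesis by (simp add: power_even_abs)
  qed
  then show ?thesis unfolding energy_def Lnorm_pow_def
    by (simp add: sum.distrib sum_subtractf sum_divide_distrib sum_distrib_left)
qed

lemma energy_ge: "M^4 / 6 * (mu_R - Lnorm_pow G 2 u) \<le> energy G u g"
proof -
  have "M^4 / 6 * mu_R \<le> (\<Sum>e\<in>edges G. cost e)"
    using cost_trail_ge sum_trail_le[of cost] cost_nonneg by fastforce
  also have "\<dots> \<le> (\<Sum>e\<in>edges G. quad e)" by (rule sum_mono) (rule cost_le_quad)
  finally show ?thesis unfolding sum_quad by (simp add: right_diff_distrib)
qed

end

lemma trail_function_exists:
  assumes G: "wf_mgraph G" "noncompact G" "assumption_H G" and H1: "H1pair G u g"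
    and nz: "e1 \<in> edges G" "x1 \<in> edom G e1" "u e1 x1 \<noteq> 0"
  obtains es vs fwd n \<psi> M j x0 where "trail_function G es vs fwd n u g \<psi> M j x0"
proof -
  obtain e x where ex: "e \<in> edges G" "x \<in> edom G e"
    "\<And>e' x'. e' \<in> edges G \<Longrightarrow> x' \<in> edom G e' \<Longrightarrow> \<bar>u e' x'\<bar> \<le> \<bar>u e x\<bar>"
    using H1pair_attains_max[OF G(1,2) H1] by metis
  obtain es vs where t: "trail2 G es vs" "e \<in> set es" using G(3) ex(1) by (auto simp: assumption_H_def)
  obtain fwd where tr: "trail G es vs fwd (length es - 1)" using trail2_imp_trail[OF G(1) t(1)] by blast
  obtain i where i: "i < length es" "es ! i = e" using t(2) by (auto simp: in_set_conv_nth)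
  obtain \<psi> where \<psi>: "\<forall>e\<in>edges G. u e 0 = \<psi> (src G e) \<and> (e \<notin> halflines G \<longrightarrow> u e (len G e) = \<psi> (tgt G e))"
    using H1 unfolding H1pair_def by blast
  have "0 < \<bar>u e x\<bar>" using ex(3)[OF nz(1,2)] nz(3) by linarith
  then have "trail_function G es vs fwd (length es - 1) u g \<psi> \<bar>u e x\<bar> i x"
    unfolding trail_function_def trail_function_axioms_def using tr H1 \<psi> ex i by auto
  then show ?thesis using that by blast
qed

section \<open>Positive mass, scaling and the Gagliardo-Nirenberg inequality\<close>

lemma H1_on_mass_pos:
  assumes H: "H1_on D u g" and nz: "x \<in> D" "u x \<noteq> 0"
  shows "0 < (LINT y:D|lborel. \<bar>u y\<bar>^2)"
proof -
  have D: "edge_interval D" using H by (simp add: H1_on_def)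
  define d where "d = \<bar>u x\<bar> / 2"
  have d: "0 < d" using nz by (simp add: d_def)
  obtain r where r: "r > 0" "\<And>y. y \<in> D \<Longrightarrow> \<bar>y - x\<bar> < r \<Longrightarrow> \<bar>u y - u x\<bar> < d"
    using H1_on_continuous[OF H, unfolded continuous_on_iff dist_real_def, rule_format, OF nz(1) d] by blast
  \<comment> \<open>The point x may be an end of the edge, so the interval is one-sided: to the
    right of x if there is room, else to the left.\<close>
  have "\<exists>a b. a < b \<and> {a..b} \<subseteq> D \<and> {a..b} \<subseteq> {x - r<..<x + r}"
  proof -
    consider "D = {0..}" | l where "l > 0" "D = {0..l}" using D by (auto simp: edge_interval_def)
    then show ?thesis
    proof cases
      case 1 then show ?thesis using r nz(1) by (intro exI[of _ x] exI[of _ "x + r/2"]) auto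
    next
      case (2 l)
      show ?thesis
      proof (cases "x < l")
        case True then show ?thesis using 2 r nz(1) by (intro exI[of _ x] exI[of _ "min l (x + r/2)"]) auto
      next
        case False then show ?thesis using 2 r nz(1) by (intro exI[of _ "max 0 (x - r/2)"] exI[of _ x]) auto
      qed
    qed
  qed
  then obtain a b where ab: "a < b" "{a..b} \<subseteq> D" "{a..b} \<subseteq> {x - r<..<x + r}" by blast
  have iu: "set_integrable lborel D (\<lambda>x. (u x)\<^sup>2)" using H by (simp add: H1_on_def)
  have "d\<^sup>2 \<le> (u y)\<^sup>2" if "y \<in> {a..b}" for y
  proof -
    have "\<bar>u y - u x\<bar> < d" using r(2)[of y] ab that by (force simp: abs_less_iff)
    then have "\<bar>d\<bar> \<le> \<bar>u y\<bar>" unfolding d_def by linarith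
    then show ?thesis by (simp only: abs_le_square_iff)
  qed
  then have "(LINT y:{a..b}|lborel. d\<^sup>2) \<le> (LINT y:{a..b}|lborel. (u y)\<^sup>2)"
    by (intro set_integral_mono set_integrable_subset[OF iu _ ab(2)] borel_integrable_atLeastAtMost') auto
  also have "\<dots> \<le> (LINT y:D|lborel. \<bar>u y\<bar>^2)"
    using set_integral_subset_mono[OF iu ab(2)] by simp
  also have "(LINT y:{a..b}|lborel. d\<^sup>2) = d\<^sup>2 * (b - a)" using ab(1) by (simp add: set_integral_const)
  finally have "d\<^sup>2 * (b - a) \<le> (LINT y:D|lborel. \<bar>u y\<bar>^2)" .
  moreover have "0 < d\<^sup>2 * (b - a)" using d ab(1) by simp
  ultimately show ?thesis by linarith
qed

lemma Lnorm_pow_pos: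
  assumes G: "wf_mgraph G" and H1: "H1pair G u g"
    and nz: "e \<in> edges G" "x \<in> edom G e" "u e x \<noteq> 0"
  shows "0 < Lnorm_pow G 2 u"
proof -
  have "0 < (LINT y:edom G e|lborel. \<bar>u e y\<bar>^2)"
    by (rule H1_on_mass_pos[where u="u e", OF H1pair_H1_on[OF G H1 nz(1)] nz(2,3)])
  moreover have "0 \<le> (LINT y:edom G e'|lborel. \<bar>u e' y\<bar>^2)" for e' by (rule set_integral_nonneg') auto
  ultimately show ?thesis unfolding Lnorm_pow_def using G nz(1)
    by (intro sum_pos2[of _ e]) (auto simp: wf_mgraph_def)
qed

lemma Lnorm_pow_zero:
  assumes G: "wf_mgraph G" and z: "\<And>e x. e \<in> edges G \<Longrightarrow> x \<in> edom G e \<Longrightarrow> u e x = 0"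
  shows "Lnorm_pow G 2 u = 0"
proof -
  have "(LINT x:edom G e|lborel. \<bar>u e x\<bar>^2) = 0" if "e \<in> edges G" for e
  proof -
    have "edom G e \<in> sets lborel" using edge_interval_borel[OF edge_interval_edom[OF G that]] by simp
    then have "(LINT x:edom G e|lborel. \<bar>u e x\<bar>^2) = (LINT x:edom G e|lborel. 0)"
      using z that by (intro set_lebesgue_integral_cong) auto
    then show ?thesis by (simp add: set_lebesgue_integral_def)
  qed
  then show ?thesis by (simp add: Lnorm_pow_def)
qed

lemma H1pair_scale:
  assumes "H1pair G u g"
  shows "H1pair G (\<lambda>e x. c * u e x) (\<lambda>e x. c * g e x)"
proof -
  obtain \<psi> where \<psi>: "\<forall>e\<in>edges G. u e 0 = \<psi> (src G e) \<and> (e \<notin> halflines G \<longrightarrow> u e (len G e) = \<psi> (tgt G e))"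
    using assms unfolding H1pair_def by blast
  have m: "set_borel_measurable lborel A (\<lambda>x. c * f x)" if "set_borel_measurable lborel A f" for A and f :: "real \<Rightarrow> real"
    using borel_measurable_times[OF borel_measurable_const[of c] that[unfolded set_borel_measurable_def]]
    by (simp add: set_borel_measurable_def mult.left_commute)
  show ?thesis unfolding H1pair_def
  proof (intro conjI ballI exI[of _ "\<lambda>v. c * \<psi> v"])
    fix e assume e: "e \<in> edges G"
    then have h: "set_borel_measurable lborel (edom G e) (g e)" "set_integrable lborel (edom G e) (\<lambda>x. (g e x)\<^sup>2)"
      "set_integrable lborel (edom G e) (\<lambda>x. (u e x)\<^sup>2)" using assms unfolding H1pair_def by blast+
    show "set_borel_measurable lborel (edom G e) (\<lambda>x. c * g e x)" by (rule m[OF h(1)])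
    show "set_integrable lborel (edom G e) (\<lambda>x. (c * g e x)\<^sup>2)" "set_integrable lborel (edom G e) (\<lambda>x. (c * u e x)\<^sup>2)"
      using h by (simp_all add: power_mult_distrib)
  next
    fix e x assume "e \<in> edges G" "x \<in> edom G e"
    then have "u e x = u e 0 + (LINT y:{0..x}|lborel. g e y)" using assms unfolding H1pair_def by blast
    then show "c * u e x = c * u e 0 + (LINT y:{0..x}|lborel. c * g e y)" by (simp add: distrib_left)
  qed (use \<psi> in auto)
qed

lemma Lnorm_pow_scale: "Lnorm_pow G p (\<lambda>e x. c * u e x) = \<bar>c\<bar>^p * Lnorm_pow G p u"
  by (simp add: Lnorm_pow_def abs_mult power_mult_distrib sum_distrib_left)

lemma energy_nonneg:
  assumes G: "wf_mgraph G" "noncompact G" "assumption_H G" and H1: "H1pair G u g" and m: "Lnorm_pow G 2 u = mu_R"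
  shows "0 \<le> energy G u g"
proof (cases "\<exists>e\<in>edges G. \<exists>x\<in>edom G e. u e x \<noteq> 0")
  case True
  then obtain e x where "e \<in> edges G" "x \<in> edom G e" "u e x \<noteq> 0" by blast
  from trail_function_exists[OF G H1 this]
  obtain es vs fwd n \<psi> M j x0 where "trail_function G es vs fwd n u g \<psi> M j x0" .
  from trail_function.energy_ge[OF this] show ?thesis using m by simp
next
  case False
  then have "Lnorm_pow G 2 u = 0" by (intro Lnorm_pow_zero[OF G(1)]) blast
  then show ?thesis using m mu_R_pos by simp
qed

text \<open>Multiplying u by c with c^2 = \<open>mu_R\<close> / mass brings it to mass
  \<open>mu_R\<close>, where the energy is nonnegative; the homogeneities 2 and 6 of the two energy
  terms turn this into the scale invariant quotient.\<close>

lemma gagliardo_nirenberg: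
  assumes G: "wf_mgraph G" "noncompact G" "assumption_H G" and H1: "H1pair G u g"
    and nz: "e \<in> edges G" "x \<in> edom G e" "u e x \<noteq> 0"
  shows "Lnorm_pow G 6 u / ((Lnorm_pow G 2 u)\<^sup>2 * Lnorm_pow G 2 g) \<le> 3 / mu_R\<^sup>2"
proof -
  let ?m = "Lnorm_pow G 2 u" and ?B = "Lnorm_pow G 6 u" and ?A = "Lnorm_pow G 2 g"
  have m: "0 < ?m" by (rule Lnorm_pow_pos[OF G(1) H1 nz])
  define c where "c = sqrt (mu_R / ?m)"
  have c2: "c\<^sup>2 = mu_R / ?m" using m mu_R_pos by (simp add: c_def)
  have c0: "0 < c" using m mu_R_pos by (simp add: c_def)
  have "0 \<le> energy G (\<lambda>e x. c * u e x) (\<lambda>e x. c * g e x)"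
    by (rule energy_nonneg[OF G H1pair_scale[OF H1]]) (use m c2 in \<open>simp add: Lnorm_pow_scale\<close>)
  then have "c^6 * ?B \<le> 3 * (c\<^sup>2 * ?A)" using c0 by (simp add: energy_def Lnorm_pow_scale)
  moreover have "c^6 = c\<^sup>2 * (c\<^sup>2)\<^sup>2" by (simp flip: power_mult power_add)
  ultimately have "c\<^sup>2 * ((c\<^sup>2)\<^sup>2 * ?B) \<le> c\<^sup>2 * (3 * ?A)" by (metis mult.assoc mult.left_commute)
  then have "(c\<^sup>2)\<^sup>2 * ?B \<le> 3 * ?A" by (rule mult_left_le_imp_le) (use c0 in simp)
  then have le: "?B \<le> 3 / mu_R\<^sup>2 * (?m\<^sup>2 * ?A)"
    using m mu_R_pos unfolding c2 by (simp add: field_simps power_divide)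
  have "0 \<le> ?A" unfolding Lnorm_pow_def by (intro sum_nonneg set_integral_nonneg') auto
  show ?thesis
  proof (cases "?A = 0")
    \<comment> \<open>A vanishing denominator makes the quotient 0 by the convention for
      division.\<close>
    case True then show ?thesis by simp
  next
    case False
    then have "0 < ?m\<^sup>2 * ?A" using m \<open>0 \<le> ?A\<close> by simp
    then show ?thesis using le by (simp add: pos_divide_le_eq)
  qed
qed

section \<open>Equality along the trail\<close>

lemma same_point_refl [simp]: "same_point G p p" by (simp add: same_point_def)
lemma same_point_sym: "same_point G p q \<Longrightarrow> same_point G q p" by (metis same_point_def)

section \<open>From a unit speed run to a quotient of the line\<close>

context trail
begin

lemma vertex_at_start: "0 < i \<Longrightarrow> i \<le> n \<Longrightarrow> vertex_at G (es ! i, start_pos i) = Some (vs ! (i - 1))"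
  using fwdD[of i] bwdD[of i] len_pos[of i] by (auto simp: vertex_at_def start_pos_def split: if_splits)

lemma vertex_at_end: "i < n \<Longrightarrow> vertex_at G (es ! i, end_pos i) = Some (vs ! i)"
  using fwdD[of i] bwdD[of i] len_pos[of i] by (auto simp: vertex_at_def end_pos_def split: if_splits)

lemma vertex_at_trail_edge:
  assumes "i \<le> n" "vertex_at G (es ! i, x) \<noteq> None"
  shows "(0 < i \<and> x = start_pos i) \<or> (i < n \<and> x = end_pos i)"
  using assms fwdD[of i] bwdD[of i] n_pos by (cases "fwd i") (auto simp: vertex_at_def start_pos_def end_pos_def split: if_splits)

text \<open>A unit speed run along a trail through all edges, passing node \<open>k\<close> at time \<open>tm k\<close> and sitting at
  \<open>q i + sg i * s\<close> on edge \<open>i\<close> at time \<open>s\<close>, exhibits \<open>G\<close> as a quotient of the line.\<close>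
lemma from_line_of_run:
  fixes tm q sg :: "nat \<Rightarrow> real"
  defines "pos \<equiv> \<lambda>i s. q i + sg i * s"
  assumes all: "set es = edges G"
    and sg: "\<And>i. i \<le> n \<Longrightarrow> sg i = 1 \<or> sg i = -1"
    and dom: "\<And>i s. i \<le> n \<Longrightarrow> pos i s \<in> edom G (es ! i) \<longleftrightarrow> (0 < i \<longrightarrow> tm i \<le> s) \<and> (i < n \<longrightarrow> s \<le> tm (Suc i))"
    and mono: "\<And>i. 0 < i \<Longrightarrow> i < n \<Longrightarrow> tm i < tm (Suc i)"
    and st: "\<And>i. 0 < i \<Longrightarrow> i \<le> n \<Longrightarrow> pos i (tm i) = start_pos i"
    and en: "\<And>i. i < n \<Longrightarrow> pos i (tm (Suc i)) = end_pos i"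
    and sym: "\<And>i k s t. i \<le> n \<Longrightarrow> k \<le> n \<Longrightarrow> pos i s \<in> edom G (es ! i) \<Longrightarrow> pos k t \<in> edom G (es ! k) \<Longrightarrow>
       same_point G (es ! i, pos i s) (es ! k, pos k t) \<Longrightarrow> \<bar>s\<bar> = \<bar>t\<bar>"
  shows "\<exists>X. finite X \<and> X \<subseteq> {0<..} \<and> from_line G X"
proof -
  have pos_inj: "s = t" if "i \<le> n" "pos i s = pos i t" for i s t
    using sg[OF that(1)] that(2) by (auto simp: pos_def)
  have pos_shift: "pos i s = pos i t + sg i * (s - t)" for i s t by (simp add: pos_def right_diff_distrib)
  have tm_mono: "0 < i \<Longrightarrow> i < k \<Longrightarrow> k \<le> n \<Longrightarrow> tm i < tm k" for i k
  proof (induction k)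
    case (Suc k)
    show ?case
    proof (cases "i = k")
      case True then show ?thesis using mono[of i] Suc.prems by simp
    next
      case False
      then have "tm i < tm k" using Suc by simp
      also have "tm k < tm (Suc k)" using mono[of k] Suc.prems by simp
      finally show ?thesis .
    qed
  qed simp
  \<comment> \<open>At a node time two edges qualify; the least index selects the edge being
    left.\<close>
  define idx where "idx s = (LEAST i. i = n \<or> s \<le> tm (Suc i))" for s
  define \<phi> where "\<phi> s = (es ! idx s, pos (idx s) s)" for s
  have idx_le: "idx s \<le> i" if "i = n \<or> s \<le> tm (Suc i)" for s i
    unfolding idx_def using that by (rule Least_le)
  have idx_n: "idx s \<le> n" for s by (rule idx_le) simp
  have idx_up: "idx s < n \<Longrightarrow> s \<le> tm (Suc (idx s))" for s
    using LeastI[of "\<lambda>i. i = n \<or> s \<le> tm (Suc i)" n] unfolding idx_def by auto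
  have idx_low: "0 < idx s \<Longrightarrow> tm (idx s) < s" for s
  proof (rule ccontr)
    assume a: "0 < idx s" "\<not> tm (idx s) < s"
    then have "idx s \<le> idx s - 1" by (intro idx_le) auto
    then show False using a by simp
  qed
  have idx_dom: "pos (idx s) s \<in> edom G (es ! idx s)" for s
    using dom[OF idx_n, of s s] idx_up[of s] idx_low[of s] by auto
  \<comment> \<open>The choice at node times is harmless: if \<open>idx s\<close> differs from i,
    then s is the time of the node between these two edges, and both positions are that
    vertex.\<close>
  have \<phi>_same: "same_point G (\<phi> s) (es ! i, pos i s)" if i: "i \<le> n" and d: "pos i s \<in> edom G (es ! i)" for i s
  proof -
    have h: "0 < i \<longrightarrow> tm i \<le> s" "i < n \<longrightarrow> s \<le> tm (Suc i)" using dom[OF i] d by auto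
    have le: "idx s \<le> i" using h i by (intro idx_le) auto
    show ?thesis
    proof (cases "idx s = i")
      case True then show ?thesis by (simp add: \<phi>_def)
    next
      case False
      then have lt: "idx s < i" using le by simp
      have "s \<le> tm (Suc (idx s))" using idx_up[of s] lt i by simp
      moreover have "tm i \<le> s" using h lt by simp
      ultimately have "Suc (idx s) = i" "s = tm i" using tm_mono[of "Suc (idx s)" i] lt i
        by (metis Suc_lessI leD le_less_trans zero_less_Suc, metis Suc_lessI antisym leD le_less_trans zero_less_Suc)
      then have "i - 1 = idx s" "s = tm i" "Suc (idx s) = i" by auto
      then have "vertex_at G (\<phi> s) = Some (vs ! idx s)" "vertex_at G (es ! i, pos i s) = Some (vs ! idx s)"
        using vertex_at_end[of "idx s"] vertex_at_start[of i] en[of "idx s"] st[of i] i lt by (simp_all add: \<phi>_def)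
      then show ?thesis by (simp add: same_point_def)
    qed
  qed
  have abs_eq: "\<bar>s\<bar> = \<bar>t\<bar>" if "same_point G (\<phi> s) (\<phi> t)" for s t
    using sym[OF idx_n idx_n idx_dom idx_dom] that unfolding \<phi>_def by blast
  \<comment> \<open>By \<open>sym\<close> only opposite times can meet, so positive times suffice to
    list the identifications.\<close>
  define X where "X = {x. 0 < x \<and> same_point G (\<phi> x) (\<phi> (- x))}"
  have "X \<subseteq> tm ` {..Suc n}"
  proof
    fix x assume x: "x \<in> X"
    \<comment> \<open>The edges are distinct and each is run at unit speed, so equal pairs would
      force x = -x. The coincidence is therefore at a vertex, and x is a node time.\<close>
    have "\<phi> x \<noteq> \<phi> (- x)"
    proof
      assume "\<phi> x = \<phi> (- x)"
      then have e: "es ! idx x = es ! idx (- x)" "pos (idx x) x = pos (idx (- x)) (- x)" by (auto simp: \<phi>_def)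
      have "idx x = idx (- x)" using e(1) dist nth_eq_iff_index_eq[OF dist, of "idx x" "idx (- x)"] idx_n[of x] idx_n[of "-x"] len_es
        by simp
      then have "x = - x" using pos_inj[OF idx_n, of x x "- x"] e(2) by simp
      then show False using x by (simp add: X_def)
    qed
    then have "vertex_at G (es ! idx x, pos (idx x) x) \<noteq> None" using x by (auto simp: X_def same_point_def \<phi>_def)
    from vertex_at_trail_edge[OF idx_n this]
    show "x \<in> tm ` {..Suc n}"
    proof
      assume a: "0 < idx x \<and> pos (idx x) x = start_pos (idx x)"
      then have "pos (idx x) x = pos (idx x) (tm (idx x))" using st[of "idx x"] idx_n[of x] by simp
      then have "x = tm (idx x)" by (rule pos_inj[OF idx_n])
      then show ?thesis using idx_n[of x] by (intro image_eqI[of _ _ "idx x"]) auto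
    next
      assume a: "idx x < n \<and> pos (idx x) x = end_pos (idx x)"
      then have "pos (idx x) x = pos (idx x) (tm (Suc (idx x)))" using en[of "idx x"] by simp
      then have "x = tm (Suc (idx x))" by (rule pos_inj[OF idx_n])
      then show ?thesis using a by (intro image_eqI[of _ _ "Suc (idx x)"]) auto
    qed
  qed
  then have fin: "finite X" by (rule finite_subset) simp
  have "from_line G X" unfolding from_line_def
  proof (intro exI[of _ \<phi>] conjI allI ballI)
    show "\<phi> t \<in> positions G" for t
      using idx_dom[of t] edge_in[OF idx_n] by (simp add: \<phi>_def positions_def)
    show "\<exists>t. same_point G (\<phi> t) p" if p: "p \<in> positions G" for p
    proof -
      obtain e x where ex: "p = (e, x)" "e \<in> edges G" "x \<in> edom G e" using p by (auto simp: positions_def)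
      then obtain i where i: "i \<le> n" "es ! i = e" using all len_es by (metis in_set_conv_nth less_Suc_eq_le)
      have "pos i (sg i * (x - q i)) = x" using sg[OF i(1)] by (auto simp: pos_def)
      then show ?thesis using \<phi>_same[OF i(1), of "sg i * (x - q i)"] ex i by auto
    qed
    show "same_point G (\<phi> s) (\<phi> t) \<longleftrightarrow> s = t \<or> (\<exists>x\<in>X. (s = x \<and> t = - x) \<or> (s = - x \<and> t = x))" for s t
    proof
      assume sp: "same_point G (\<phi> s) (\<phi> t)"
      have "s = t \<or> s = - t" using abs_eq[OF sp] by linarith
      then show "s = t \<or> (\<exists>x\<in>X. (s = x \<and> t = - x) \<or> (s = - x \<and> t = x))"
      proof (cases "s = t")
        case False
        then have "s = - t" "t \<noteq> 0" using \<open>s = t \<or> s = - t\<close> by auto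
        then have "\<bar>t\<bar> \<in> X" using sp same_point_sym[OF sp] by (auto simp: X_def abs_if)
        moreover have "(s = \<bar>t\<bar> \<and> t = - \<bar>t\<bar>) \<or> (s = - \<bar>t\<bar> \<and> t = \<bar>t\<bar>)" using \<open>s = - t\<close> by linarith
        ultimately show ?thesis by blast
      qed simp
    next
      assume "s = t \<or> (\<exists>x\<in>X. (s = x \<and> t = - x) \<or> (s = - x \<and> t = x))"
      then show "same_point G (\<phi> s) (\<phi> t)" by (auto simp: X_def dest: same_point_sym)
    qed
    fix t :: real
    have pos_mem: "(es ! i, pos i s) \<in> positions G \<and> same_point G (\<phi> s) (es ! i, pos i s)"
      if "i \<le> n" "pos i s \<in> edom G (es ! i)" for i s
      using that edge_in \<phi>_same by (auto simp: positions_def)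
    define i where "i = idx t"
    define d1 where "d1 = (if i = 0 then 1 else t - tm i)"
    have d1: "d1 > 0" using idx_low[of t] by (auto simp: d1_def i_def)
    have L: "(es ! i, pos i t + sg i * (s - t)) \<in> positions G \<and> same_point G (\<phi> s) (es ! i, pos i t + sg i * (s - t))"
      if "s \<in> {t - d1..t}" for s
      unfolding pos_shift[of i s t, symmetric]
      by (rule pos_mem) (use that idx_n idx_up[of t] dom[OF idx_n, of t s] in \<open>auto simp: i_def d1_def split: if_splits\<close>)
    \<comment> \<open>Edge \<open>idx t\<close> serves the times just before t; the strict
      inequality selects the edge in use just after t.\<close>
    define k where "k = (LEAST k. k = n \<or> t < tm (Suc k))"
    have k: "k = n \<or> t < tm (Suc k)" unfolding k_def by (rule LeastI[of _ n]) simp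
    have k_le: "k \<le> k'" if "k' = n \<or> t < tm (Suc k')" for k'
      unfolding k_def using that by (rule Least_le)
    have kn: "k \<le> n" by (rule k_le) simp
    have klow: "tm k \<le> t" if "0 < k"
    proof (rule ccontr)
      assume "\<not> tm k \<le> t"
      then have "k \<le> k - 1" using that by (intro k_le) auto
      then show False using that by simp
    qed
    define d2 where "d2 = (if k = n then 1 else tm (Suc k) - t)"
    have d2: "d2 > 0" using k by (auto simp: d2_def)
    have R: "(es ! k, pos k t + sg k * (s - t)) \<in> positions G \<and> same_point G (\<phi> s) (es ! k, pos k t + sg k * (s - t))"
      if "s \<in> {t..t + d2}" for s
      unfolding pos_shift[of k s t, symmetric]
      by (rule pos_mem[OF kn]) (use that kn klow dom[OF kn, of s] in \<open>auto simp: d2_def split: if_splits\<close>)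
    show "\<exists>\<epsilon>>0. \<exists>e1 a1 \<sigma>1 e2 a2 \<sigma>2. \<sigma>1 \<in> {-1, 1} \<and> \<sigma>2 \<in> {-1, 1 :: real} \<and>
        (\<forall>s\<in>{t - \<epsilon>..t}. (e1, a1 + \<sigma>1 * (s - t)) \<in> positions G \<and> same_point G (\<phi> s) (e1, a1 + \<sigma>1 * (s - t))) \<and>
        (\<forall>s\<in>{t..t + \<epsilon>}. (e2, a2 + \<sigma>2 * (s - t)) \<in> positions G \<and> same_point G (\<phi> s) (e2, a2 + \<sigma>2 * (s - t)))"
      apply (rule exI[of _ "min d1 d2"], rule conjI, use d1 d2 in simp)
      apply (rule exI[of _ "es ! i"], rule exI[of _ "pos i t"], rule exI[of _ "sg i"])
      apply (rule exI[of _ "es ! k"], rule exI[of _ "pos k t"], rule exI[of _ "sg k"])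
      using sg[OF idx_n[of t]] sg[OF kn] L R by (auto simp: i_def)
  qed
  moreover have "X \<subseteq> {0<..}" by (auto simp: X_def)
  ultimately show ?thesis using fin by blast
qed

end


lemma soliton_time_nonneg: "0 < M \<Longrightarrow> t \<noteq> 0 \<Longrightarrow> \<bar>t\<bar> \<le> M \<Longrightarrow> 0 \<le> soliton_time M t"
  using sq_le[of t M] by (auto simp: soliton_time_def intro!: mult_nonneg_nonneg)

lemma soliton_time_max: "0 < M \<Longrightarrow> \<bar>t\<bar> = M \<Longrightarrow> soliton_time M t = 0"
  using power2_abs[of t] by (simp add: soliton_time_def)

section \<open>Rigidity of minimizers of mass mu_R\<close>

locale minimizer = trail_function +
  assumes conn: "connected_mgraph G" and E0: "energy G u g = 0" and mass: "Lnorm_pow G 2 u = mu_R"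
begin

lemma fin: "finite (edges G)" using wf by (simp add: wf_mgraph_def)

lemma sum_quad_eq: "(\<Sum>e\<in>edges G. quad e) = M^4 / 6 * mu_R"
  unfolding sum_quad E0 mass by simp

lemma sum_cost_le: "(\<Sum>e\<in>edges G. cost e) \<le> M^4 / 6 * mu_R"
  unfolding sum_quad_eq[symmetric] by (rule sum_mono) (rule cost_le_quad)

lemma sum_trail_cost: "(\<Sum>i\<le>n. cost (es ! i)) = M^4 / 6 * mu_R"
  using cost_trail_ge sum_cost_le sum_trail_le[of cost] cost_nonneg by fastforce

lemma cost_eq_quad: "e \<in> edges G \<Longrightarrow> cost e = quad e"
proof -
  assume e: "e \<in> edges G"
  have "(\<Sum>e\<in>edges G. cost e) = (\<Sum>e\<in>edges G. quad e)"
    using sum_cost_le sum_trail_cost sum_trail_le[of cost] cost_nonneg unfolding sum_quad_eq by fastforce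
  from sum_mono_inv[OF this cost_le_quad e fin] show ?thesis .
qed

lemma ae: assumes e: "e \<in> edges G" shows "AE x in lborel. x \<in> edom G e \<longrightarrow> \<bar>g e x\<bar> = \<bar>cal M (u e x)\<bar>"
proof -
  have "(LINT x:edom G e|lborel. (\<bar>g e x\<bar> - \<bar>cal M (u e x)\<bar>)\<^sup>2 / 2) = 0"
    using quad_minus_cost(1)[OF e] cost_eq_quad[OF e] by simp
  then have "AE x in lborel. indicat_real (edom G e) x *\<^sub>R ((\<bar>g e x\<bar> - \<bar>cal M (u e x)\<bar>)\<^sup>2 / 2) = 0"
    using quad_minus_cost(2)[OF e] unfolding set_lebesgue_integral_def set_integrable_def
    by (subst (asm) integral_nonneg_eq_0_iff_AE) auto
  then show ?thesis by eventually_elim auto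
qed

text \<open>The bounds \<open>cost_trail_edge\<close> add up to an equality, hence each of them is
  an equality.\<close>

lemma saturated: assumes i: "i \<le> n" shows "saturated_edge (edom G (es ! i)) (u (es ! i)) (g (es ! i)) M (pk i)"
proof -
  have "(\<Sum>i\<le>n. 2 * calF M (u (es ! i) (pk i)) - calF M (u (es ! i) 0) - calF M (far_value (edom G (es ! i)) (u (es ! i))))
      = (\<Sum>i\<le>n. cost (es ! i))"
    unfolding sum_edge_bounds[of "calF M", OF calF_0] sum_trail_cost by (rule calF_max[OF M peak])
  from sum_mono_inv[OF this cost_trail_edge, of i]
  have "2 * calF M (u (es ! i) (pk i)) - calF M (u (es ! i) 0) - calF M (far_value (edom G (es ! i)) (u (es ! i))) = cost (es ! i)"
    using i by simp
  then show ?thesis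
    unfolding saturated_edge_def saturated_edge_axioms_def
    using bounded_edge[OF edge_in[OF i]] pk_edom[OF i] ae[OF edge_in[OF i]] by auto
qed

abbreviation "edge_mass e \<equiv> (LINT x:edom G e|lborel. \<bar>u e x\<bar>^2)"

abbreviation "mass_bound i \<equiv> sqrt 3 / 2 * (2 * mass_angle M (u (es ! i) (pk i)) - mass_angle M (u (es ! i) 0)
   - mass_angle M (far_value (edom G (es ! i)) (u (es ! i))))"

lemma mass_bound_le: "i \<le> n \<Longrightarrow> mass_bound i \<le> edge_mass (es ! i)"
  using saturated_edge.mass_ge[OF saturated[of i] pk_edom[of i]] by simp

text \<open>The branches before and after the maximum sweep the angle pi / 2 each, and sqrt 3 / 2 *
  pi = \<open>mu_R\<close>: the trail alone needs the whole mass.\<close>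

lemma sum_mass_bound: "(\<Sum>i\<le>n. mass_bound i) = mu_R"
  unfolding sum_distrib_left[symmetric] sum_edge_bounds[of "mass_angle M", OF mass_angle_0] mass_angle_max[OF M peak]
  by (simp add: mu_R_def)

lemma edge_mass_nonneg: "0 \<le> edge_mass e" by (rule set_integral_nonneg') auto

lemma sum_trail_mass: "(\<Sum>i\<le>n. edge_mass (es ! i)) = mu_R"
proof (rule antisym)
  show "(\<Sum>i\<le>n. edge_mass (es ! i)) \<le> mu_R"
    using sum_trail_le[of edge_mass] edge_mass_nonneg mass by (simp add: Lnorm_pow_def)
  show "mu_R \<le> (\<Sum>i\<le>n. edge_mass (es ! i))"
    unfolding sum_mass_bound[symmetric] by (rule sum_mono) (use mass_bound_le in auto)
qed

lemma mass_bound_eq: "i \<le> n \<Longrightarrow> mass_bound i = edge_mass (es ! i)"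
  using sum_mono_inv[of mass_bound "{..n}" "\<lambda>i. edge_mass (es ! i)" i] sum_mass_bound sum_trail_mass mass_bound_le by simp

text \<open>The mass of edge i is exhausted by its angle bound, which leaves nothing for the plateau
  term.\<close>

lemma max_only_at_peak: assumes "i \<le> n" "x \<in> edom G (es ! i)" "\<bar>u (es ! i) x\<bar> = M" shows "x = pk i"
proof -
  have "M\<^sup>2 * \<bar>x - pk i\<bar> \<le> 0"
    using saturated_edge.mass_ge[OF saturated[OF assms(1)] assms(2)] assms(3) mass_bound_eq[OF assms(1)] by simp
  then show ?thesis using M by (simp add: mult_le_0_iff)
qed

lemma off_trail_zero: assumes e: "e \<in> edges G - set es" and x: "x \<in> edom G e" shows "u e x = 0"
proof (rule ccontr)
  assume nz: "u e x \<noteq> 0"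
  have pos: "0 < edge_mass e" using H1_on_mass_pos[where u="u e", OF H1pair_H1_on[OF wf H1p] x nz] e by blast
  have "(\<Sum>e\<in>set es. edge_mass e) + (\<Sum>e\<in>edges G - set es. edge_mass e) = mu_R"
    using sum.subset_diff[OF es_edges fin, of edge_mass] mass by (simp add: Lnorm_pow_def)
  then have "(\<Sum>e\<in>edges G - set es. edge_mass e) = 0" using sum_trail_mass unfolding sum_trail[of edge_mass] by simp
  moreover have "edge_mass e \<le> (\<Sum>e\<in>edges G - set es. edge_mass e)"
    by (rule member_le_sum) (use e fin edge_mass_nonneg in auto)
  ultimately show False using pos by simp
qed

text \<open>On the trail this is the Gronwall bound, off the trail u vanishes: each edge is entirely
  zero or nowhere zero.\<close>

lemma zero_iff: assumes "e \<in> edges G" "x \<in> edom G e" "y \<in> edom G e" shows "u e x = 0 \<longleftrightarrow> u e y = 0"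
proof (cases "e \<in> set es")
  case True
  then obtain i where i: "i \<le> n" "es ! i = e" using len_es by (metis in_set_conv_nth less_Suc_eq_le)
  then show ?thesis using saturated_edge.zero_iff_peak[OF saturated[OF i(1)]] assms by blast
next
  case False then show ?thesis using off_trail_zero assms by simp
qed

text \<open>Connectedness enters here: from the edge of the maximum point, nonvanishing passes from
  edge to edge through common vertices. An edge off the trail, where u = 0, then becomes
  impossible.\<close>

lemma \<psi>_nonzero: assumes "v \<in> verts G" shows "\<psi> v \<noteq> 0"
proof -
  let ?w = "src G (es ! j)"
  have e: "es ! j \<in> edges G" by (rule edge_in[OF j])
  have "0 \<in> edom G (es ! j)" by (rule edge_interval_0[OF edge_interval_edom[OF wf e]])
  then have w: "\<psi> ?w \<noteq> 0" using zero_iff[OF e x0, of 0] peak M \<psi>(1)[OF e] by auto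
  have "?w \<in> verts G" using wf e by (auto simp: wf_mgraph_def)
  then have "(?w, v) \<in> (adj G)\<^sup>*" using conn assms by (auto simp: connected_mgraph_def)
  then show ?thesis
  proof (induction rule: rtrancl_induct)
    case base show ?case by (rule w)
  next
    case (step y z)
    then obtain e where e: "e \<in> edges G" "e \<notin> halflines G"
      "(src G e = y \<and> tgt G e = z) \<or> (src G e = z \<and> tgt G e = y)" by (auto simp: adj_def)
    have "0 \<in> edom G e" "len G e \<in> edom G e" using e wf by (auto simp: edom_def wf_mgraph_def less_imp_le)
    then show ?case using zero_iff[OF e(1), of 0 "len G e"] \<psi>(1)[OF e(1)] \<psi>(2)[OF e(1,2)] e(3) step.IH by auto
  qed
qed

lemma all_nonzero: assumes "e \<in> edges G" "x \<in> edom G e" shows "u e x \<noteq> 0"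
proof -
  have "src G e \<in> verts G" using wf assms by (auto simp: wf_mgraph_def)
  then show ?thesis using zero_iff[OF assms(1) edge_interval_0[OF edge_interval_edom[OF wf assms(1)]] assms(2)] \<psi>(1)[OF assms(1)] \<psi>_nonzero
    by auto
qed

lemma trail_covers: "set es = edges G"
  using es_edges off_trail_zero all_nonzero edge_interval_0[OF edge_interval_edom[OF wf]] by blast

abbreviation "T \<equiv> soliton_time M"

lemma time_eq: assumes i: "i \<le> n" and x: "x \<in> edom G (es ! i)"
  shows "T (u (es ! i) x) = T (u (es ! i) (pk i)) + \<bar>x - pk i\<bar>"
proof (rule saturated_edge.time_eq[OF saturated[OF i] _ _ x])
  fix y assume y: "y \<in> edom G (es ! i)"
  show "u (es ! i) y \<noteq> 0" by (rule all_nonzero[OF edge_in[OF i] y])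
  assume "y \<noteq> pk i"
  then show "\<bar>u (es ! i) y\<bar> < M" using max_only_at_peak[OF i y] bd[OF edge_in[OF i] y] by fastforce
qed

text \<open>Signed distance from the maximum point along the trail, for the nodes 1 to n. The
  maximum lies on edge j, between nodes j and j + 1, so nodes up to j come before it.\<close>

definition node_time :: "nat \<Rightarrow> real" where
  "node_time k = (if k \<le> j then - T (node_val \<psi> k) else T (node_val \<psi> k))"

text \<open>The time at which the run passes \<open>pk i\<close>.\<close>

definition peak_time :: "nat \<Rightarrow> real" where
  "peak_time i = (if i < j then node_time (Suc i) else if i = j then 0 else node_time i)"

definition dir :: "nat \<Rightarrow> real" where
  "dir i = (if fwd i then 1 else -1)"

definition run :: "nat \<Rightarrow> real \<Rightarrow> real" where
  "run i s = (pk i - dir i * peak_time i) + dir i * s"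

lemma node_dist: assumes "i \<le> n"
  shows "0 < i \<Longrightarrow> T (node_val \<psi> i) = T (u (es ! i) (pk i)) + \<bar>start_pos i - pk i\<bar>"
    and "i < n \<Longrightarrow> T (node_val \<psi> (Suc i)) = T (u (es ! i) (pk i)) + \<bar>end_pos i - pk i\<bar>"
  using time_eq[OF assms start_pos_edom] time_eq[OF assms end_pos_edom] u_start u_end assms by auto

lemma T_peak: "T (u (es ! j) x0) = 0" by (rule soliton_time_max[OF M peak])

lemma start_end_dist: "0 < i \<Longrightarrow> i < n \<Longrightarrow> end_pos i - start_pos i = dir i * len G (es ! i) \<and> 0 < len G (es ! i)"
  using len_pos[of i] halfline_iff[of i] by (auto simp: end_pos_def start_pos_def dir_def)

lemma run_start: assumes "0 < i" "i \<le> n" shows "run i (node_time i) = start_pos i"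
proof -
  consider "i < j" | "i = j" | "i > j" by linarith
  then show ?thesis
  proof cases
    case 1
    then have "i < n" using j by simp
    \<comment> \<open>\<open>soliton_time\<close> falls towards the maximum by the length of the
      edge; the minus sign in \<open>node_time\<close> turns this into an increase.\<close>
    then have "node_time i = node_time (Suc i) - len G (es ! i)"
      using node_dist(1)[OF assms(2,1)] u_pk[OF assms(2)] 1 start_end_dist[OF assms(1)]
      by (auto simp: node_time_def pk_def dir_def split: if_splits)
    then show ?thesis using 1 start_end_dist[OF assms(1) \<open>i < n\<close>] by (simp add: run_def pk_def peak_time_def right_diff_distrib)
  next
    case 2
    have "node_time i = - \<bar>start_pos i - x0\<bar>"
      using node_dist(1)[OF assms(2,1)] 2 T_peak by (simp add: node_time_def pk_def)
    moreover have "dir i * \<bar>start_pos i - x0\<bar> = x0 - start_pos i"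
      using x0 2 bwdD[OF assms(2)] assms(1) by (auto simp: dir_def start_pos_def edom_def split: if_splits)
    ultimately show ?thesis using 2 by (simp add: run_def pk_def peak_time_def)
  next
    case 3 then show ?thesis by (simp add: run_def pk_def peak_time_def)
  qed
qed

lemma run_end: assumes "i < n" shows "run i (node_time (Suc i)) = end_pos i"
proof -
  have i: "i \<le> n" using assms by simp
  consider "i < j" | "i = j" | "i > j" by linarith
  then show ?thesis
  proof cases
    case 1 then show ?thesis by (simp add: run_def pk_def peak_time_def)
  next
    case 2
    have "node_time (Suc i) = \<bar>end_pos i - x0\<bar>"
      using node_dist(2)[OF i assms] 2 T_peak by (simp add: node_time_def pk_def)
    moreover have "dir i * \<bar>end_pos i - x0\<bar> = end_pos i - x0"
      using x0 2 fwdD[OF i] assms by (auto simp: dir_def end_pos_def edom_def split: if_splits)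
    ultimately show ?thesis using 2 by (simp add: run_def pk_def peak_time_def)
  next
    case 3
    then have "0 < i" by simp
    have "node_time (Suc i) = node_time i + len G (es ! i)"
      using node_dist(2)[OF i assms] u_pk[OF i] 3 start_end_dist[OF \<open>0 < i\<close> assms]
      by (auto simp: node_time_def pk_def dir_def split: if_splits)
    then show ?thesis using 3 start_end_dist[OF \<open>0 < i\<close> assms] by (simp add: run_def pk_def peak_time_def distrib_left)
  qed
qed

lemma run_dom: assumes i: "i \<le> n"
  shows "run i s \<in> edom G (es ! i) \<longleftrightarrow> (0 < i \<longrightarrow> node_time i \<le> s) \<and> (i < n \<longrightarrow> s \<le> node_time (Suc i))"
proof (cases "fwd i")
  case True
  then have "0 < i" "i = n \<longleftrightarrow> es ! i \<in> halflines G" using fwdD[OF i True] by (auto split: if_splits)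
  then show ?thesis using run_start[of i] run_end[of i] i True
    by (cases "i = n") (auto simp: run_def dir_def start_pos_def end_pos_def edom_def)
next
  case False
  then have "i < n" "i = 0 \<longleftrightarrow> es ! i \<in> halflines G" using bwdD[OF i False] by (auto split: if_splits)
  then show ?thesis using run_start[of i] run_end[of i] i False
    by (cases "i = 0") (auto simp: run_def dir_def start_pos_def end_pos_def edom_def)
qed

lemma node_time_mono: assumes "0 < i" "i < n" shows "node_time i < node_time (Suc i)"
proof -
  have "dir i * (node_time (Suc i) - node_time i) = dir i * len G (es ! i)"
    using run_start[of i] run_end[of i] start_end_dist[OF assms] assms by (simp add: run_def right_diff_distrib)
  then show ?thesis using start_end_dist[OF assms] by (auto simp: dir_def split: if_splits)
qed

text \<open>The reason for taking \<open>soliton_time\<close> as the clock: equal values of u now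
  mean equal |s|, so different times at one point of G are opposite. Away from edge j the sign of
  \<open>s - peak_time i\<close> is constant on the edge and resolves the modulus.\<close>

lemma T_run: assumes i: "i \<le> n" and s: "run i s \<in> edom G (es ! i)" shows "T (u (es ! i) (run i s)) = \<bar>s\<bar>"
proof -
  have r: "run i s - pk i = dir i * (s - peak_time i)" by (simp add: run_def right_diff_distrib)
  have d: "\<bar>run i s - pk i\<bar> = \<bar>s - peak_time i\<bar>" unfolding r by (simp add: dir_def abs_mult)
  have Tp: "0 \<le> T (u (es ! i) (pk i))"
    using soliton_time_nonneg[OF M all_nonzero bd] edge_in[OF i] pk_edom[OF i] by blast
  have t: "T (u (es ! i) (run i s)) = T (u (es ! i) (pk i)) + \<bar>s - peak_time i\<bar>" using time_eq[OF i s] d by simp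
  consider "i < j" | "i = j" | "i > j" by linarith
  then show ?thesis
  proof cases
    case 1
    then have "T (u (es ! i) (pk i)) = - peak_time i" using u_pk[OF i] by (simp add: peak_time_def node_time_def)
    moreover have "s \<le> peak_time i" using run_dom[OF i, of s] s 1 j by (simp add: peak_time_def)
    ultimately show ?thesis using t Tp by simp
  next
    case 2 then show ?thesis using t T_peak by (simp add: pk_def peak_time_def)
  next
    case 3
    then have "T (u (es ! i) (pk i)) = peak_time i" using u_pk[OF i] by (simp add: peak_time_def node_time_def)
    moreover have "peak_time i \<le> s" using run_dom[OF i, of s] s 3 by (simp add: peak_time_def)
    ultimately show ?thesis using t Tp by simp
  qed
qed

lemma u_same_point:
  assumes p: "(e, x) \<in> positions G" "(e', x') \<in> positions G" "same_point G (e, x) (e', x')"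
  shows "u e x = u e' x'"
proof -
  have v: "u e x = \<psi> v" if "vertex_at G (e, x) = Some v" "(e, x) \<in> positions G" for e x v
    using that \<psi>(1)[of e] \<psi>(2)[of e] by (auto simp: vertex_at_def positions_def split: if_splits)
  show ?thesis
  proof (cases "(e, x) = (e', x')")
    case False
    then obtain w where "vertex_at G (e, x) = Some w" "vertex_at G (e', x') = Some w"
      using p(3) by (metis not_None_eq same_point_def)
    then show ?thesis using v p by metis
  qed simp
qed

theorem line_or_tower: "is_real_line G \<or> bubble_tower G"
proof -
  have "\<exists>X. finite X \<and> X \<subseteq> {0<..} \<and> from_line G X"
  proof (rule from_line_of_run[where q="\<lambda>i. pk i - dir i * peak_time i" and sg=dir and tm=node_time, folded run_def])
    fix i k s t assume h: "i \<le> n" "k \<le> n" "run i s \<in> edom G (es ! i)" "run k t \<in> edom G (es ! k)"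
      "same_point G (es ! i, run i s) (es ! k, run k t)"
    then have "u (es ! i) (run i s) = u (es ! k) (run k t)"
      using edge_in by (intro u_same_point) (auto simp: positions_def)
    then show "\<bar>s\<bar> = \<bar>t\<bar>" using T_run[OF h(1,3)] T_run[OF h(2,4)] by simp
  qed (use trail_covers run_dom node_time_mono run_start run_end in \<open>auto simp: dir_def\<close>)
  then show ?thesis unfolding is_real_line_def bubble_tower_def by metis
qed

end

lemma minimizer_imp_line_or_tower:
  assumes G: "wf_mgraph G" "connected_mgraph G" "noncompact G" "assumption_H G"
    and H1: "H1pair G u g" and m: "Lnorm_pow G 2 u = mu_R" and E: "energy G u g = 0"
  shows "is_real_line G \<or> bubble_tower G"
proof -
  have "\<exists>e\<in>edges G. \<exists>x\<in>edom G e. u e x \<noteq> 0"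
    using Lnorm_pow_zero[OF G(1), of u] m mu_R_pos by fastforce
  then obtain e x where "e \<in> edges G" "x \<in> edom G e" "u e x \<noteq> 0" by blast
  from trail_function_exists[OF G(1,3,4) H1 this]
  obtain es vs fwd n \<psi> M j x0 where "trail_function G es vs fwd n u g \<psi> M j x0" .
  then have "minimizer G es vs fwd n u g \<psi> M j x0"
    using G(2) E m by (simp add: minimizer_def minimizer_axioms_def)
  then show ?thesis by (rule minimizer.line_or_tower)
qed

section \<open>Solitons on the line\<close>

text \<open>The soliton of height 1, the square root of a hyperbolic secant.\<close>

definition soliton :: "real \<Rightarrow> real" where
  "soliton x = 1 / sqrt (cosh (2 / sqrt 3 * x))"

definition soliton' :: "real \<Rightarrow> real" where
  "soliton' x = - (1 / sqrt 3) * soliton x * tanh (2 / sqrt 3 * x)"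

lemma soliton_pos: "0 < soliton x"
  by (simp add: soliton_def cosh_real_pos)

lemma soliton_abs: "\<bar>s\<bar> = \<bar>t\<bar> \<Longrightarrow> soliton s = soliton t"
  by (auto simp: soliton_def abs_eq_iff)

lemma soliton_sq: "(soliton x)\<^sup>2 = 1 / cosh (2 / sqrt 3 * x)"
  using cosh_real_pos[of "2 / sqrt 3 * x"] by (simp add: soliton_def power_divide)

lemma soliton_pow6: "soliton x ^ 6 = 1 / cosh (2 / sqrt 3 * x) ^ 3"
proof -
  have "soliton x ^ 6 = ((soliton x)\<^sup>2) ^ 3" by (simp flip: power_mult)
  then show ?thesis by (simp add: soliton_sq power_divide)
qed

text \<open>The equation |u'| = \<open>cal 1 u\<close>, squared; it reduces the norm of the
  derivative to the two other norms.\<close>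

lemma soliton'_sq: "(soliton' x)\<^sup>2 = ((soliton x)\<^sup>2 - soliton x ^ 6) / 3"
proof -
  let ?c = "cosh (2 / sqrt 3 * x)"
  have c: "?c > 0" by (rule cosh_real_pos)
  have "(tanh (2 / sqrt 3 * x))\<^sup>2 = 1 - 1 / ?c\<^sup>2"
    using c by (simp add: tanh_def power_divide sinh_square_eq diff_divide_distrib)
  then have "(soliton' x)\<^sup>2 = (1 / ?c) * (1 - 1 / ?c\<^sup>2) / 3"
    by (simp add: soliton'_def power_mult_distrib power_divide soliton_sq)
  also have "\<dots> = (1 / ?c - 1 / ?c ^ 3) / 3" using c by (simp add: field_simps eval_nat_numeral)
  finally show ?thesis by (simp add: soliton_sq soliton_pow6)
qed

lemma soliton_deriv: "(soliton has_real_derivative soliton' x) (at x within A)"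
proof -
  let ?y = "2 / sqrt 3 * x"
  have c: "cosh ?y > 0" by (rule cosh_real_pos)
  have "((\<lambda>x. cosh (k * x)) has_real_derivative sinh (k * x) * k) (at x within A)" for k :: real
    by (auto intro!: derivative_eq_intros)
  from DERIV_divide[OF DERIV_const[of 1] DERIV_chain2[OF DERIV_real_sqrt[OF c] this]]
  have "((\<lambda>x. 1 / sqrt (cosh (2 / sqrt 3 * x))) has_real_derivative
     (0 * sqrt (cosh ?y) - 1 * (inverse (sqrt (cosh ?y)) / 2 * (sinh ?y * (2 / sqrt 3)))) / (sqrt (cosh ?y) * sqrt (cosh ?y))) (at x within A)"
    using c by simp
  moreover have "(0 * sqrt (cosh ?y) - 1 * (inverse (sqrt (cosh ?y)) / 2 * (sinh ?y * (2 / sqrt 3)))) / (sqrt (cosh ?y) * sqrt (cosh ?y)) = soliton' x"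
    using c by (simp add: soliton'_def soliton_def tanh_def inverse_eq_divide)
  ultimately show ?thesis unfolding soliton_def[abs_def] by simp
qed

lemma soliton_cont: "continuous_on A soliton"
  by (rule DERIV_continuous_on[OF soliton_deriv])

lemma soliton'_cont: "continuous_on A soliton'"
  unfolding soliton'_def[abs_def] tanh_def by (intro continuous_intros soliton_cont) (auto simp: cosh_real_nonzero)

lemma soliton_antimono: "\<bar>x\<bar> \<le> y \<Longrightarrow> soliton y \<le> soliton x"
proof -
  assume "\<bar>x\<bar> \<le> y"
  then have y: "0 \<le> y" by linarith
  have "\<bar>2 / sqrt 3 * x\<bar> \<le> 2 / sqrt 3 * y" using \<open>\<bar>x\<bar> \<le> y\<close> by (simp add: abs_mult mult_left_mono divide_right_mono)
  then have "cosh \<bar>2 / sqrt 3 * x\<bar> \<le> cosh (2 / sqrt 3 * y)" by (intro cosh_real_nonneg_le_iff[THEN iffD2]) (use y in auto)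
  moreover have "cosh \<bar>z\<bar> = cosh z" for z :: real by (simp add: abs_if)
  ultimately have "cosh (2 / sqrt 3 * x) \<le> cosh (2 / sqrt 3 * y)" by metis
  then show ?thesis unfolding soliton_def using cosh_real_pos by (intro divide_left_mono) auto
qed

lemma soliton_less: "0 < y \<Longrightarrow> soliton y < soliton 0"
proof -
  assume "0 < y"
  then have "cosh 0 < cosh (2 / sqrt 3 * y)" by (intro cosh_real_nonneg_less_iff[THEN iffD2]) auto
  then show ?thesis unfolding soliton_def using cosh_real_pos[of "2 / sqrt 3 * y"] by simp
qed

lemma cosh_scaled_at_top: "filterlim (\<lambda>x. cosh (2 / sqrt 3 * x) :: real) at_top at_top"
  by (rule filterlim_compose[OF cosh_real_at_top filterlim_tendsto_pos_mult_at_top[OF tendsto_const _ filterlim_ident]]) simp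

lemma soliton_tendsto_0: "(soliton \<longlongrightarrow> 0) at_top"
  unfolding soliton_def[abs_def]
  by (intro tendsto_divide_0[OF tendsto_const] filterlim_at_top_imp_at_infinity
      filterlim_compose[OF sqrt_at_top cosh_scaled_at_top])

lemma integral_line_FTC:
  fixes f F :: "real \<Rightarrow> real"
  assumes "\<And>x. (F has_real_derivative f x) (at x)" "continuous_on UNIV f" "\<And>x. 0 \<le> f x"
    and "(F \<longlongrightarrow> A) at_bot" "(F \<longlongrightarrow> B) at_top"
  shows "integrable lborel f" "(LINT x|lborel. f x) = B - A"
proof -
  have c: "isCont f x" for x using assms(2) by (simp add: continuous_on_eq_continuous_at)
  have "set_integrable lborel (einterval (-\<infinity>) \<infinity>) f" "(LBINT x=-\<infinity>..\<infinity>. f x) = B - A"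
    by (rule interval_integral_FTC_nonneg[where F=F]; use assms c in \<open>simp add: ereal_tendsto_simps\<close>)+
  then show "integrable lborel f" "(LINT x|lborel. f x) = B - A"
    by (simp_all add: set_integrable_def interval_lebesgue_integral_def set_lebesgue_integral_def)
qed

lemma soliton_scaled_limits:
  shows "((\<lambda>x. arctan (sinh (2 / sqrt 3 * x))) \<longlongrightarrow> pi / 2) at_top"
    and "((\<lambda>x. arctan (sinh (2 / sqrt 3 * x))) \<longlongrightarrow> - (pi / 2)) at_bot"
    and "((\<lambda>x. sinh (2 / sqrt 3 * x) / cosh (2 / sqrt 3 * x) ^ 2 :: real) \<longlongrightarrow> 0) at_top"
    and "((\<lambda>x. sinh (2 / sqrt 3 * x) / cosh (2 / sqrt 3 * x) ^ 2 :: real) \<longlongrightarrow> 0) at_bot"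
proof -
  have m: "filterlim (\<lambda>x. 2 / sqrt 3 * x) at_top at_top"
    by (rule filterlim_tendsto_pos_mult_at_top[OF tendsto_const _ filterlim_ident]) simp
  show 1: "((\<lambda>x. arctan (sinh (2 / sqrt 3 * x))) \<longlongrightarrow> pi / 2) at_top"
    by (rule filterlim_compose[OF tendsto_arctan_at_top filterlim_compose[OF sinh_real_at_top m]])
  show "((\<lambda>x. arctan (sinh (2 / sqrt 3 * x))) \<longlongrightarrow> - (pi / 2)) at_bot"
    unfolding filterlim_at_bot_mirror using tendsto_minus[OF 1] by (simp add: arctan_minus)
  have le: "norm (sinh y / cosh y ^ 2) \<le> 1 / cosh y" for y :: real
  proof -
    have "(sinh y)\<^sup>2 \<le> (cosh y)\<^sup>2" by (simp add: sinh_square_eq)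
    then have "\<bar>sinh y\<bar> \<le> cosh y" using cosh_real_pos[of y] by (simp add: abs_le_square_iff[symmetric] abs_of_pos)
    then have "\<bar>sinh y\<bar> / cosh y ^ 2 \<le> cosh y / cosh y ^ 2" by (intro divide_right_mono) auto
    then show ?thesis using cosh_real_pos[of y] by (simp add: power2_eq_square)
  qed
  show 3: "((\<lambda>x. sinh (2 / sqrt 3 * x) / cosh (2 / sqrt 3 * x) ^ 2 :: real) \<longlongrightarrow> 0) at_top"
  proof (rule Lim_null_comparison[OF always_eventually])
    show "((\<lambda>x. 1 / cosh (2 / sqrt 3 * x) :: real) \<longlongrightarrow> 0) at_top"
      by (intro tendsto_divide_0[OF tendsto_const] filterlim_at_top_imp_at_infinity cosh_scaled_at_top)
  qed (use le in blast)
  show "((\<lambda>x. sinh (2 / sqrt 3 * x) / cosh (2 / sqrt 3 * x) ^ 2 :: real) \<longlongrightarrow> 0) at_bot"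
    unfolding filterlim_at_bot_mirror using tendsto_minus[OF 3] by simp
qed

lemma arctan_sinh_deriv: "((\<lambda>x. arctan (sinh (k * x))) has_real_derivative k / cosh (k * x)) (at x)" for k :: real
proof -
  let ?y = "k * x"
  have "1 + (sinh ?y)\<^sup>2 = (cosh ?y)\<^sup>2" by (simp add: sinh_square_eq)
  then have "inverse (1 + (sinh ?y)\<^sup>2) * (cosh ?y * k) = k / cosh ?y"
    using cosh_real_pos[of ?y] by (simp add: field_simps power2_eq_square)
  moreover have "((\<lambda>x. arctan (sinh (k * x))) has_real_derivative inverse (1 + (sinh ?y)\<^sup>2) * (cosh ?y * k)) (at x)"
    by (auto intro!: derivative_eq_intros)
  ultimately show ?thesis by simp
qed

text \<open>The square is a hyperbolic secant, with the Gudermannian arctan (sinh y) as primitive;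
  its total angle pi times sqrt 3 / 2 is \<open>mu_R\<close>.\<close>

lemma soliton_mass: "integrable lborel (\<lambda>x. (soliton x)\<^sup>2)" "(LINT x|lborel. (soliton x)\<^sup>2) = mu_R"
proof -
  have d: "((\<lambda>x. sqrt 3 / 2 * arctan (sinh (2 / sqrt 3 * x))) has_real_derivative (soliton x)\<^sup>2) (at x)" for x
    using DERIV_cmult[OF arctan_sinh_deriv[of "2 / sqrt 3" x], of "sqrt 3 / 2"] by (simp add: soliton_sq)
  have c: "continuous_on UNIV (\<lambda>x. (soliton x)\<^sup>2)" by (intro continuous_intros soliton_cont)
  note I = integral_line_FTC[OF d c zero_le_power2
      tendsto_mult_left[OF soliton_scaled_limits(2)] tendsto_mult_left[OF soliton_scaled_limits(1)]]
  show "integrable lborel (\<lambda>x. (soliton x)\<^sup>2)" by (rule I(1))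
  show "(LINT x|lborel. (soliton x)\<^sup>2) = mu_R" unfolding I(2) mu_R_def by simp
qed

text \<open>The cube of sech has the primitive (sinh / cosh^2 + arctan sinh) / 2. The first term
  vanishes at both ends, which leaves half the mass; with \<open>soliton'_L2\<close> the energy is
  \<open>mu_R\<close> / 12 - \<open>mu_R\<close> / 12 = 0.\<close>

lemma soliton_L6: "integrable lborel (\<lambda>x. soliton x ^ 6)" "(LINT x|lborel. soliton x ^ 6) = mu_R / 2"
proof -
  let ?F = "\<lambda>x. sqrt 3 / 4 * (sinh (2 / sqrt 3 * x) / cosh (2 / sqrt 3 * x) ^ 2 + arctan (sinh (2 / sqrt 3 * x)))"
  have d: "(?F has_real_derivative soliton x ^ 6) (at x)" for x
  proof -
    let ?c = "cosh (2 / sqrt 3 * x)" and ?s = "sinh (2 / sqrt 3 * x)"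
    have c: "?c > 0" by (rule cosh_real_pos)
    have "((\<lambda>x. sinh (k * x) / cosh (k * x) ^ 2) has_real_derivative
        ((cosh (k * x) * k) * cosh (k * x)^2 - sinh (k * x) * (2 * cosh (k * x) * (sinh (k * x) * k))) / (cosh (k * x)^2 * cosh (k * x)^2)) (at x)"
      for k :: real using cosh_real_pos[of "k * x"] by (auto intro!: derivative_eq_intros)
    from this[of "2 / sqrt 3"]
    have "((\<lambda>x. sinh (2 / sqrt 3 * x) / cosh (2 / sqrt 3 * x) ^ 2) has_real_derivative
        ((?c * (2 / sqrt 3)) * ?c^2 - ?s * (2 * ?c * (?s * (2 / sqrt 3)))) / (?c^2 * ?c^2)) (at x)" .
    moreover have "((?c * (2 / sqrt 3)) * ?c^2 - ?s * (2 * ?c * (?s * (2 / sqrt 3)))) / (?c^2 * ?c^2) = (2 / sqrt 3) * (2 / ?c^3 - 1 / ?c)"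
    proof -
      have "(?c * (2 / sqrt 3)) * ?c^2 - ?s * (2 * ?c * (?s * (2 / sqrt 3))) = (2 / sqrt 3) * (?c * ?c^2 - 2 * ?c * ?s^2)"
        by (simp add: algebra_simps power2_eq_square)
      also have "?c * ?c^2 - 2 * ?c * ?s^2 = 2 * ?c - ?c^3"
        unfolding sinh_square_eq by (simp add: algebra_simps eval_nat_numeral)
      finally have "(?c * (2 / sqrt 3)) * ?c^2 - ?s * (2 * ?c * (?s * (2 / sqrt 3))) = (2 / sqrt 3) * (2 * ?c - ?c^3)" .
      moreover have "k * (2 * y - y^3) / (y^2 * y^2) = k * (2 / y^3 - 1 / y)" if "y > 0" for k y :: real
        using that by (simp add: field_simps eval_nat_numeral)
      ultimately show ?thesis using c by presburger
    qed
    ultimately have "((\<lambda>x. sinh (2 / sqrt 3 * x) / cosh (2 / sqrt 3 * x) ^ 2) has_real_derivative (2 / sqrt 3) * (2 / ?c^3 - 1 / ?c)) (at x)"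
      by simp
    from DERIV_cmult[OF DERIV_add[OF this arctan_sinh_deriv[of "2 / sqrt 3" x]], of "sqrt 3 / 4"]
    have "(?F has_real_derivative sqrt 3 / 4 * ((2 / sqrt 3) * (2 / ?c^3 - 1 / ?c) + (2 / sqrt 3) / ?c)) (at x)" .
    moreover have "sqrt 3 / 4 * ((2 / sqrt 3) * (2 / ?c^3 - 1 / ?c) + (2 / sqrt 3) / ?c) = soliton x ^ 6"
      using c by (simp add: soliton_pow6 field_simps)
    ultimately show ?thesis by simp
  qed
  have c: "continuous_on UNIV (\<lambda>x. soliton x ^ 6)" by (intro continuous_intros soliton_cont)
  have nn: "0 \<le> soliton x ^ 6" for x by simp
  note I = integral_line_FTC[OF d c nn
      tendsto_mult_left[OF tendsto_add[OF soliton_scaled_limits(4,2)]] tendsto_mult_left[OF tendsto_add[OF soliton_scaled_limits(3,1)]]]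
  show "integrable lborel (\<lambda>x. soliton x ^ 6)" by (rule I(1))
  show "(LINT x|lborel. soliton x ^ 6) = mu_R / 2" unfolding I(2) mu_R_def by simp
qed

lemma soliton'_L2: "integrable lborel (\<lambda>x. (soliton' x)\<^sup>2)" "(LINT x|lborel. (soliton' x)\<^sup>2) = mu_R / 6"
  unfolding soliton'_sq using soliton_mass soliton_L6 by simp_all

lemma set_integral_FTC:
  fixes f F :: "real \<Rightarrow> real"
  assumes "a \<le> b" "\<And>x. x \<in> {a..b} \<Longrightarrow> (F has_real_derivative f x) (at x within {a..b})" "continuous_on {a..b} f"
  shows "(LINT x:{a..b}|lborel. f x) = F b - F a"
proof -
  have "(f has_integral (F b - F a)) {a..b}"
    by (rule fundamental_theorem_of_calculus[OF assms(1)])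
       (use assms(2) in \<open>simp add: has_real_derivative_iff_has_vector_derivative\<close>)
  then show ?thesis
    using set_borel_integral_eq_integral(2)[OF borel_integrable_atLeastAtMost'[OF assms(3)]] by (simp add: integral_unique)
qed

section \<open>Test functions on a halfline\<close>

text \<open>Extension by zero is continuous because U 0 = 0. The power is positive because 0^0 =
  1.\<close>

lemma H1pair_on_halfline:
  assumes G: "wf_mgraph G" and h: "h \<in> halflines G" and H: "H1_on {0..} U W" and U0: "U 0 = 0"
  shows "H1pair G (\<lambda>e. if e = h then U else (\<lambda>_. 0)) (\<lambda>e. if e = h then W else (\<lambda>_. 0))"
    and "0 < p \<Longrightarrow> Lnorm_pow G p (\<lambda>e. if e = h then f else (\<lambda>_. 0)) = (LINT x:{0..}|lborel. \<bar>f x\<bar> ^ p)"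
proof -
  have he: "h \<in> edges G" "finite (edges G)" using h G by (auto simp: wf_mgraph_def)
  show "H1pair G (\<lambda>e. if e = h then U else (\<lambda>_. 0)) (\<lambda>e. if e = h then W else (\<lambda>_. 0))"
    unfolding H1pair_def
  proof (intro conjI ballI exI[of _ "\<lambda>_. 0"])
    fix e x assume e: "e \<in> edges G" "x \<in> edom G e"
    show "(if e = h then U else (\<lambda>_. 0)) x = (if e = h then U else (\<lambda>_. 0)) 0 +
       set_lebesgue_integral lborel {0..x} (if e = h then W else (\<lambda>_. 0))"
    proof (cases "e = h")
      case True
      then have "x \<in> {0..}" using e h by (simp add: edom_def)
      then have "U x = U 0 + set_lebesgue_integral lborel {0..x} W" using H unfolding H1_on_def by blast
      then show ?thesis using True by simp
    qed (simp add: set_lebesgue_integral_def)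
  next
    fix e assume e: "e \<in> edges G"
    have hd: "edom G h = {0..}" using h by (simp add: edom_def)
    have *: "set_borel_measurable lborel {0..} W" "set_integrable lborel {0..} (\<lambda>x. (W x)\<^sup>2)" "set_integrable lborel {0..} (\<lambda>x. (U x)\<^sup>2)"
      using H unfolding H1_on_def by blast+
    show "set_borel_measurable lborel (edom G e) (if e = h then W else (\<lambda>_. 0))"
      using *(1) hd by (auto simp: set_borel_measurable_def)
    show "set_integrable lborel (edom G e) (\<lambda>x. ((if e = h then W else (\<lambda>_. 0)) x)\<^sup>2)"
      using *(2) hd by (auto simp: set_integrable_def)
    show "set_integrable lborel (edom G e) (\<lambda>x. ((if e = h then U else (\<lambda>_. 0)) x)\<^sup>2)"
      using *(3) hd by (auto simp: set_integrable_def)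
    show "(if e = h then U else (\<lambda>_. 0)) 0 = 0" using U0 by simp
    show "e \<notin> halflines G \<longrightarrow> (if e = h then U else (\<lambda>_. 0)) (len G e) = 0" using h by auto
  qed
  assume p: "0 < p"
  have "(\<Sum>e\<in>edges G - {h}. LINT x:edom G e|lborel. \<bar>(if e = h then f else (\<lambda>_. 0)) x\<bar> ^ p) = 0"
    by (rule sum.neutral) (use p in \<open>simp add: set_lebesgue_integral_def\<close>)
  then show "Lnorm_pow G p (\<lambda>e. if e = h then f else (\<lambda>_. 0)) = (LINT x:{0..}|lborel. \<bar>f x\<bar> ^ p)"
    unfolding Lnorm_pow_def sum.remove[OF he(2,1)] using h by (simp add: edom_def)
qed

text \<open>Lowering the soliton by its value at L, rather than truncating it, makes the function
  vanish continuously at -L and L and keeps it below the soliton.\<close>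

definition cutoff :: "real \<Rightarrow> real \<Rightarrow> real" where
  "cutoff L x = indicator {-L..L} x * (soliton x - soliton L)"

definition cutoff' :: "real \<Rightarrow> real \<Rightarrow> real" where
  "cutoff' L x = indicator {-L..L} x * soliton' x"

lemma cutoff_measurable: "cutoff L \<in> borel_measurable lborel" "cutoff' L \<in> borel_measurable lborel"
proof -
  have "soliton \<in> borel_measurable borel" "soliton' \<in> borel_measurable borel"
    by (rule borel_measurable_continuous_onI[OF soliton_cont] borel_measurable_continuous_onI[OF soliton'_cont])+
  then show "cutoff L \<in> borel_measurable lborel" "cutoff' L \<in> borel_measurable lborel"
    unfolding cutoff_def[abs_def] cutoff'_def[abs_def] by measurable
qed

lemma cutoff_le: "\<bar>cutoff L x\<bar> \<le> soliton x"
  using soliton_antimono[of x L] soliton_pos[of x] soliton_pos[of L]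
  by (cases "x \<in> {-L..L}") (auto simp: cutoff_def)

lemma cutoff_pow_le: "\<bar>cutoff L x\<bar> ^ p \<le> soliton x ^ p"
  by (rule power_mono[OF cutoff_le]) simp

lemma cutoff'_sq_le: "\<bar>cutoff' L x\<bar>\<^sup>2 \<le> (soliton' x)\<^sup>2"
  by (auto simp: cutoff'_def split: split_indicator)

lemma cutoff_integrable:
  shows "integrable lborel (\<lambda>x. \<bar>cutoff L x\<bar>^2)" "integrable lborel (\<lambda>x. \<bar>cutoff' L x\<bar>^2)"
proof -
  show "integrable lborel (\<lambda>x. \<bar>cutoff L x\<bar>^2)"
    by (rule Bochner_Integration.integrable_bound[OF soliton_mass(1)])
       (use cutoff_measurable[of L] cutoff_pow_le[of L _ 2] in auto)
  show "integrable lborel (\<lambda>x. \<bar>cutoff' L x\<bar>^2)"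
    by (rule Bochner_Integration.integrable_bound[OF soliton'_L2(1)])
       (use cutoff_measurable[of L] cutoff'_sq_le[of L] in auto)
qed

lemma cutoff_limits:
  shows "((\<lambda>L. LINT x|lborel. \<bar>cutoff L x\<bar>^2) \<longlongrightarrow> mu_R) at_top"
    and "((\<lambda>L. LINT x|lborel. \<bar>cutoff L x\<bar>^6) \<longlongrightarrow> mu_R / 2) at_top"
    and "((\<lambda>L. LINT x|lborel. \<bar>cutoff' L x\<bar>^2) \<longlongrightarrow> mu_R / 6) at_top"
proof -
  have ev: "\<forall>\<^sub>F L in at_top. indicat_real {-L..L} x = 1" for x :: real
    using eventually_ge_at_top[of "\<bar>x\<bar>"] by eventually_elim (auto simp: indicator_def)
  have "((\<lambda>L. 1 * (soliton x - soliton L)) \<longlongrightarrow> 1 * (soliton x - 0)) at_top" for x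
    by (intro tendsto_intros soliton_tendsto_0)
  then have lim: "((\<lambda>L. cutoff L x) \<longlongrightarrow> soliton x) at_top" for x
    unfolding cutoff_def by (subst tendsto_cong[OF eventually_mono[OF ev[of x]]]) auto
  have lim': "((\<lambda>L. cutoff' L x) \<longlongrightarrow> soliton' x) at_top" for x
    unfolding cutoff'_def by (rule tendsto_eventually[OF eventually_mono[OF ev[of x]]]) auto
  have m: "soliton \<in> borel_measurable lborel" "soliton' \<in> borel_measurable lborel"
    using borel_measurable_continuous_onI[OF soliton_cont] borel_measurable_continuous_onI[OF soliton'_cont] by auto
  have D: "((\<lambda>L. LINT x|lborel. \<bar>cutoff L x\<bar>^p) \<longlongrightarrow> (LINT x|lborel. \<bar>soliton x\<bar>^p)) at_top"
    if "integrable lborel (\<lambda>x. soliton x ^ p)" for p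
  proof (rule integral_dominated_convergence_at_top[OF _ _ that])
    show "AE x in lborel. ((\<lambda>L. \<bar>cutoff L x\<bar>^p) \<longlongrightarrow> \<bar>soliton x\<bar>^p) at_top"
      by (intro AE_I2 tendsto_intros lim)
    show "\<forall>\<^sub>F L in at_top. AE x in lborel. norm (\<bar>cutoff L x\<bar>^p) \<le> soliton x ^ p"
      using cutoff_pow_le by (intro always_eventually allI AE_I2) simp
  qed (use m cutoff_measurable in measurable)
  have a: "\<bar>soliton x\<bar> = soliton x" for x using soliton_pos[of x] by simp
  show "((\<lambda>L. LINT x|lborel. \<bar>cutoff L x\<bar>^2) \<longlongrightarrow> mu_R) at_top"
    using D[OF soliton_mass(1)] unfolding a soliton_mass(2) .
  show "((\<lambda>L. LINT x|lborel. \<bar>cutoff L x\<bar>^6) \<longlongrightarrow> mu_R / 2) at_top"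
    using D[OF soliton_L6(1)] unfolding a soliton_L6(2) .
  have "((\<lambda>L. LINT x|lborel. \<bar>cutoff' L x\<bar>^2) \<longlongrightarrow> (LINT x|lborel. \<bar>soliton' x\<bar>^2)) at_top"
  proof (rule integral_dominated_convergence_at_top[OF _ _ soliton'_L2(1)])
    show "AE x in lborel. ((\<lambda>L. \<bar>cutoff' L x\<bar>^2) \<longlongrightarrow> \<bar>soliton' x\<bar>^2) at_top"
      by (intro AE_I2 tendsto_intros lim')
    show "\<forall>\<^sub>F L in at_top. AE x in lborel. norm (\<bar>cutoff' L x\<bar>^2) \<le> (soliton' x)\<^sup>2"
      using cutoff'_sq_le by (intro always_eventually allI AE_I2) simp
  qed (use m cutoff_measurable in measurable)
  then show "((\<lambda>L. LINT x|lborel. \<bar>cutoff' L x\<bar>^2) \<longlongrightarrow> mu_R / 6) at_top"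
    by (simp add: soliton'_L2(2))
qed

lemma shift_halfline_integral:
  fixes f :: "real \<Rightarrow> real"
  assumes "\<And>x. x < -L \<Longrightarrow> f x = 0"
  shows "(LINT x:{0..}|lborel. f (x - L)) = (LINT x|lborel. f x)"
    and "integrable lborel f \<Longrightarrow> set_integrable lborel {0..} (\<lambda>x. f (x - L))"
proof -
  have e: "indicat_real {0..} x *\<^sub>R f (x - L) = f (- L + 1 * x)" for x using assms[of "x - L"] by (auto split: split_indicator)
  show "(LINT x:{0..}|lborel. f (x - L)) = (LINT x|lborel. f x)"
    unfolding set_lebesgue_integral_def e by (subst (2) lborel_integral_real_affine[of 1 _ "-L"]) auto
  show "set_integrable lborel {0..} (\<lambda>x. f (x - L))" if "integrable lborel f"
    unfolding set_integrable_def e using lborel_integrable_real_affine[OF that, of 1 "-L"] by simp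
qed

lemma cutoff_H1_on:
  assumes L: "0 < L"
  shows "H1_on {0..} (\<lambda>x. cutoff L (x - L)) (\<lambda>x. cutoff' L (x - L))"
  unfolding H1_on_def
proof (intro conjI ballI)
  show "edge_interval {0..}" by (simp add: edge_interval_def)
  have "(\<lambda>x. cutoff' L (x - L)) \<in> borel_measurable lborel"
    using cutoff_measurable(2)[of L] by measurable
  then show "set_borel_measurable lborel {0..} (\<lambda>x. cutoff' L (x - L))"
    by (auto simp: set_borel_measurable_def)
  show "set_integrable lborel {0..} (\<lambda>x. (cutoff' L (x - L))\<^sup>2)" "set_integrable lborel {0..} (\<lambda>x. (cutoff L (x - L))\<^sup>2)"
    by (rule shift_halfline_integral(2)[of L "\<lambda>x. (cutoff' L x)\<^sup>2"] shift_halfline_integral(2)[of L "\<lambda>x. (cutoff L x)\<^sup>2"];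
        use cutoff_integrable[of L] in \<open>simp add: cutoff_def cutoff'_def\<close>)+
  fix x :: real assume "x \<in> {0..}"
  then have x: "0 \<le> x" by simp
  \<comment> \<open>The support of the shifted function ends at 2 L; beyond it both sides are
    constant.\<close>
  let ?b = "min x (2 * L)"
  have "(LINT y:{0..x}|lborel. cutoff' L (y - L)) = (LINT y:{0..?b}|lborel. soliton' (y - L))"
    unfolding set_lebesgue_integral_def by (intro Bochner_Integration.integral_cong) (auto simp: cutoff'_def split: split_indicator)
  also have "\<dots> = soliton (?b - L) - soliton (0 - L)"
  proof (rule set_integral_FTC)
    show "((\<lambda>y. soliton (y - L)) has_real_derivative soliton' (y - L)) (at y within {0..?b})" for y
      using DERIV_chain2[OF soliton_deriv[of "y - L" UNIV] DERIV_diff[OF DERIV_ident DERIV_const[of L]]] by simp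
    show "continuous_on {0..?b} (\<lambda>y. soliton' (y - L))"
      by (rule continuous_on_compose2[OF soliton'_cont[of UNIV]]) (auto intro!: continuous_intros)
  qed (use x L in simp)
  also have "soliton (0 - L) = soliton L" by (rule soliton_abs) simp
  finally have I: "(LINT y:{0..x}|lborel. cutoff' L (y - L)) = soliton (?b - L) - soliton L" .
  have "cutoff L (0 - L) = 0" using soliton_abs[of "- L" L] L by (simp add: cutoff_def)
  moreover have "cutoff L (x - L) = soliton (?b - L) - soliton L" using x L
    by (cases "x \<le> 2 * L") (auto simp: cutoff_def min_def)
  ultimately show "cutoff L (x - L) = cutoff L (0 - L) + (LINT y:{0..x}|lborel. cutoff' L (y - L))"
    unfolding I by simp
qed

lemma test_functions:
  fixes G :: "('a, 'b) mgraph"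
  assumes G: "wf_mgraph G" "noncompact G"
  obtains U W :: "real \<Rightarrow> 'b \<Rightarrow> real \<Rightarrow> real" where "\<And>L. 0 < L \<Longrightarrow> H1pair G (U L) (W L)"
    "\<And>L. 0 < L \<Longrightarrow> \<exists>e\<in>edges G. \<exists>x\<in>edom G e. U L e x \<noteq> 0"
    "((\<lambda>L. Lnorm_pow G 2 (U L)) \<longlongrightarrow> mu_R) at_top"
    "((\<lambda>L. Lnorm_pow G 6 (U L)) \<longlongrightarrow> mu_R / 2) at_top"
    "((\<lambda>L. Lnorm_pow G 2 (W L)) \<longlongrightarrow> mu_R / 6) at_top"
proof -
  obtain h where h: "h \<in> halflines G" using G by (auto simp: noncompact_def)
  define U where "U L e = (if e = h then (\<lambda>x. cutoff L (x - L)) else (\<lambda>_. 0))" for L e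
  define W where "W L e = (if e = h then (\<lambda>x. cutoff' L (x - L)) else (\<lambda>_. 0))" for L e
  have 0: "cutoff L (0 - L) = 0" if "0 < L" for L using soliton_abs[of "- L" L] that by (simp add: cutoff_def)
  have 1: "H1pair G (U L) (W L)" if "0 < L" for L
    unfolding U_def[abs_def] W_def[abs_def] by (rule H1pair_on_halfline(1)[OF G(1) h cutoff_H1_on[OF that] 0[OF that]])
  have 2: "\<exists>e\<in>edges G. \<exists>x\<in>edom G e. U L e x \<noteq> 0" if "0 < L" for L
  proof (intro bexI)
    show "U L h L \<noteq> 0" using soliton_less[OF that] that by (simp add: U_def cutoff_def)
    show "L \<in> edom G h" using h that by (simp add: edom_def)
    show "h \<in> edges G" using h G by (auto simp: wf_mgraph_def)
  qed
  have N: "Lnorm_pow G p (\<lambda>e. if e = h then (\<lambda>x. f (x - L)) else (\<lambda>_. 0)) = (LINT x|lborel. \<bar>f x\<bar> ^ p)"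
    if "0 < L" "0 < p" "\<And>x. x < -L \<Longrightarrow> f x = 0" for f :: "real \<Rightarrow> real" and L p
  proof -
    have "(LINT x:{0..}|lborel. \<bar>f (x - L)\<bar> ^ p) = (LINT x|lborel. \<bar>f x\<bar> ^ p)"
      by (rule shift_halfline_integral(1)[of L "\<lambda>x. \<bar>f x\<bar> ^ p"]) (use that in auto)
    then show ?thesis
      unfolding H1pair_on_halfline(2)[OF G(1) h cutoff_H1_on[OF that(1)] 0[OF that(1)] that(2)] .
  qed
  have ev: "\<forall>\<^sub>F L in at_top. (0::real) < L" by (rule eventually_gt_at_top)
  have l1: "((\<lambda>L. Lnorm_pow G 2 (U L)) \<longlongrightarrow> mu_R) at_top"
    by (rule tendsto_cong[THEN iffD1, OF _ cutoff_limits(1)], rule eventually_mono[OF ev])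
       (subst U_def[abs_def], subst N, auto simp: cutoff_def)
  have l2: "((\<lambda>L. Lnorm_pow G 6 (U L)) \<longlongrightarrow> mu_R / 2) at_top"
    by (rule tendsto_cong[THEN iffD1, OF _ cutoff_limits(2)], rule eventually_mono[OF ev])
       (subst U_def[abs_def], subst N, auto simp: cutoff_def)
  have l3: "((\<lambda>L. Lnorm_pow G 2 (W L)) \<longlongrightarrow> mu_R / 6) at_top"
    by (rule tendsto_cong[THEN iffD1, OF _ cutoff_limits(3)], rule eventually_mono[OF ev])
       (subst W_def[abs_def], subst N, auto simp: cutoff'_def)
  show ?thesis by (rule that[OF 1 2 l1 l2 l3])
qed

section \<open>The values of the sharp constant, the critical mass and the ground state
  level\<close>

lemma K_const_eq:
  fixes G :: "('a, 'b) mgraph"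
  assumes G: "wf_mgraph G" "noncompact G" "assumption_H G"
  shows "K_const G = ereal (3 / mu_R\<^sup>2)"
proof (rule antisym)
  show "K_const G \<le> ereal (3 / mu_R\<^sup>2)"
    unfolding K_const_def by (rule SUP_least) (auto dest!: gagliardo_nirenberg[OF G])
  obtain U W :: "real \<Rightarrow> 'b \<Rightarrow> real \<Rightarrow> real" where UW: "\<And>L. 0 < L \<Longrightarrow> H1pair G (U L) (W L)"
    "\<And>L. 0 < L \<Longrightarrow> \<exists>e\<in>edges G. \<exists>x\<in>edom G e. U L e x \<noteq> 0"
    "((\<lambda>L. Lnorm_pow G 2 (U L)) \<longlongrightarrow> mu_R) at_top"
    "((\<lambda>L. Lnorm_pow G 6 (U L)) \<longlongrightarrow> mu_R / 2) at_top"
    "((\<lambda>L. Lnorm_pow G 2 (W L)) \<longlongrightarrow> mu_R / 6) at_top" using test_functions[OF G(1,2)] by blast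
  let ?R = "\<lambda>L. Lnorm_pow G 6 (U L) / ((Lnorm_pow G 2 (U L))\<^sup>2 * Lnorm_pow G 2 (W L))"
  have "(?R \<longlongrightarrow> (mu_R / 2) / (mu_R\<^sup>2 * (mu_R / 6))) at_top"
    using mu_R_pos by (intro tendsto_intros UW) auto
  then have "((\<lambda>L. ereal (?R L)) \<longlongrightarrow> ereal (3 / mu_R\<^sup>2)) at_top"
    using mu_R_pos by (simp add: field_simps)
  moreover have "\<forall>\<^sub>F L in at_top. ereal (?R L) \<le> K_const G"
    using eventually_gt_at_top[of 0]
  proof eventually_elim
    case (elim L)
    show ?case unfolding K_const_def
      by (rule SUP_upper2[of "(U L, W L)"]) (use UW(1,2)[OF elim] in auto)
  qed
  ultimately show "ereal (3 / mu_R\<^sup>2) \<le> K_const G" by (rule tendsto_upperbound) simp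
qed

lemma mu_const_eq:
  assumes G: "wf_mgraph G" "noncompact G" "assumption_H G"
  shows "mu_const G = mu_R"
  unfolding mu_const_def K_const_eq[OF G] using mu_R_pos by simp

lemma energy_level_eq:
  fixes G :: "('a, 'b) mgraph"
  assumes G: "wf_mgraph G" "noncompact G" "assumption_H G"
  shows "energy_level G mu_R = 0"
proof (rule antisym)
  show "0 \<le> energy_level G mu_R"
    unfolding energy_level_def by (rule INF_greatest) (auto simp: H1_mass_def intro: energy_nonneg[OF G])
  obtain U W :: "real \<Rightarrow> 'b \<Rightarrow> real \<Rightarrow> real" where UW: "\<And>L. 0 < L \<Longrightarrow> H1pair G (U L) (W L)"
    "\<And>L. 0 < L \<Longrightarrow> \<exists>e\<in>edges G. \<exists>x\<in>edom G e. U L e x \<noteq> 0"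
    "((\<lambda>L. Lnorm_pow G 2 (U L)) \<longlongrightarrow> mu_R) at_top"
    "((\<lambda>L. Lnorm_pow G 6 (U L)) \<longlongrightarrow> mu_R / 2) at_top"
    "((\<lambda>L. Lnorm_pow G 2 (W L)) \<longlongrightarrow> mu_R / 6) at_top" using test_functions[OF G(1,2)] by blast
  \<comment> \<open>The cut off solitons miss the mass \<open>mu_R\<close> slightly; the factor c
    corrects this and tends to 1, so the energies tend to that of the soliton, which is 0.\<close>
  define c where "c L = sqrt (mu_R / Lnorm_pow G 2 (U L))" for L
  define E where "E L = \<bar>c L\<bar>^2 * Lnorm_pow G 2 (W L) / 2 - \<bar>c L\<bar>^6 * Lnorm_pow G 6 (U L) / 6" for L
  have "(c \<longlongrightarrow> sqrt (mu_R / mu_R)) at_top"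
    unfolding c_def using mu_R_pos by (intro tendsto_intros UW) auto
  then have "(E \<longlongrightarrow> \<bar>sqrt (mu_R / mu_R)\<bar>^2 * (mu_R / 6) / 2 - \<bar>sqrt (mu_R / mu_R)\<bar>^6 * (mu_R / 2) / 6) at_top"
    unfolding E_def by (intro tendsto_intros UW) auto
  then have "((\<lambda>L. ereal (E L)) \<longlongrightarrow> 0) at_top" using mu_R_pos by (simp add: zero_ereal_def)
  moreover have "\<forall>\<^sub>F L in at_top. energy_level G mu_R \<le> ereal (E L)"
    using eventually_gt_at_top[of 0]
  proof eventually_elim
    case (elim L)
    obtain e x where ex: "e \<in> edges G" "x \<in> edom G e" "U L e x \<noteq> 0" using UW(2)[OF elim] by blast
    have m: "0 < Lnorm_pow G 2 (U L)" by (rule Lnorm_pow_pos[OF G(1) UW(1)[OF elim] ex])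
    then have "\<bar>c L\<bar>^2 * Lnorm_pow G 2 (U L) = mu_R" using mu_R_pos by (simp add: c_def)
    then have "((\<lambda>e x. c L * U L e x), (\<lambda>e x. c L * W L e x)) \<in> H1_mass G mu_R"
      using H1pair_scale[OF UW(1)[OF elim]] by (simp add: H1_mass_def Lnorm_pow_scale)
    then show ?case unfolding energy_level_def
      by (rule INF_lower2) (simp add: energy_def E_def Lnorm_pow_scale)
  qed
  ultimately show "energy_level G mu_R \<le> 0" by (rule tendsto_lowerbound) simp
qed

section \<open>Quotients of the line\<close>

text \<open>\<open>from_line\<close> unpacked. It describes positions only locally and up to
  \<open>same_point\<close>, so each edge must be recovered as an affine piece of the line before a
  soliton can be pulled back to it.\<close>

locale line_quotient =
  fixes G :: "('v, 'e) mgraph" and X :: "real set" and \<phi> :: "real \<Rightarrow> 'e \<times> real"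
  assumes wf: "wf_mgraph G" and X: "finite X"
    and pos_all: "\<forall>t. \<phi> t \<in> positions G"
    and onto_all: "\<forall>p\<in>positions G. \<exists>t. same_point G (\<phi> t) p"
    and ident_all: "\<forall>s t. same_point G (\<phi> s) (\<phi> t) \<longleftrightarrow>
              s = t \<or> (\<exists>x\<in>X. (s = x \<and> t = - x) \<or> (s = - x \<and> t = x))"
    and locally_all: "\<forall>t. \<exists>\<epsilon>>0. \<exists>e1 a1 \<sigma>1 e2 a2 \<sigma>2. \<sigma>1 \<in> {-1, 1} \<and> \<sigma>2 \<in> {-1, 1 :: real} \<and>
        (\<forall>s\<in>{t - \<epsilon>..t}. (e1, a1 + \<sigma>1 * (s - t)) \<in> positions G \<and>
                          same_point G (\<phi> s) (e1, a1 + \<sigma>1 * (s - t))) \<and>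
        (\<forall>s\<in>{t..t + \<epsilon>}. (e2, a2 + \<sigma>2 * (s - t)) \<in> positions G \<and>
                          same_point G (\<phi> s) (e2, a2 + \<sigma>2 * (s - t)))"
begin

lemmas pos = pos_all[rule_format]
lemmas onto = onto_all[rule_format]
lemmas ident = ident_all[rule_format]
lemmas locally = locally_all[THEN spec]

text \<open>On the open edge \<open>same_point\<close> is equality, so statements about \<phi> up to
  identification become equations.\<close>

definition inner :: "'e \<Rightarrow> real set" where
  "inner e = (if e \<in> halflines G then {0<..} else {0<..<len G e})"

lemma inner_edom: "x \<in> inner e \<Longrightarrow> x \<in> edom G e"
  by (auto simp: inner_def edom_def split: if_splits)

lemma vertex_at_inner: "x \<in> edom G e \<Longrightarrow> vertex_at G (e, x) = None \<longleftrightarrow> x \<in> inner e"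
  by (auto simp: inner_def edom_def vertex_at_def split: if_splits)

lemma inner_open: "open (inner e)" and inner_convex: "convex (inner e)"
  by (auto simp: inner_def)

lemma same_point_inner: "x \<in> inner e \<Longrightarrow> same_point G p (e, x) \<Longrightarrow> p = (e, x)"
  using vertex_at_inner[OF inner_edom, of x e] by (auto simp: same_point_def)

lemma ident_abs: "same_point G (\<phi> s) (\<phi> t) \<Longrightarrow> \<bar>s\<bar> = \<bar>t\<bar>"
  unfolding ident by auto

lemma same_imp_X: "same_point G (\<phi> s) (\<phi> t) \<Longrightarrow> s \<noteq> t \<Longrightarrow> s \<in> X \<union> uminus ` X"
  unfolding ident by auto

text \<open>The source of the two contradictions below: if \<phi> met earlier or later points
  throughout an interval of times, that interval would lie in a finite set.\<close>

lemma no_interval: "a < b \<Longrightarrow> \<not> {a<..<b} \<subseteq> X \<union> uminus ` X"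
  using X finite_subset[of "{a<..<b}" "X \<union> uminus ` X"] infinite_Ioo[of a b] by auto

text \<open>The arcs on the two sides of t both lie on e and meet at x. If their slopes differed,
  \<phi> would turn back at t and retrace an interval.\<close>

lemma passes_through:
  assumes t: "\<phi> t = (e, x)" and x: "x \<in> inner e"
  shows "\<exists>\<sigma> \<epsilon>. (\<sigma> = 1 \<or> \<sigma> = (-1::real)) \<and> 0 < \<epsilon> \<and> (\<forall>h. \<bar>h\<bar> < \<epsilon> \<longrightarrow> x + h \<in> inner e \<and> \<phi> (t + \<sigma> * h) = (e, x + h))"
proof -
  obtain \<epsilon> e1 a1 \<sigma>1 e2 a2 \<sigma>2 where loc: "\<epsilon> > 0" "\<sigma>1 \<in> {-1, 1}" "\<sigma>2 \<in> {-1, 1 :: real}"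
    "\<And>s. s \<in> {t - \<epsilon>..t} \<Longrightarrow> same_point G (\<phi> s) (e1, a1 + \<sigma>1 * (s - t))"
    "\<And>s. s \<in> {t..t + \<epsilon>} \<Longrightarrow> same_point G (\<phi> s) (e2, a2 + \<sigma>2 * (s - t))"
    using locally[of t] by blast
  have "same_point G (e1, a1) (e, x)" "same_point G (e2, a2) (e, x)"
    using loc(4)[of t] loc(5)[of t] loc(1) same_point_sym unfolding t by auto
  then have e12: "e1 = e" "a1 = x" "e2 = e" "a2 = x" using same_point_inner[OF x] by blast+
  obtain d where d: "d > 0" "\<And>y. \<bar>y - x\<bar> < d \<Longrightarrow> y \<in> inner e"
    using inner_open[of e] x unfolding open_dist dist_real_def by blast
  define r where "r = min \<epsilon> d"
  have r: "r > 0" using loc(1) d(1) by (simp add: r_def)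
  have L: "\<phi> (t + k) = (e, x + \<sigma>1 * k)" if "-r < k" "k \<le> 0" for k
  proof -
    have "x + \<sigma>1 * k \<in> inner e" using that loc(2) by (intro d(2)) (auto simp: r_def)
    then show ?thesis using same_point_inner loc(4)[of "t + k"] that e12 by (auto simp: r_def)
  qed
  have R: "\<phi> (t + k) = (e, x + \<sigma>2 * k)" if "0 \<le> k" "k < r" for k
  proof -
    have "x + \<sigma>2 * k \<in> inner e" using that loc(3) by (intro d(2)) (auto simp: r_def)
    then show ?thesis using same_point_inner loc(5)[of "t + k"] that e12 by (auto simp: r_def)
  qed
  have eq: "\<sigma>1 = \<sigma>2"
  proof (rule ccontr)
    assume "\<sigma>1 \<noteq> \<sigma>2"
    then have op: "\<sigma>1 = - \<sigma>2" using loc(2,3) by auto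
    have "{t<..<t + r} \<subseteq> X \<union> uminus ` X"
    proof
      fix y assume y: "y \<in> {t<..<t + r}"
      have "\<phi> y = (e, x + \<sigma>2 * (y - t))" using R[of "y - t"] y by auto
      moreover have "\<phi> (2 * t - y) = (e, x + \<sigma>2 * (y - t))" using L[of "t - y"] y op by (auto simp: algebra_simps)
      ultimately have "same_point G (\<phi> y) (\<phi> (2 * t - y))" by simp
      then show "y \<in> X \<union> uminus ` X" by (rule same_imp_X) (use y in auto)
    qed
    then show False using no_interval[of t "t + r"] r by simp
  qed
  have \<sigma>: "\<sigma>2 = 1 \<or> \<sigma>2 = -1" using loc(3) by auto
  have "x + h \<in> inner e \<and> \<phi> (t + \<sigma>2 * h) = (e, x + h)" if h: "\<bar>h\<bar> < r" for h
  proof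
    show "x + h \<in> inner e" using h by (intro d(2)) (auto simp: r_def)
    have ss: "\<sigma>2 * (\<sigma>2 * h) = h" using \<sigma> by auto
    show "\<phi> (t + \<sigma>2 * h) = (e, x + h)"
    proof (cases "0 \<le> \<sigma>2 * h")
      case True then show ?thesis using R[of "\<sigma>2 * h"] h \<sigma> ss by auto
    next
      case False then show ?thesis using L[of "\<sigma>2 * h"] h \<sigma> ss eq by auto
    qed
  qed
  then show ?thesis using \<sigma> r by blast
qed

text \<open>Near each of the two times \<phi> covers a neighbourhood of x, so a whole interval of
  points would be visited twice.\<close>

lemma inner_unique:
  assumes t: "\<phi> t = (e, x)" "\<phi> t' = (e, x)" and x: "x \<in> inner e"
  shows "t = t'"
proof (rule ccontr)
  assume ne: "t \<noteq> t'"
  obtain \<sigma> d where s: "\<sigma> = 1 \<or> \<sigma> = (-1::real)" "0 < d" "\<And>h. \<bar>h\<bar> < d \<Longrightarrow> \<phi> (t + \<sigma> * h) = (e, x + h)"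
    using passes_through[OF t(1) x] by blast
  obtain \<sigma>' d' where s': "\<sigma>' = 1 \<or> \<sigma>' = (-1::real)" "0 < d'" "\<And>h. \<bar>h\<bar> < d' \<Longrightarrow> \<phi> (t' + \<sigma>' * h) = (e, x + h)"
    using passes_through[OF t(2) x] by blast
  define r where "r = min (min d d') (\<bar>t - t'\<bar> / 2)"
  have r: "r > 0" using s s' ne by (simp add: r_def)
  have "{t<..<t + r} \<subseteq> X \<union> uminus ` X"
  proof
    fix y assume y: "y \<in> {t<..<t + r}"
    define h where "h = \<sigma> * (y - t)"
    have h: "\<bar>h\<bar> < r" "t + \<sigma> * h = y" using y s(1) by (auto simp: h_def)
    have "\<phi> y = \<phi> (t' + \<sigma>' * h)" using s(3)[of h] s'(3)[of h] h by (simp add: r_def)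
    moreover have "y \<noteq> t' + \<sigma>' * h"
    proof
      assume "y = t' + \<sigma>' * h"
      then have "t - t' = \<sigma>' * h - \<sigma> * h" using h(2) by simp
      moreover have "\<bar>\<sigma>' * h\<bar> = \<bar>h\<bar>" "\<bar>\<sigma> * h\<bar> = \<bar>h\<bar>" using s(1) s'(1) by auto
      ultimately have "\<bar>t - t'\<bar> \<le> 2 * \<bar>h\<bar>" by linarith
      then show False using h(1) by (simp add: r_def)
    qed
    ultimately show "y \<in> X \<union> uminus ` X" using same_imp_X[of y "t' + \<sigma>' * h"] by simp
  qed
  then show False using no_interval[of t "t + r"] r by simp
qed

text \<open>The inverse \<tau> of \<phi> on the open edge is locally affine with slope 1 or -1; its
  slope is continuous with finitely many values on a connected set, hence constant.\<close>

lemma affine_on_edge: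
  assumes e: "e \<in> edges G"
  shows "\<exists>a \<sigma>. (\<sigma> = 1 \<or> \<sigma> = (-1::real)) \<and> (\<forall>x\<in>inner e. \<phi> (a + \<sigma> * x) = (e, x))"
proof -
  define \<tau> where "\<tau> x = (SOME t. \<phi> t = (e, x))" for x
  have \<tau>: "\<phi> (\<tau> x) = (e, x)" if "x \<in> inner e" for x
  proof -
    have "(e, x) \<in> positions G" using e inner_edom[OF that] by (simp add: positions_def)
    then obtain t where "same_point G (\<phi> t) (e, x)" using onto by blast
    then have "\<phi> t = (e, x)" by (rule same_point_inner[OF that])
    then show ?thesis unfolding \<tau>_def by (rule someI)
  qed
  have loc: "\<exists>\<sigma> \<epsilon>. (\<sigma> = 1 \<or> \<sigma> = (-1::real)) \<and> 0 < \<epsilon> \<and> (\<forall>h. \<bar>h\<bar> < \<epsilon> \<longrightarrow> x + h \<in> inner e \<and> \<tau> (x + h) = \<tau> x + \<sigma> * h)"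
    if x: "x \<in> inner e" for x
  proof -
    obtain \<sigma> \<epsilon> where s: "\<sigma> = 1 \<or> \<sigma> = (-1::real)" "0 < \<epsilon>" "\<And>h. \<bar>h\<bar> < \<epsilon> \<Longrightarrow> x + h \<in> inner e \<and> \<phi> (\<tau> x + \<sigma> * h) = (e, x + h)"
      using passes_through[OF \<tau>[OF x] x] by blast
    have "\<tau> (x + h) = \<tau> x + \<sigma> * h" if "\<bar>h\<bar> < \<epsilon>" for h
      using inner_unique[of "\<tau> (x + h)" e "x + h" "\<tau> x + \<sigma> * h"] s(3)[OF that] \<tau> by blast
    then show ?thesis using s by blast
  qed
  have D: "\<exists>\<sigma> \<epsilon>. (\<sigma> = 1 \<or> \<sigma> = (-1::real)) \<and> 0 < \<epsilon> \<and> (\<forall>y. \<bar>y - x\<bar> < \<epsilon> \<longrightarrow> (\<tau> has_real_derivative \<sigma>) (at y))"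
    if x: "x \<in> inner e" for x
  proof -
    obtain \<sigma> \<epsilon> where s: "\<sigma> = 1 \<or> \<sigma> = (-1::real)" "0 < \<epsilon>" "\<And>h. \<bar>h\<bar> < \<epsilon> \<Longrightarrow> \<tau> (x + h) = \<tau> x + \<sigma> * h"
      using loc[OF x] by blast
    have "(\<tau> has_real_derivative \<sigma>) (at y)" if y: "\<bar>y - x\<bar> < \<epsilon>" for y
    proof (rule has_field_derivative_transform_within_open[of "\<lambda>y. \<tau> x + \<sigma> * (y - x)" _ _ "ball x \<epsilon>"])
      show "((\<lambda>y. \<tau> x + \<sigma> * (y - x)) has_real_derivative \<sigma>) (at y)" by (auto intro!: derivative_eq_intros)
      show "y \<in> ball x \<epsilon>" using y by (simp add: dist_real_def abs_minus_commute)
      show "\<tau> x + \<sigma> * (z - x) = \<tau> z" if "z \<in> ball x \<epsilon>" for z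
        using s(3)[of "z - x"] that by (simp add: dist_real_def abs_minus_commute)
    qed simp
    then show ?thesis using s by blast
  qed
  have dv: "deriv \<tau> x \<in> {1, -1}" "(\<tau> has_real_derivative deriv \<tau> x) (at x)" if x: "x \<in> inner e" for x
  proof -
    obtain \<sigma> where \<sigma>: "\<sigma> = 1 \<or> \<sigma> = (-1::real)" "(\<tau> has_real_derivative \<sigma>) (at x)"
      using D[OF x] by (metis diff_self abs_zero)
    then have "deriv \<tau> x = \<sigma>" by (intro DERIV_imp_deriv)
    then show "deriv \<tau> x \<in> {1, -1}" "(\<tau> has_real_derivative deriv \<tau> x) (at x)" using \<sigma> by auto
  qed
  have "continuous_on (inner e) (deriv \<tau>)"
  proof (intro continuous_at_imp_continuous_on ballI)
    fix x assume x: "x \<in> inner e"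
    obtain \<sigma> \<epsilon> where s: "0 < \<epsilon>" "\<And>y. \<bar>y - x\<bar> < \<epsilon> \<Longrightarrow> (\<tau> has_real_derivative \<sigma>) (at y)" using D[OF x] by blast
    have "deriv \<tau> y = \<sigma>" if "\<bar>y - x\<bar> < \<epsilon>" for y using s(2)[OF that] by (rule DERIV_imp_deriv)
    then have "\<forall>\<^sub>F y in at x. deriv \<tau> y = deriv \<tau> x"
      unfolding eventually_at using s(1) by (intro exI[of _ \<epsilon>]) (auto simp: dist_real_def)
    then show "isCont (deriv \<tau>) x" unfolding isCont_def by (rule tendsto_eventually)
  qed
  then have "deriv \<tau> constant_on inner e"
    by (rule continuous_finite_range_constant[OF convex_connected[OF inner_convex]])
       (use dv(1) in \<open>auto intro: finite_subset[of _ "{1, -1}"]\<close>)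
  then obtain \<sigma> where \<sigma>: "\<And>x. x \<in> inner e \<Longrightarrow> deriv \<tau> x = \<sigma>" by (auto simp: constant_on_def)
  have "\<exists>c. \<forall>x\<in>inner e. \<tau> x - \<sigma> * x = c"
  proof (rule has_field_derivative_zero_constant[OF inner_convex])
    fix x assume x: "x \<in> inner e"
    have "(\<tau> has_real_derivative \<sigma>) (at x within inner e)" using dv(2)[OF x] \<sigma>[OF x] by (simp add: has_field_derivative_at_within)
    then show "((\<lambda>x. \<tau> x - \<sigma> * x) has_real_derivative 0) (at x within inner e)" by (auto intro!: derivative_eq_intros)
  qed
  then obtain a where a: "\<And>x. x \<in> inner e \<Longrightarrow> \<tau> x - \<sigma> * x = a" by blast
  have "\<exists>x. x \<in> inner e"
  proof (cases "e \<in> halflines G")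
    case True then show ?thesis by (intro exI[of _ 1]) (simp add: inner_def)
  next
    case False
    then have "0 < len G e" using wf e by (simp add: wf_mgraph_def)
    then show ?thesis using False by (intro exI[of _ "len G e / 2"]) (simp add: inner_def)
  qed
  then have "\<sigma> = 1 \<or> \<sigma> = -1" using dv(1) \<sigma> by force
  moreover have "\<phi> (a + \<sigma> * x) = (e, x)" if "x \<in> inner e" for x using \<tau>[OF that] a[OF that] by (simp add: algebra_simps)
  ultimately show ?thesis by blast
qed

text \<open>At the end of an edge \<phi> may pick a representative on another edge, so its value
  there is reached through the local arc at t, which agrees with edge e for small y > 0.\<close>

lemma limit_point:
  assumes d: "0 < d" and \<eta>: "\<eta> = 1 \<or> \<eta> = (-1::real)"
    and h: "\<And>y. 0 < y \<Longrightarrow> y < d \<Longrightarrow> \<phi> (t + \<eta> * y) = (e, c + \<kappa> * y) \<and> c + \<kappa> * y \<in> inner e"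
  shows "same_point G (\<phi> t) (e, c)"
proof -
  obtain \<epsilon> e1 a1 \<sigma>1 e2 a2 \<sigma>2 where loc: "\<epsilon> > 0"
    "\<And>s. s \<in> {t - \<epsilon>..t} \<Longrightarrow> same_point G (\<phi> s) (e1, a1 + \<sigma>1 * (s - t))"
    "\<And>s. s \<in> {t..t + \<epsilon>} \<Longrightarrow> same_point G (\<phi> s) (e2, a2 + \<sigma>2 * (s - t))"
    using locally[of t] by blast
  obtain e' a' \<sigma>' where l: "\<And>y. 0 \<le> y \<Longrightarrow> y \<le> \<epsilon> \<Longrightarrow> same_point G (\<phi> (t + \<eta> * y)) (e', a' + \<sigma>' * y)"
  proof (cases "\<eta> = 1")
    case True
    show ?thesis
    proof (rule that[of e2 a2 \<sigma>2])
      fix y assume "0 \<le> y" "y \<le> \<epsilon>"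
      then show "same_point G (\<phi> (t + \<eta> * y)) (e2, a2 + \<sigma>2 * y)" using loc(3)[of "t + y"] True by auto
    qed
  next
    case False
    show ?thesis
    proof (rule that[of e1 a1 "- \<sigma>1"])
      fix y assume "0 \<le> y" "y \<le> \<epsilon>"
      then show "same_point G (\<phi> (t + \<eta> * y)) (e1, a1 + - \<sigma>1 * y)" using loc(2)[of "t - y"] False \<eta> by auto
    qed
  qed
  define r where "r = min d \<epsilon> / 2"
  have r: "0 < r" "r < d" "r \<le> \<epsilon>" using d loc(1) by (auto simp: r_def)
  have "e' = e \<and> a' + \<sigma>' * y = c + \<kappa> * y" if "0 < y" "y \<le> r" for y
    using same_point_inner[of "c + \<kappa> * y" e "(e', a' + \<sigma>' * y)"] h[of y] l[of y] same_point_sym that r by force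
  \<comment> \<open>Two values determine an affine function: agreement at r and r / 2 gives a' =
    c.\<close>
  from this[of r] this[of "r / 2"] r
  have q: "e' = e" "a' + \<sigma>' * r = c + \<kappa> * r" "a' + \<sigma>' * (r / 2) = c + \<kappa> * (r / 2)" by auto
  then have "a' = c" by (simp add: field_simps)
  then show ?thesis using l[of 0] q(1) loc(1) by simp
qed

lemma edge_param:
  assumes e: "e \<in> edges G"
  shows "\<exists>a \<sigma>. (\<sigma> = 1 \<or> \<sigma> = (-1::real)) \<and> (\<forall>x\<in>edom G e. same_point G (\<phi> (a + \<sigma> * x)) (e, x))"
proof -
  obtain a \<sigma> where s: "\<sigma> = 1 \<or> \<sigma> = (-1::real)" "\<And>x. x \<in> inner e \<Longrightarrow> \<phi> (a + \<sigma> * x) = (e, x)"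
    using affine_on_edge[OF e] by blast
  define d where "d = (if e \<in> halflines G then 1 else len G e)"
  have d: "0 < d" using wf e by (auto simp: d_def wf_mgraph_def)
  have "same_point G (\<phi> (a + \<sigma> * x)) (e, x)" if x: "x \<in> edom G e" for x
  proof (cases "x \<in> inner e")
    case True then show ?thesis using s(2) by simp
  next
    case False
    then consider "x = 0" | "e \<notin> halflines G" "x = len G e"
      using x by (auto simp: inner_def edom_def split: if_splits)
    then show ?thesis
    proof cases
      case 1
      have "same_point G (\<phi> a) (e, 0)"
      proof (rule limit_point[OF d s(1), where \<kappa>=1])
        fix y assume "0 < y" "y < d"
        then have "y \<in> inner e" by (auto simp: inner_def d_def split: if_splits)
        then show "\<phi> (a + \<sigma> * y) = (e, 0 + 1 * y) \<and> 0 + 1 * y \<in> inner e" using s(2) by simp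
      qed
      then show ?thesis using 1 by simp
    next
      case 2
      have "- \<sigma> = 1 \<or> - \<sigma> = -1" using s(1) by auto
      then have "same_point G (\<phi> (a + \<sigma> * len G e)) (e, len G e)"
      proof (rule limit_point[OF d, where \<kappa>="-1"])
        fix y assume "0 < y" "y < d"
        then have "len G e - y \<in> inner e" using 2 by (auto simp: inner_def d_def)
        then show "\<phi> (a + \<sigma> * len G e + - \<sigma> * y) = (e, len G e + -1 * y) \<and> len G e + -1 * y \<in> inner e"
          using s(2)[of "len G e - y"] by (simp add: algebra_simps)
      qed
      then show ?thesis using 2 by simp
    qed
  qed
  then show ?thesis using s(1) by blast
qed

text \<open>Two visits to one vertex are at equal or opposite times, so each of the finitely many
  vertices accounts for at most two times.\<close>

lemma finite_vertex_times: "finite {t. vertex_at G (\<phi> t) \<noteq> None}"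
proof -
  have v: "w \<in> verts G" if "vertex_at G (\<phi> t) = Some w" for t w
    using that pos[of t] wf by (auto simp: vertex_at_def positions_def wf_mgraph_def split: if_splits)
  have "finite {t. vertex_at G (\<phi> t) = Some w}" for w
  proof (cases "\<exists>t. vertex_at G (\<phi> t) = Some w")
    case True
    then obtain t0 where t0: "vertex_at G (\<phi> t0) = Some w" by blast
    have "t \<in> {t0, - t0}" if "vertex_at G (\<phi> t) = Some w" for t
      using ident_abs[of t t0] t0 that by (auto simp: same_point_def abs_eq_iff)
    then have "{t. vertex_at G (\<phi> t) = Some w} \<subseteq> {t0, - t0}" by blast
    then show ?thesis by (rule finite_subset) simp
  qed simp
  moreover have "{t. vertex_at G (\<phi> t) \<noteq> None} \<subseteq> (\<Union>w\<in>verts G. {t. vertex_at G (\<phi> t) = Some w})"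
    using v by auto
  ultimately show ?thesis using wf by (meson finite_UN_I finite_subset wf_mgraph_def)
qed

text \<open>The pulled back soliton is well defined at identified points because it is even, and the
  edges tile the line up to finitely many vertex times, so all three norms are those on the
  line.\<close>

lemma minimizer_exists: "\<exists>u g. (u, g) \<in> H1_mass G mu_R \<and> energy G u g = 0"
proof -
  obtain a \<sigma> where s: "\<And>e. e \<in> edges G \<Longrightarrow> \<sigma> e = 1 \<or> \<sigma> e = (-1::real)"
    "\<And>e x. e \<in> edges G \<Longrightarrow> x \<in> edom G e \<Longrightarrow> same_point G (\<phi> (a e + \<sigma> e * x)) (e, x)"
    using edge_param by metis
  define u where "u e x = soliton (a e + \<sigma> e * x)" for e x
  define g where "g e x = \<sigma> e * soliton' (a e + \<sigma> e * x)" for e x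
  \<comment> \<open>Any visiting time gives the same value, since all of them have the same
    modulus.\<close>
  define \<psi> where "\<psi> v = soliton (SOME t. vertex_at G (\<phi> t) = Some v)" for v
  have \<psi>: "u e x = \<psi> v" if e: "e \<in> edges G" "x \<in> edom G e" "vertex_at G (e, x) = Some v" for e x v
  proof -
    have 1: "vertex_at G (\<phi> (a e + \<sigma> e * x)) = Some v" using s(2)[OF e(1,2)] e(3) by (auto simp: same_point_def)
    then have "vertex_at G (\<phi> (SOME t. vertex_at G (\<phi> t) = Some v)) = Some v" by (rule someI)
    with 1 have "same_point G (\<phi> (a e + \<sigma> e * x)) (\<phi> (SOME t. vertex_at G (\<phi> t) = Some v))" by (simp add: same_point_def)
    from soliton_abs[OF ident_abs[OF this]] show ?thesis unfolding u_def \<psi>_def .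
  qed
  have integral: "(\<Sum>e\<in>edges G. LINT x:edom G e|lborel. h (a e + \<sigma> e * x)) = (LINT t|lborel. h t)"
    and integrable: "e \<in> edges G \<Longrightarrow> set_integrable lborel (edom G e) (\<lambda>x. h (a e + \<sigma> e * x))"
    if h: "integrable lborel h" for h :: "real \<Rightarrow> real" and e
  proof -
    \<comment> \<open>The times spent on edge e; away from the vertex times exactly one of these
      sets contains t.\<close>
    define I where "I e = {t. \<sigma> e * (t - a e) \<in> edom G e}" for e
    have I: "indicat_real (edom G e) x *\<^sub>R h (a e + \<sigma> e * x) = indicat_real (I e) (a e + \<sigma> e * x) *\<^sub>R h (a e + \<sigma> e * x)"
      if "e \<in> edges G" for e x
    proof -
      have "a e + \<sigma> e * x \<in> I e \<longleftrightarrow> x \<in> edom G e" using s(1)[OF that] by (auto simp: I_def)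
      then show ?thesis by (simp add: indicator_def)
    qed
    have Im: "I e \<in> sets borel" if "e \<in> edges G" for e
    proof -
      have "(\<lambda>t. \<sigma> e * (t - a e)) \<in> borel_measurable borel" by measurable
      from measurable_sets_borel[OF this edge_interval_borel[OF edge_interval_edom[OF wf that]]]
      show ?thesis by (simp add: I_def vimage_def)
    qed
    have Ii: "integrable lborel (\<lambda>t. indicat_real (I e) t *\<^sub>R h t)" if "e \<in> edges G" for e
      using integrable_mult_indicator[OF _ h, of "I e"] Im[OF that] by simp
    have nz: "\<sigma> e \<noteq> 0" "\<bar>\<sigma> e\<bar> = 1" if "e \<in> edges G" for e using s(1)[OF that] by auto
    show "set_integrable lborel (edom G e) (\<lambda>x. h (a e + \<sigma> e * x))" if e: "e \<in> edges G" for e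
      unfolding set_integrable_def I[OF e] by (rule lborel_integrable_real_affine[OF Ii[OF e] nz(1)[OF e]])
    have "(LINT x:edom G e|lborel. h (a e + \<sigma> e * x)) = (LINT t|lborel. indicat_real (I e) t *\<^sub>R h t)" if e: "e \<in> edges G" for e
      unfolding set_lebesgue_integral_def I[OF e]
      using lborel_integral_real_affine[OF nz(1)[OF e], of "\<lambda>t. indicat_real (I e) t *\<^sub>R h t" "a e"] nz(2)[OF e] by simp
    then have "(\<Sum>e\<in>edges G. LINT x:edom G e|lborel. h (a e + \<sigma> e * x)) = (\<Sum>e\<in>edges G. LINT t|lborel. indicat_real (I e) t *\<^sub>R h t)"
      by simp
    also have "\<dots> = (LINT t|lborel. (\<Sum>e\<in>edges G. indicat_real (I e) t *\<^sub>R h t))"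
      by (rule Bochner_Integration.integral_sum[symmetric]) (rule Ii)
    also have "\<dots> = (LINT t|lborel. h t)"
    proof (rule integral_cong_AE)
      have "AE t in lborel. t \<notin> {t. vertex_at G (\<phi> t) \<noteq> None}"
        using finite_vertex_times by (intro AE_not_in) (simp add: finite_imp_null_set_lborel)
      then show "AE t in lborel. (\<Sum>e\<in>edges G. indicat_real (I e) t *\<^sub>R h t) = h t"
      proof eventually_elim
        case (elim t)
        obtain e x where ex: "\<phi> t = (e, x)" by fastforce
        then have e: "e \<in> edges G" "x \<in> edom G e" using pos[of t] by (auto simp: positions_def)
        then have xi: "x \<in> inner e" using elim ex vertex_at_inner[of x e] by auto
        have "\<phi> (a e + \<sigma> e * x) = (e, x)" by (rule same_point_inner[OF xi s(2)[OF e]])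
        then have te: "t = a e + \<sigma> e * x" using inner_unique[OF ex _ xi] by blast
        have "t \<in> I e'  \<longleftrightarrow> e' = e" if e': "e' \<in> edges G" for e'
        proof
          assume "t \<in> I e'"
          then have y: "\<sigma> e' * (t - a e') \<in> edom G e'" by (simp add: I_def)
          have "a e' + \<sigma> e' * (\<sigma> e' * (t - a e')) = t" using s(1)[OF e'] by auto
          then have "same_point G (e', \<sigma> e' * (t - a e')) (e, x)" using same_point_sym[OF s(2)[OF e' y]] ex by simp
          then show "e' = e" using same_point_inner[OF xi] by blast
        next
          assume "e' = e"
          then show "t \<in> I e'" using te e s(1)[OF e(1)] by (auto simp: I_def)
        qed
        then have "(\<Sum>e'\<in>edges G. indicat_real (I e') t *\<^sub>R h t) = (\<Sum>e'\<in>edges G. if e' = e then h t else 0)"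
          by (intro sum.cong) (auto simp: indicator_def)
        then show ?case using e wf by (simp add: wf_mgraph_def)
      qed
    next
      show "(\<lambda>t. \<Sum>e\<in>edges G. indicat_real (I e) t *\<^sub>R h t) \<in> borel_measurable lborel"
        using Ii by (intro borel_measurable_sum) auto
    qed (use h in auto)
    finally show "(\<Sum>e\<in>edges G. LINT x:edom G e|lborel. h (a e + \<sigma> e * x)) = (LINT t|lborel. h t)" .
  qed
  have g2: "(g e x)\<^sup>2 = (soliton' (a e + \<sigma> e * x))\<^sup>2" if "e \<in> edges G" for e x
    using s(1)[OF that] by (auto simp: g_def)
  have u2: "Lnorm_pow G 2 u = mu_R"
    using integral[OF soliton_mass(1)] by (simp add: Lnorm_pow_def u_def soliton_mass(2))
  have u6: "Lnorm_pow G 6 u = mu_R / 2"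
    using integral[OF soliton_L6(1)] by (simp add: Lnorm_pow_def u_def soliton_L6(2) power_even_abs)
  have g2': "Lnorm_pow G 2 g = mu_R / 6"
    using integral[OF soliton'_L2(1)] g2 by (simp add: Lnorm_pow_def soliton'_L2(2) cong: sum.cong)
  have gc: "continuous_on A (g e)" for A e
    unfolding g_def by (intro continuous_intros continuous_on_compose2[OF soliton'_cont[of UNIV]]) auto
  have "H1pair G u g" unfolding H1pair_def
  proof (intro conjI ballI exI[of _ \<psi>])
    fix e assume e: "e \<in> edges G"
    show "set_borel_measurable lborel (edom G e) (g e)"
      by (rule continuous_on_set_borel_measurable[OF gc edge_interval_borel[OF edge_interval_edom[OF wf e]]])
    show "set_integrable lborel (edom G e) (\<lambda>x. (g e x)\<^sup>2)"
      unfolding g2[OF e] by (rule integrable[OF soliton'_L2(1) e])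
    show "set_integrable lborel (edom G e) (\<lambda>x. (u e x)\<^sup>2)"
      unfolding u_def by (rule integrable[OF soliton_mass(1) e])
    have i: "edge_interval (edom G e)" by (rule edge_interval_edom[OF wf e])
    show "u e 0 = \<psi> (src G e)" by (rule \<psi>[OF e edge_interval_0[OF i]]) (simp add: vertex_at_def)
    show "e \<notin> halflines G \<longrightarrow> u e (len G e) = \<psi> (tgt G e)"
    proof
      assume n: "e \<notin> halflines G"
      then have "0 < len G e" using wf e by (simp add: wf_mgraph_def)
      then show "u e (len G e) = \<psi> (tgt G e)" using n by (intro \<psi>[OF e]) (auto simp: vertex_at_def edom_def)
    qed
    fix x assume x: "x \<in> edom G e"
    have "(LINT y:{0..x}|lborel. g e y) = u e x - u e 0"
    proof (rule set_integral_FTC[OF edge_interval_ge0[OF i x] _ gc])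
      fix y
      have "((\<lambda>y. a e + \<sigma> e * y) has_real_derivative \<sigma> e) (at y within {0..x})" by (auto intro!: derivative_eq_intros)
      from DERIV_chain2[OF soliton_deriv[of "a e + \<sigma> e * y" UNIV] this]
      show "(u e has_real_derivative g e y) (at y within {0..x})" unfolding u_def[abs_def] g_def by (simp add: mult.commute)
    qed
    then show "u e x = u e 0 + (LINT y:{0..x}|lborel. g e y)" by simp
  qed
  then show ?thesis using u2 u6 g2' by (intro exI[of _ u] exI[of _ g]) (simp add: H1_mass_def energy_def)
qed

end

lemma from_line_imp_minimizer:
  assumes "wf_mgraph G" "from_line G X" "finite X"
  shows "\<exists>u g. (u, g) \<in> H1_mass G mu_R \<and> energy G u g = 0"
proof -
  from assms(2)[unfolded from_line_def] obtain \<phi> where "line_quotient G X \<phi>"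
    by (elim exE conjE) (erule meta_allE, erule meta_mp, rule line_quotient.intro[OF assms(1,3)], assumption+)
  then show ?thesis by (rule line_quotient.minimizer_exists)
qed

theorem theorem7p2:
  fixes G :: "('v, 'e) mgraph"
  assumes "wf_mgraph G" and "connected_mgraph G" and "noncompact G" and "assumption_H G"
  shows "mu_const G = mu_R \<and> energy_level G mu_R = 0 \<and>
         ((\<exists>u g. (u, g) \<in> H1_mass G mu_R \<and> energy G u g = 0) \<longleftrightarrow>
            (is_real_line G \<or> bubble_tower G))"
proof (intro conjI iffI)
  show "mu_const G = mu_R" by (rule mu_const_eq[OF assms(1,3,4)])
  show "energy_level G mu_R = 0" by (rule energy_level_eq[OF assms(1,3,4)])
  show "is_real_line G \<or> bubble_tower G" if "\<exists>u g. (u, g) \<in> H1_mass G mu_R \<and> energy G u g = 0"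
    using that minimizer_imp_line_or_tower[OF assms] by (auto simp: H1_mass_def)
  show "\<exists>u g. (u, g) \<in> H1_mass G mu_R \<and> energy G u g = 0" if "is_real_line G \<or> bubble_tower G"
    using that from_line_imp_minimizer[OF assms(1)] by (auto simp: is_real_line_def bubble_tower_def)
qed

end
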